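(* Let $p$ be a prime and let $G$ be a finite $p$-group such that $G_3\cong C_p$, $\Phi(G')=1$ and $G/G_3\cong M_p(n,m,1)$, where $n\ge m$, and $n>1$ if $p=2$. Then $G$ is isomorphic to one of the following groups, and the listed groups (different types, or the same type with different parameter values) are pairwise non-isomorphic: (F) one of the $3$-groups of maximal class of order $3^4$; In (G1)--(G3): $m>1$ if $p\le3$. (G1) $\langle a,b,c\mid a^{p^{m+1}}=b^{p^m}=c^p=1,[a,b]=c,[c,a]=1,[c,b]=a^{\nu p^m}\rangle$, where $\nu=1$ or a fixed quadratic non-residue modulo $p$; (G2) $\langle a,b,c,d\mid a^{p^m}=b^{p^m}=c^p=d^p=1,[a,b]=c,[c,a]=d,[c,b]=1,[d,a]=[d,b]=1\rangle$; (G3) $\langle a,b,c\mid a^{p^{m+1}}=b^{p^m}=c^p=1,[a,b]=c,[c,a]=a^{p^m},[c,b]=1\rangle$; (H1) $\langle a,b,c,d\mid a^4=b^2=c^2=d^2=1,[a,b]=c,[c,a]=d,[c,b]=[d,a]=[d,b]=1\rangle$; (H2) $\langle a,b,c\mid a^8=b^2=c^2=1,[a,b]=c,[c,a]=a^4,[c,b]=1\rangle$; (H3) $\langle a,b,c\mid a^8=c^2=1,b^2=a^4,[a,b]=c,[c,a]=b^2,[c,b]=1\rangle$; (I1) $\langle a,b,c,d\mid a^{2^n}=b^2=c^2=d^2=1,[a,b]=c,[c,a]=d,[c,b]=[d,a]=[d,b]=1\rangle$, where $n\ge3$; (I2) $\langle a,b,c\mid a^{2^{n+1}}=b^2=c^2=1,[a,b]=c,[c,a]=a^{2^n},[c,b]=1\rangle$,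 where $n\ge3$; (I3) $\langle a,b,c\mid a^{2^n}=b^4=c^2=1,[a,b]=c,[c,a]=b^2,[c,b]=1\rangle$, where $n\ge3$; In (J1)--(J6): $n>m$, and $m>1$ if $p=2$. (J1) $\langle a,b,c\mid a^{p^{n+1}}=b^{p^m}=c^p=1,[a,b]=c,[c,a]=1,[c,b]=a^{\nu p^n}\rangle$, where $\nu=1$ or a fixed quadratic non-residue modulo $p$; (J2) $\langle a,b,c\mid a^{p^{n+1}}=b^{p^m}=c^p=1,[a,b]=c,[c,a]=a^{p^n},[c,b]=1\rangle$; (J3) $\langle a,b,c\mid a^{p^n}=b^{p^{m+1}}=c^p=1,[a,b]=c,[c,a]=1,[c,b]=b^{p^m}\rangle$; (J4) $\langle a,b,c\mid a^{p^n}=b^{p^{m+1}}=c^p=1,[a,b]=c,[c,a]=b^{\nu p^m},[c,b]=1\rangle$, where $\nu=1$ or a fixed quadratic non-residue modulo $p$; (J5) $\langle a,b,c,d\mid a^{p^n}=b^{p^m}=c^p=d^p=1,[a,b]=c,[c,a]=1,[c,b]=d,[d,a]=[d,b]=1\rangle$; (J6) $\langle a,b,c,d\mid a^{p^n}=b^{p^m}=c^p=d^p=1,[a,b]=c,[c,a]=d,[c,b]=1,[d,a]=[d,b]=1\rangle$.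
   Context: All groups are finite $p$-groups; $G_3=[G',G]$, $\Phi(H)$ is the Frattini subgroup of $H$, $[x,y]=x^{-1}y^{-1}xy$. For $n\ge m\ge 1$ (with $n>1$ if $p=2$), $M_p(n,m,1)=\langle a,b,c\mid a^{p^n}=b^{p^m}=c^p=1,\ [a,b]=c,\ [c,a]=[c,b]=1\rangle$. A $3$-group of order $3^4$ is of maximal class if its nilpotency class is $3$. Where $\nu$ occurs, one quadratic non-residue modulo $p$ is fixed once and for all; for $p=2$ only $\nu=1$ occurs. Types (H), (I) are 2-groups. *)

theory Defs
  imports "HOL-Algebra.Elementary_Groups" "HOL-Algebra.Generated_Groups" "HOL-Number_Theory.Residues"
begin

section \<open>Free groups and presentations\<close>

text \<open>A letter \<open>(x, True)\<close> stands for the generator \<open>x\<close> and \<open>(x, False)\<close> for its inverse.\<close>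

type_synonym 'x word = "('x \<times> bool) list"

definition words :: "'x set \<Rightarrow> 'x word set" where
  "words A = lists (A \<times> UNIV)"

definition cancellation :: "'x set \<Rightarrow> ('x word \<times> 'x word) set" where
  "cancellation A =
    {(u @ [(x, e), (x, \<not> e)] @ v, u @ v) | u v x e. u \<in> words A \<and> v \<in> words A \<and> x \<in> A}"

definition free_eq :: "'x set \<Rightarrow> ('x word \<times> 'x word) set" where
  "free_eq A = (cancellation A \<union> (cancellation A)\<inverse>)\<^sup>*"

definition free_group :: "'x set \<Rightarrow> 'x word set monoid" where
  "free_group A =
    \<lparr>carrier = words A // free_eq A,
     monoid.mult = (\<lambda>U V. \<Union>u\<in>U. \<Union>v\<in>V. free_eq A `` {u @ v}),
     monoid.one = free_eq A `` {[]}\<rparr>"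

definition free_gen :: "'x set \<Rightarrow> 'x \<Rightarrow> 'x word set" where
  "free_gen A x = free_eq A `` {[(x, True)]}"

definition normal_closure :: "('a, 'b) monoid_scheme \<Rightarrow> 'a set \<Rightarrow> 'a set" where
  "normal_closure G S = \<Inter>{N. N \<lhd> G \<and> S \<subseteq> N}"

text \<open>A relation \<open>u = v\<close> is a pair \<open>(u, v)\<close> of elements of the free group.\<close>

definition presented_group ::
    "'x set \<Rightarrow> ('x word set \<times> 'x word set) set \<Rightarrow> 'x word set set monoid" where
  "presented_group A R =
    (let F = free_group A
     in F Mod normal_closure F {u \<otimes>\<^bsub>F\<^esub> inv\<^bsub>F\<^esub> v | u v. (u, v) \<in> R})"


section \<open>Commutators, lower central series, Frattini subgroup\<close>

definition commutator :: "('a, 'b) monoid_scheme \<Rightarrow> 'a \<Rightarrow> 'a \<Rightarrow> 'a" where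
  "commutator G x y = inv\<^bsub>G\<^esub> x \<otimes>\<^bsub>G\<^esub> inv\<^bsub>G\<^esub> y \<otimes>\<^bsub>G\<^esub> x \<otimes>\<^bsub>G\<^esub> y"

definition commutator_subgroup :: "('a, 'b) monoid_scheme \<Rightarrow> 'a set \<Rightarrow> 'a set \<Rightarrow> 'a set" where
  "commutator_subgroup G A B = generate G {commutator G x y | x y. x \<in> A \<and> y \<in> B}"

text \<open>The index is shifted: \<open>lower_central G i\<close> is the term usually numbered \<open>i + 1\<close>.\<close>

primrec lower_central :: "('a, 'b) monoid_scheme \<Rightarrow> nat \<Rightarrow> 'a set" where
  "lower_central G 0 = carrier G"
| "lower_central G (Suc i) = commutator_subgroup G (lower_central G i) (carrier G)"

definition has_nilpotency_class :: "('a, 'b) monoid_scheme \<Rightarrow> nat \<Rightarrow> bool" where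
  "has_nilpotency_class G k \<longleftrightarrow>
    lower_central G k = {\<one>\<^bsub>G\<^esub>} \<and> (\<forall>i<k. lower_central G i \<noteq> {\<one>\<^bsub>G\<^esub>})"

definition maximal_subgroup :: "'a set \<Rightarrow> ('a, 'b) monoid_scheme \<Rightarrow> bool" where
  "maximal_subgroup M G \<longleftrightarrow>
    subgroup M G \<and> M \<noteq> carrier G \<and>
    (\<forall>K. subgroup K G \<and> M \<subseteq> K \<longrightarrow> K = M \<or> K = carrier G)"

text \<open>The intersection with the carrier matters only if there are no maximal subgroups.\<close>

definition frattini :: "('a, 'b) monoid_scheme \<Rightarrow> 'a set" where
  "frattini G = carrier G \<inter> \<Inter>{M. maximal_subgroup M G}"

definition finite_p_group :: "nat \<Rightarrow> ('a, 'b) monoid_scheme \<Rightarrow> bool" where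
  "finite_p_group p G \<longleftrightarrow> group G \<and> finite (carrier G) \<and> (\<exists>k. order G = p ^ k)"

definition maximal_class_81 :: "('a, 'b) monoid_scheme \<Rightarrow> bool" where
  "maximal_class_81 G \<longleftrightarrow> group G \<and> order G = 3 ^ 4 \<and> has_nilpotency_class G 3"


section \<open>The groups of the classification\<close>

datatype gen = Gen_a | Gen_b | Gen_c | Gen_d

text \<open>
  The parameters are those of the presentations: \<open>m\<close> and \<open>\<nu>\<close> for \<open>G1\<close>; \<open>m\<close> for \<open>G2\<close>, \<open>G3\<close>;
  \<open>n\<close> for \<open>I1\<close> to \<open>I3\<close>; \<open>n\<close>, \<open>m\<close> and possibly \<open>\<nu>\<close> for \<open>J1\<close> to \<open>J6\<close>.
\<close>

datatype group_type =
    G1 nat int | G2 nat | G3 nat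
  | H1 | H2 | H3
  | I1 nat | I2 nat | I3 nat
  | J1 nat nat int | J2 nat nat | J3 nat nat | J4 nat nat int | J5 nat nat | J6 nat nat

context
  fixes G :: "('a, 'b) monoid_scheme" (structure)
begin

definition M_relations :: "nat \<Rightarrow> nat \<Rightarrow> nat \<Rightarrow> 'a \<Rightarrow> 'a \<Rightarrow> 'a \<Rightarrow> ('a \<times> 'a) set" where
  "M_relations p n m a b c =
    {(a [^] (p ^ n), \<one>), (b [^] (p ^ m), \<one>), (c [^] p, \<one>),
     (commutator G a b, c), (commutator G c a, \<one>), (commutator G c b, \<one>)}"

text \<open>The argument \<open>d\<close> is ignored for the types with only three generators.\<close>

fun relations :: "nat \<Rightarrow> group_type \<Rightarrow> 'a \<Rightarrow> 'a \<Rightarrow> 'a \<Rightarrow> 'a \<Rightarrow> ('a \<times> 'a) set" where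
  "relations p (G1 m \<nu>) a b c d =
    {(a [^] (p ^ (m + 1)), \<one>), (b [^] (p ^ m), \<one>), (c [^] p, \<one>),
     (commutator G a b, c), (commutator G c a, \<one>), (commutator G c b, a [^] (\<nu> * int (p ^ m)))}"
| "relations p (G2 m) a b c d =
    {(a [^] (p ^ m), \<one>), (b [^] (p ^ m), \<one>), (c [^] p, \<one>), (d [^] p, \<one>),
     (commutator G a b, c), (commutator G c a, d), (commutator G c b, \<one>),
     (commutator G d a, \<one>), (commutator G d b, \<one>)}"
| "relations p (G3 m) a b c d =
    {(a [^] (p ^ (m + 1)), \<one>), (b [^] (p ^ m), \<one>), (c [^] p, \<one>),
     (commutator G a b, c), (commutator G c a, a [^] (p ^ m)), (commutator G c b, \<one>)}"
| "relations p H1 a b c d =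
    {(a [^] (4::nat), \<one>), (b [^] (2::nat), \<one>), (c [^] (2::nat), \<one>), (d [^] (2::nat), \<one>),
     (commutator G a b, c), (commutator G c a, d), (commutator G c b, \<one>),
     (commutator G d a, \<one>), (commutator G d b, \<one>)}"
| "relations p H2 a b c d =
    {(a [^] (8::nat), \<one>), (b [^] (2::nat), \<one>), (c [^] (2::nat), \<one>),
     (commutator G a b, c), (commutator G c a, a [^] (4::nat)), (commutator G c b, \<one>)}"
| "relations p H3 a b c d =
    {(a [^] (8::nat), \<one>), (c [^] (2::nat), \<one>), (b [^] (2::nat), a [^] (4::nat)),
     (commutator G a b, c), (commutator G c a, b [^] (2::nat)), (commutator G c b, \<one>)}"
| "relations p (I1 n) a b c d =
    {(a [^] (2 ^ n :: nat), \<one>), (b [^] (2::nat), \<one>), (c [^] (2::nat), \<one>), (d [^] (2::nat), \<one>),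
     (commutator G a b, c), (commutator G c a, d), (commutator G c b, \<one>),
     (commutator G d a, \<one>), (commutator G d b, \<one>)}"
| "relations p (I2 n) a b c d =
    {(a [^] (2 ^ (n + 1) :: nat), \<one>), (b [^] (2::nat), \<one>), (c [^] (2::nat), \<one>),
     (commutator G a b, c), (commutator G c a, a [^] (2 ^ n :: nat)), (commutator G c b, \<one>)}"
| "relations p (I3 n) a b c d =
    {(a [^] (2 ^ n :: nat), \<one>), (b [^] (4::nat), \<one>), (c [^] (2::nat), \<one>),
     (commutator G a b, c), (commutator G c a, b [^] (2::nat)), (commutator G c b, \<one>)}"
| "relations p (J1 n m \<nu>) a b c d =
    {(a [^] (p ^ (n + 1)), \<one>), (b [^] (p ^ m), \<one>), (c [^] p, \<one>),
     (commutator G a b, c), (commutator G c a, \<one>), (commutator G c b, a [^] (\<nu> * int (p ^ n)))}"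
| "relations p (J2 n m) a b c d =
    {(a [^] (p ^ (n + 1)), \<one>), (b [^] (p ^ m), \<one>), (c [^] p, \<one>),
     (commutator G a b, c), (commutator G c a, a [^] (p ^ n)), (commutator G c b, \<one>)}"
| "relations p (J3 n m) a b c d =
    {(a [^] (p ^ n), \<one>), (b [^] (p ^ (m + 1)), \<one>), (c [^] p, \<one>),
     (commutator G a b, c), (commutator G c a, \<one>), (commutator G c b, b [^] (p ^ m))}"
| "relations p (J4 n m \<nu>) a b c d =
    {(a [^] (p ^ n), \<one>), (b [^] (p ^ (m + 1)), \<one>), (c [^] p, \<one>),
     (commutator G a b, c), (commutator G c a, b [^] (\<nu> * int (p ^ m))), (commutator G c b, \<one>)}"
| "relations p (J5 n m) a b c d =
    {(a [^] (p ^ n), \<one>), (b [^] (p ^ m), \<one>), (c [^] p, \<one>), (d [^] p, \<one>),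
     (commutator G a b, c), (commutator G c a, \<one>), (commutator G c b, d),
     (commutator G d a, \<one>), (commutator G d b, \<one>)}"
| "relations p (J6 n m) a b c d =
    {(a [^] (p ^ n), \<one>), (b [^] (p ^ m), \<one>), (c [^] p, \<one>), (d [^] p, \<one>),
     (commutator G a b, c), (commutator G c a, d), (commutator G c b, \<one>),
     (commutator G d a, \<one>), (commutator G d b, \<one>)}"

end

fun generators :: "group_type \<Rightarrow> gen set" where
  "generators (G2 m) = {Gen_a, Gen_b, Gen_c, Gen_d}"
| "generators H1 = {Gen_a, Gen_b, Gen_c, Gen_d}"
| "generators (I1 n) = {Gen_a, Gen_b, Gen_c, Gen_d}"
| "generators (J5 n m) = {Gen_a, Gen_b, Gen_c, Gen_d}"
| "generators (J6 n m) = {Gen_a, Gen_b, Gen_c, Gen_d}"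
| "generators _ = {Gen_a, Gen_b, Gen_c}"

definition M_group :: "nat \<Rightarrow> nat \<Rightarrow> nat \<Rightarrow> gen word set set monoid" where
  "M_group p n m =
    (let A = {Gen_a, Gen_b, Gen_c}
     in presented_group A
          (M_relations (free_group A) p n m (free_gen A Gen_a) (free_gen A Gen_b) (free_gen A Gen_c)))"

definition listed_group :: "nat \<Rightarrow> group_type \<Rightarrow> gen word set set monoid" where
  "listed_group p T =
    (let A = generators T
     in presented_group A
          (relations (free_group A) p T
            (free_gen A Gen_a) (free_gen A Gen_b) (free_gen A Gen_c) (free_gen A Gen_d)))"

definition nu_values :: "nat \<Rightarrow> int \<Rightarrow> int set" where
  "nu_values p \<eta> = (if p = 2 then {1} else {1, \<eta>})"

text \<open>
  \<open>listed p \<eta> T\<close>: the type \<open>T\<close> with its parameters occurs in the list for the prime \<open>p\<close>, where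
  \<open>\<eta>\<close> is the fixed quadratic non-residue. The condition \<open>m \<ge> 1\<close> is the standing one on the
  parameters of \<open>M_group\<close>; the types \<open>H1\<close> to \<open>I3\<close> are 2-groups.
\<close>

fun listed :: "nat \<Rightarrow> int \<Rightarrow> group_type \<Rightarrow> bool" where
  "listed p \<eta> (G1 m \<nu>) \<longleftrightarrow> m \<ge> 1 \<and> (p \<le> 3 \<longrightarrow> m > 1) \<and> \<nu> \<in> nu_values p \<eta>"
| "listed p \<eta> (G2 m) \<longleftrightarrow> m \<ge> 1 \<and> (p \<le> 3 \<longrightarrow> m > 1)"
| "listed p \<eta> (G3 m) \<longleftrightarrow> m \<ge> 1 \<and> (p \<le> 3 \<longrightarrow> m > 1)"
| "listed p \<eta> H1 \<longleftrightarrow> p = 2"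
| "listed p \<eta> H2 \<longleftrightarrow> p = 2"
| "listed p \<eta> H3 \<longleftrightarrow> p = 2"
| "listed p \<eta> (I1 n) \<longleftrightarrow> p = 2 \<and> n \<ge> 3"
| "listed p \<eta> (I2 n) \<longleftrightarrow> p = 2 \<and> n \<ge> 3"
| "listed p \<eta> (I3 n) \<longleftrightarrow> p = 2 \<and> n \<ge> 3"
| "listed p \<eta> (J1 n m \<nu>) \<longleftrightarrow> m \<ge> 1 \<and> n > m \<and> (p = 2 \<longrightarrow> m > 1) \<and> \<nu> \<in> nu_values p \<eta>"
| "listed p \<eta> (J2 n m) \<longleftrightarrow> m \<ge> 1 \<and> n > m \<and> (p = 2 \<longrightarrow> m > 1)"
| "listed p \<eta> (J3 n m) \<longleftrightarrow> m \<ge> 1 \<and> n > m \<and> (p = 2 \<longrightarrow> m > 1)"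
| "listed p \<eta> (J4 n m \<nu>) \<longleftrightarrow> m \<ge> 1 \<and> n > m \<and> (p = 2 \<longrightarrow> m > 1) \<and> \<nu> \<in> nu_values p \<eta>"
| "listed p \<eta> (J5 n m) \<longleftrightarrow> m \<ge> 1 \<and> n > m \<and> (p = 2 \<longrightarrow> m > 1)"
| "listed p \<eta> (J6 n m) \<longleftrightarrow> m \<ge> 1 \<and> n > m \<and> (p = 2 \<longrightarrow> m > 1)"

end

theory Submission
  imports Defs "HOL-Number_Theory.Euler_Criterion"
begin

text \<open>
  Put \<open>c = [a, b]\<close> for lifts \<open>a, b\<close> of the generators of \<open>G/G\<^sub>3\<close>, and let \<open>d\<close> generate the central
  subgroup \<open>G\<^sub>3\<close>. Then \<open>G\<close> is determined by residues \<open>i, j, r, s\<close> modulo \<open>p\<close> with \<open>[c, a] = d\<^sup>i\<close>,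
  \<open>[c, b] = d\<^sup>j\<close>, \<open>a ^ (p ^ n) = d\<^sup>r\<close>, \<open>b ^ (p ^ m) = d\<^sup>s\<close>; the hypothesis on the Frattini subgroup gives
  \<open>c ^ p = 1\<close>. All computations take place in one explicit group on quadruples of integers, which maps
  onto \<open>G\<close> by \<open>(x, y, z, w) \<mapsto> a\<^sup>x b\<^sup>y c\<^sup>z d\<^sup>w\<close> and whose finite quotients are models of order
  \<open>p ^ (n + m + 2)\<close> for all such groups. Two models are isomorphic iff \<open>n\<close> and \<open>m\<close> agree and the
  residues are related by a change of generators, so the theorem reduces to finding normal forms and
  invariants for this action modulo \<open>p\<close>.
\<close>

section \<open>A group on quadruples of integers\<close>

text \<open>A presentation does not reveal the order of its group, so every isomorphism with a model
  is found by counting: collection maps the model onto the group, and a lower bound for the order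
  makes this map injective. For a listed group the bound comes from a homomorphism back to the
  model, for \<open>G\<close> from the orders of \<open>G/G_3\<close> and \<open>G_3\<close>.

  Small primes enter through powers. In class 3 the k-th power of a^x b^y has correction terms with
  k choose 2 and k choose 3. For k = p^n and k = p^m these vanish modulo p, with two exceptions. For
  p = 3, n = m = 1 the power map can fail to be linear in (x, y); this is type (F). For p = 2, m = 1
  the relations force j = 0, and a term \<open>twist\<close> survives exactly for n = 2, which
  separates the types H from the types I.

  For n = m a change of generators is any invertible matrix modulo p; for n > m it is triangular. It
  multiplies the form (i, j) by its determinant, while passing from d to d^l rescales both (i, j)
  and (r, s). Invariants bilinear in the two forms therefore change by squares, which is the origin
  of \<nu>.\<close>

type_synonym quad = "int \<times> int \<times> int \<times> int"

text \<open>This is x choose 2 on all integers; exponents in \<open>umult\<close> may be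
  negative.\<close>

definition tri :: "int \<Rightarrow> int" where "tri x = x * (x - 1) div 2"

lemma two_tri: "2 * tri x = x * (x - 1)"
  unfolding tri_def by (rule dvd_mult_div_cancel) (cases "even x"; simp)

lemma tri_add: "tri (x + y) = tri x + tri y + x * y"
  using two_tri[of x] two_tri[of y] two_tri[of "x + y"] by (simp add: algebra_simps)

lemma tri_mult: "tri (x * y) = y\<^sup>2 * tri x + x * tri y"
proof -
  have "2 * tri (x * y) = y\<^sup>2 * (2 * tri x) + x * (2 * tri y)"
    unfolding two_tri by (simp add: algebra_simps power2_eq_square)
  then show ?thesis by simp
qed

lemma tri_0 [simp]: "tri 0 = 0" and tri_1 [simp]: "tri 1 = 0"
  by (simp_all add: tri_def)

fun umult :: "int \<Rightarrow> int \<Rightarrow> quad \<Rightarrow> quad \<Rightarrow> quad" where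
  "umult i j (x, y, z, w) (X, Y, Z, W) =
    (x + X, y + Y, z + Z - X * y,
     w + W + i * z * X - j * X * tri y - i * y * tri X + j * (z - X * y) * Y)"

text \<open>
  In \<open>umult\<close> the quadruple \<open>(x, y, z, w)\<close> stands for \<open>a\<^sup>x b\<^sup>y c\<^sup>z d\<^sup>w\<close>, where \<open>c = [a, b]\<close>, \<open>[c, a] = d\<^sup>i\<close>,
  \<open>[c, b] = d\<^sup>j\<close> and \<open>d\<close> is central; the product is what collection to the left gives.
\<close>

definition U :: "int \<Rightarrow> int \<Rightarrow> quad monoid" where
  "U i j = \<lparr>carrier = UNIV, monoid.mult = umult i j, one = (0, 0, 0, 0)\<rparr>"

lemma U_simps [simp]:
  "carrier (U i j) = UNIV" "x \<otimes>\<^bsub>U i j\<^esub> y = umult i j x y" "\<one>\<^bsub>U i j\<^esub> = (0, 0, 0, 0)"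
  by (simp_all add: U_def)

lemma umult_assoc: "umult i j (umult i j u v) w = umult i j u (umult i j v w)"
  by (cases u; cases v; cases w) (simp add: tri_add algebra_simps)

lemma umult_zero [simp]: "umult i j (0, 0, 0, 0) u = u" "umult i j u (0, 0, 0, 0) = u"
  by (cases u; simp)+

lemma group_U: "group (U i j)"
proof (rule groupI)
  fix u assume "u \<in> carrier (U i j)"
  obtain x y z w where u: "u = (x, y, z, w)" by (cases u)
  \<comment> \<open>A left inverse is solved for coordinate by coordinate: the third coordinate of
    the product is \<open>?Z + z + x * y\<close>, and \<open>?Z\<close> then enters the last
    one.\<close>
  let ?Z = "- z - x * y"
  let ?v = "(- x, - y, ?Z, - (w + i * ?Z * x - j * x * tri (- y) + i * y * tri x + j * (?Z + x * y) * y))"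
  have "umult i j ?v u = (0, 0, 0, 0)"
    by (simp add: u algebra_simps)
  then show "\<exists>v\<in>carrier (U i j). v \<otimes>\<^bsub>U i j\<^esub> u = \<one>\<^bsub>U i j\<^esub>"
    by (intro bexI[of _ ?v]) auto
qed (simp_all add: umult_assoc)

text \<open>With [x, y] = x^-1 y^-1 x y the commutator is what remains when x y is rewritten as y x.
  Commutators in \<open>U\<close> are thus read off from two products, without computing
  inverses.\<close>

lemma (in group) commutator_eqI:
  assumes "x \<in> carrier G" "y \<in> carrier G" "t \<in> carrier G" "x \<otimes> y = y \<otimes> x \<otimes> t"
  shows "commutator G x y = t"
proof -
  have "commutator G x y = inv x \<otimes> inv y \<otimes> (x \<otimes> y)"
    using assms by (simp add: commutator_def m_assoc)
  also have "\<dots> = inv (y \<otimes> x) \<otimes> (y \<otimes> x \<otimes> t)"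
    using assms by (simp add: inv_mult_group)
  also have "\<dots> = t"
    using assms(1-3) m_assoc[of "inv (y \<otimes> x)" "y \<otimes> x" t] by (simp del: inv_mult_group)
  finally show ?thesis .
qed

lemma (in group) commutator_closed [simp]:
  "x \<in> carrier G \<Longrightarrow> y \<in> carrier G \<Longrightarrow> commutator G x y \<in> carrier G"
  by (simp add: commutator_def)

lemma (in group) mult_commutator:
  assumes "x \<in> carrier G" "y \<in> carrier G"
  shows "x \<otimes> y = y \<otimes> x \<otimes> commutator G x y"
proof -
  have "y \<otimes> x \<otimes> commutator G x y = (y \<otimes> x) \<otimes> (inv (y \<otimes> x) \<otimes> (x \<otimes> y))"
    using assms by (simp add: commutator_def m_assoc inv_mult_group)
  then show ?thesis
    using assms by (simp add: m_assoc[symmetric] del: inv_mult_group)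
qed

lemma (in group) commutator_eq_one_iff:
  assumes "x \<in> carrier G" "y \<in> carrier G"
  shows "commutator G x y = \<one> \<longleftrightarrow> x \<otimes> y = y \<otimes> x"
  using assms mult_commutator[of x y] commutator_eqI[of x y \<one>] by auto

lemma (in group) hom_commutator:
  assumes "group H" "h \<in> hom G H" "x \<in> carrier G" "y \<in> carrier G"
  shows "h (commutator G x y) = commutator H (h x) (h y)"
proof -
  interpret H: group H by fact
  interpret h: group_hom G H h using assms by unfold_locales
  show ?thesis using assms by (simp add: commutator_def)
qed

text \<open>The last coordinate may stay unknown: it is an exponent of the central d and drops out
  of all further commutators. The third is the determinant of the change of generators.\<close>

lemma commutator_U:
  "\<exists>e. commutator (U i j) (x, y, z, w) (x', y', z', w') = (0, 0, x * y' - y * x', e)"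
proof -
  interpret group "U i j" by (rule group_U)
  obtain X Y Z W where c: "commutator (U i j) (x, y, z, w) (x', y', z', w') = (X, Y, Z, W)"
    by (metis prod_cases4)
  show ?thesis
    using mult_commutator[of "(x, y, z, w)" "(x', y', z', w')"] unfolding c
    by (auto simp: algebra_simps)
qed

lemma commutator_U_derived:
  "commutator (U i j) (0, 0, z, w) (x', y', z', w') = (0, 0, 0, z * (i * x' + j * y'))"
proof -
  interpret group "U i j" by (rule group_U)
  show ?thesis
    by (rule commutator_eqI) (simp_all add: algebra_simps)
qed

lemma commutator_U_gens: "commutator (U i j) (1, 0, 0, 0) (0, 1, 0, 0) = (0, 0, 1, 0)"
proof -
  interpret group "U i j" by (rule group_U)
  show ?thesis
    by (rule commutator_eqI) (simp_all add: algebra_simps)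
qed

lemma tri_int: "tri (int k) = int (k choose 2)"
  unfolding tri_def choose_two by (cases k) (simp_all add: zdiv_int algebra_simps)

text \<open>Collection in class 3: summing the linear coordinates over the factors gives k choose 2,
  summing the products that arise once more gives k choose 3. Divisibility of these two numbers by p
  decides how power relations transform.\<close>

lemma U_pow:
  "(x, y, z, w) [^]\<^bsub>U i j\<^esub> k =
    (int k * x, int k * y, int k * z - x * y * int (k choose 2),
     int k * w + int (k choose 2) * (i * x * z - j * x * tri y - i * y * tri x + j * y * z - j * x * y\<^sup>2)
       - int (k choose 3) * (i * x\<^sup>2 * y + 2 * j * x * y\<^sup>2))"
proof (induction k)
  case (Suc k)
  have s: "int (Suc k choose 2) = int (k choose 2) + int k"
          "int (Suc k choose 3) = int (k choose 3) + int (k choose 2)"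
    by (simp_all add: numeral_2_eq_2 numeral_3_eq_3)
  have t: "tri (int k * y) = y\<^sup>2 * int (k choose 2) + int k * tri y"
    by (simp add: tri_mult tri_int)
  show ?case
    unfolding s nat_pow_Suc Suc U_simps umult.simps t
    by (simp add: algebra_simps power2_eq_square)
qed (simp add: numeral_2_eq_2 numeral_3_eq_3)

lemma U_pow_gen:
  "(x, 0, 0, 0) [^]\<^bsub>U i j\<^esub> (k::nat) = (int k * x, 0, 0, 0)"
  "(0, y, 0, 0) [^]\<^bsub>U i j\<^esub> (k::nat) = (0, int k * y, 0, 0)"
  "(0, 0, z, w) [^]\<^bsub>U i j\<^esub> (k::nat) = (0, 0, int k * z, int k * w)"
  by (simp_all add: U_pow)

lemma U_int_pow:
  "(1, 0, 0, 0) [^]\<^bsub>U i j\<^esub> (k::int) = (k, 0, 0, 0)"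
  "(0, 1, 0, 0) [^]\<^bsub>U i j\<^esub> (k::int) = (0, k, 0, 0)"
  "(0, 0, z, w) [^]\<^bsub>U i j\<^esub> (k::int) = (0, 0, k * z, k * w)"
proof -
  interpret group "U i j" by (rule group_U)
  have inv: "inv\<^bsub>U i j\<^esub> u = v" if "umult i j v u = (0, 0, 0, 0)" for u v
    using that by (intro inv_equality) simp_all
  show "(1, 0, 0, 0) [^]\<^bsub>U i j\<^esub> k = (k, 0, 0, 0)"
    by (auto simp: int_pow_def2 U_pow_gen intro!: inv)
  show "(0, 1, 0, 0) [^]\<^bsub>U i j\<^esub> k = (0, k, 0, 0)"
    by (auto simp: int_pow_def2 U_pow_gen intro!: inv)
  show "(0, 0, z, w) [^]\<^bsub>U i j\<^esub> k = (0, 0, k * z, k * w)"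
    by (auto simp: int_pow_def2 U_pow_gen intro!: inv)
qed

section \<open>Finite quotients\<close>

text \<open>
  The last condition is forced by the relations: for \<open>p = 2\<close> and \<open>m = 1\<close> the square of \<open>b\<close> is central,
  so that \<open>1 = [a, b\<^sup>2] = c\<^sup>2 d\<^sup>j = d\<^sup>j\<close>.
\<close>

definition admissible :: "nat \<Rightarrow> nat \<Rightarrow> nat \<Rightarrow> int \<Rightarrow> bool" where
  "admissible p n m j \<longleftrightarrow>
    prime p \<and> 1 \<le> m \<and> m \<le> n \<and> (p = 2 \<longrightarrow> n > 1) \<and> (p = 2 \<and> m = 1 \<longrightarrow> int p dvd j)"

text \<open>
  \<open>nf\<close> picks a representative modulo the relations \<open>a ^ (p ^ n) = d\<^sup>r\<close>, \<open>b ^ (p ^ m) = d\<^sup>s\<close>,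
  \<open>c ^ p = d ^ p = 1\<close>; the elements of \<open>Q\<close> are these representatives.
\<close>

fun nf :: "nat \<Rightarrow> nat \<Rightarrow> nat \<Rightarrow> int \<Rightarrow> int \<Rightarrow> quad \<Rightarrow> quad" where
  "nf p n m r s (x, y, z, w) =
    (x mod int p ^ n, y mod int p ^ m, z mod int p,
     (w + r * (x div int p ^ n) + s * (y div int p ^ m)) mod int p)"

definition Q :: "nat \<Rightarrow> nat \<Rightarrow> nat \<Rightarrow> int \<Rightarrow> int \<Rightarrow> int \<Rightarrow> int \<Rightarrow> quad monoid" where
  "Q p n m i j r s =
    \<lparr>carrier = range (nf p n m r s), monoid.mult = (\<lambda>u v. nf p n m r s (umult i j u v)),
     one = (0, 0, 0, 0)\<rparr>"

lemma Q_simps [simp]: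
  "carrier (Q p n m i j r s) = range (nf p n m r s)"
  "u \<otimes>\<^bsub>Q p n m i j r s\<^esub> v = nf p n m r s (umult i j u v)"
  "\<one>\<^bsub>Q p n m i j r s\<^esub> = (0, 0, 0, 0)"
  by (simp_all add: Q_def)

text \<open>Twice \<open>tri (p ^ n)\<close> is p^n (p^n - 1), so only the division by 2 can do
  harm; for p = 2 the condition n > 1 supplies the spare factor. \<open>tri_mult\<close> brings in
  k.\<close>

lemma prime_dvd_tri:
  assumes "prime p" "1 \<le> n" "p = 2 \<longrightarrow> n > 1"
  shows "int p dvd tri (int p ^ n * k)"
proof -
  have pn: "int p dvd int p ^ n" using assms by (simp add: dvd_power)
  have "int p dvd tri (int p ^ n)"
  proof (cases "p = 2")
    case True
    then obtain l where "n = Suc (Suc l)" using assms by (metis less_imp_Suc_add One_nat_def add_Suc)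
    then have "tri (int p ^ n) = 2 * (2 ^ l * (4 * 2 ^ l - 1))"
      by (simp add: tri_def True)
    then show ?thesis by (simp add: True)
  next
    case False
    have "int p dvd 2 * tri (int p ^ n)"
      unfolding two_tri using pn by simp
    moreover have "coprime (int p) 2"
      using False assms(1) by (metis coprime_int_iff of_nat_numeral primes_coprime two_is_prime_nat)
    ultimately show ?thesis by (simp add: coprime_dvd_mult_right_iff)
  qed
  then show ?thesis using pn by (simp add: tri_mult)
qed

text \<open>Witnesses in place of \<open>mod\<close> and \<open>div\<close> turn well-definedness
  into polynomial identities. The signs: raising x by p^n k contributes a further d^(r k), which w'
  has to take back.\<close>

lemma nf_eq_iff:
  assumes "p > 0"
  shows "nf p n m r s (x, y, z, w) = nf p n m r s (x', y', z', w') \<longleftrightarrow>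
    (\<exists>k l t e. x' = x + int p ^ n * k \<and> y' = y + int p ^ m * l \<and> z' = z + int p * t \<and>
       w' = w - r * k - s * l + int p * e)" (is "?L = ?R")
proof
  assume L: ?L
  define k where "k = x' div int p ^ n - x div int p ^ n"
  define l where "l = y' div int p ^ m - y div int p ^ m"
  have "x' = x + int p ^ n * k"
  proof -
    have "x mod int p ^ n = x' mod int p ^ n" using L by simp
    then show ?thesis
      using mult_div_mod_eq[of "int p ^ n" x] mult_div_mod_eq[of "int p ^ n" x']
      unfolding k_def right_diff_distrib by linarith
  qed
  moreover have "y' = y + int p ^ m * l"
  proof -
    have "y mod int p ^ m = y' mod int p ^ m" using L by simp
    then show ?thesis
      using mult_div_mod_eq[of "int p ^ m" y] mult_div_mod_eq[of "int p ^ m" y']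
      unfolding l_def right_diff_distrib by linarith
  qed
  moreover obtain t where "z' = z + int p * t"
    using mod_eqE[of z "int p" z'] L by auto
  moreover obtain e where "w' + r * (x' div int p ^ n) + s * (y' div int p ^ m)
      = w + r * (x div int p ^ n) + s * (y div int p ^ m) + int p * e"
    using mod_eqE[of "w + r * (x div int p ^ n) + s * (y div int p ^ m)" "int p"
        "w' + r * (x' div int p ^ n) + s * (y' div int p ^ m)"] L
    by (auto simp del: mod_add_left_eq)
  then have "w' = w - r * k - s * l + int p * e"
    by (simp add: k_def l_def algebra_simps)
  ultimately show ?R by blast
next
  have P: "int p ^ n \<noteq> 0" "int p ^ m \<noteq> 0" using assms by auto
  assume ?R
  then obtain k l t e where *: "x' = x + int p ^ n * k" "y' = y + int p ^ m * l" "z' = z + int p * t"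
       "w' = w - r * k - s * l + int p * e" by blast
  have "w' + r * (x' div int p ^ n) + s * (y' div int p ^ m) =
     w + r * (x div int p ^ n) + s * (y div int p ^ m) + int p * e"
    using P by (simp add: * algebra_simps)
  then have "(w' + r * (x' div int p ^ n) + s * (y' div int p ^ m)) mod int p =
     (w + r * (x div int p ^ n) + s * (y div int p ^ m)) mod int p"
    by (simp del: mod_add_left_eq)
  then show ?L by (simp add: *(1-3))
qed

lemma nf_idem [simp]: "p > 0 \<Longrightarrow> nf p n m r s (nf p n m r s u) = nf p n m r s u"
  by (cases u) simp

lemma nf_0 [simp]: "nf p n m r s (0, 0, 0, 0) = (0, 0, 0, 0)"
  by simp

text \<open>Passing to the quotient is legitimate because multiplication respects the relations. The
  delicate terms are those with \<open>tri\<close>: changing an exponent by a multiple of p^n or p^m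
  must change them by a multiple of p.\<close>

lemma nf_umult_cong:
  assumes adm: "admissible p n m j"
    and u: "nf p n m r s u = nf p n m r s u'" and v: "nf p n m r s v = nf p n m r s v'"
  shows "nf p n m r s (umult i j u v) = nf p n m r s (umult i j u' v')"
proof -
  have p: "p > 0" using adm by (auto simp: admissible_def prime_gt_0_nat)
  obtain x y z w where U: "u = (x, y, z, w)" by (cases u)
  obtain X Y Z W where V: "v = (X, Y, Z, W)" by (cases v)
  obtain x' y' z' w' where U': "u' = (x', y', z', w')" by (cases u')
  obtain X' Y' Z' W' where V': "v' = (X', Y', Z', W')" by (cases v')
  obtain k l t e where *: "x' = x + int p ^ n * k" "y' = y + int p ^ m * l" "z' = z + int p * t"
       "w' = w - r * k - s * l + int p * e"
    using u unfolding U U' nf_eq_iff[OF p] by blast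
  obtain k' l' t' e' where **: "X' = X + int p ^ n * k'" "Y' = Y + int p ^ m * l'" "Z' = Z + int p * t'"
       "W' = W - r * k' - s * l' + int p * e'"
    using v unfolding V V' nf_eq_iff[OF p] by blast
  obtain pn where pn: "int p ^ n = int p * pn"
    using adm by (metis admissible_def dvd_def dvd_power le_trans less_le_trans zero_less_one)
  obtain pm where pm: "int p ^ m = int p * pm"
    using adm by (metis admissible_def dvd_def dvd_power less_le_trans zero_less_one)
  obtain q where q: "tri (int p ^ n * k') = int p * q"
    using prime_dvd_tri[of p n k'] adm by (auto simp: admissible_def)
  \<comment> \<open>For p = 2 and m = 1 the number \<open>tri (2 * l)\<close> can be odd; then
    \<open>admissible\<close> makes j even.\<close>
  have "int p dvd j * tri (int p ^ m * l)"
    using prime_dvd_tri[of p m l] adm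
    by (cases "p = 2 \<and> m = 1") (auto simp: admissible_def)
  then obtain q' where q': "j * tri (int p ^ m * l) = int p * q'" by blast
  define T where "T = tri (int p ^ m * l)"
  have jT: "j * T = int p * q'" using q' by (simp add: T_def)
  have tX: "tri X' = tri X + int p * q + X * (int p * pn * k')"
    by (simp add: ** tri_add q) (simp add: pn)
  have ty: "tri y' = tri y + T + y * (int p * pm * l)"
    by (simp add: * tri_add T_def) (simp add: pm)
  have z: "z' + Z' - X' * y' = (z + Z - X * y) + int p * (t + t' - X * pm * l - pn * k' * y - pn * k' * int p * pm * l)"
    unfolding * ** pn pm by (simp add: algebra_simps)
  let ?f = "\<lambda>x y z w X Y Z W tX ty. w + W + i * z * X - j * X * ty - i * y * tX + j * (z - X * y) * Y"
  have "\<exists>E. ?f x' y' z' w' X' Y' Z' W' (tri X') (tri y') =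
    ?f x y z w X Y Z W (tri X) (tri y) - r * (k + k') - s * (l + l') + int p * E"
  proof -
    define zz where "zz = t - pn * k' * y - X * pm * l - pn * k' * int p * pm * l"
    have zz: "z' - X' * y' = z - X * y + int p * zz"
      unfolding * ** pn pm zz_def by (simp add: algebra_simps)
    have 1: "j * (z' - X' * y') * Y' = j * (z - X * y) * Y + int p * (j * zz * Y' + j * (z - X * y) * pm * l')"
      unfolding zz by (simp add: ** pm algebra_simps)
    have 2: "i * z' * X' = i * z * X + int p * (i * t * X' + i * z * pn * k')"
      by (simp add: * ** pn algebra_simps)
    have 3: "j * X' * tri y' = j * X * tri y + int p * (X' * q' + j * X' * y * pm * l + j * pn * k' * tri y)"
    proof -
      have "j * X' * tri y' = j * X' * tri y + X' * (j * T) + j * X' * (y * (int p * pm * l))"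
        unfolding ty by (simp add: algebra_simps)
      moreover have "j * X' * tri y = j * X * tri y + int p * (j * pn * k' * tri y)"
        by (simp add: **(1) pn algebra_simps)
      moreover have "X' * (j * T) = int p * (X' * q')"
        unfolding jT by simp
      ultimately show ?thesis unfolding distrib_left by (simp add: ac_simps)
    qed
    have 4: "i * y' * tri X' = i * y * tri X + int p * (i * y' * q + i * y' * X * pn * k' + i * pm * l * tri X)"
      unfolding tX by (simp add: * pm algebra_simps)
    show ?thesis unfolding 1 2 3 4 *(4) **(4)
      by (rule exI[of _ "e + e' + (i * t * X' + i * z * pn * k') - (X' * q' + j * X' * y * pm * l + j * pn * k' * tri y)
         - (i * y' * q + i * y' * X * pn * k' + i * pm * l * tri X) + (j * zz * Y' + j * (z - X * y) * pm * l')"])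
        (simp add: algebra_simps)
  qed
  moreover have "x' + X' = x + X + int p ^ n * (k + k')" "y' + Y' = y + Y + int p ^ m * (l + l')"
    by (simp_all add: * ** algebra_simps)
  ultimately show ?thesis
    unfolding U V U' V' umult.simps nf_eq_iff[OF p] using z by blast
qed

lemma nf_hom_mult:
  assumes "admissible p n m j"
  shows "nf p n m r s (umult i j (nf p n m r s u) (nf p n m r s v)) = nf p n m r s (umult i j u v)"
proof -
  have "p > 0" using assms by (auto simp: admissible_def prime_gt_0_nat)
  then show ?thesis by (intro nf_umult_cong[OF assms]) simp_all
qed

lemma nf_hom: "admissible p n m j \<Longrightarrow> nf p n m r s \<in> hom (U i j) (Q p n m i j r s)"
  by (rule homI) (simp_all add: nf_hom_mult)

lemma group_Q:
  assumes adm: "admissible p n m j"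
  shows "group (Q p n m i j r s)"
proof -
  interpret group "U i j" by (rule group_U)
  have p: "p > 0" using adm by (auto simp: admissible_def prime_gt_0_nat)
  have [simp]: "nf p n m r s (umult i j (nf p n m r s u) v) = nf p n m r s (umult i j u v)"
    "nf p n m r s (umult i j u (nf p n m r s v)) = nf p n m r s (umult i j u v)" for u v
    using p by (auto intro!: nf_umult_cong[OF adm])
  show ?thesis
  proof (rule groupI)
    fix x assume "x \<in> carrier (Q p n m i j r s)"
    then obtain u where u: "x = nf p n m r s u" by auto
    show "\<exists>y\<in>carrier (Q p n m i j r s). y \<otimes>\<^bsub>Q p n m i j r s\<^esub> x = \<one>\<^bsub>Q p n m i j r s\<^esub>"
      using l_inv[of u] by (intro bexI[of _ "nf p n m r s (inv\<^bsub>U i j\<^esub> u)"]) (auto simp: u)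
  next
    show "\<one>\<^bsub>Q p n m i j r s\<^esub> \<in> carrier (Q p n m i j r s)"
      by (metis nf_0 Q_simps(1,3) rangeI)
  qed (use p in \<open>auto simp: umult_assoc simp del: nf.simps\<close>)
qed

lemma range_nf:
  assumes "p > 0"
  shows "range (nf p n m r s) =
    {0..<int p ^ n} \<times> {0..<int p ^ m} \<times> {0..<int p} \<times> {0..<int p}" (is "?L = ?R")
proof
  show "?L \<subseteq> ?R" using assms by (auto simp: image_subset_iff)
  show "?R \<subseteq> ?L"
  proof
    fix u assume "u \<in> ?R"
    then have "nf p n m r s u = u" by (cases u) auto
    then show "u \<in> ?L" by (metis rangeI)
  qed
qed

lemma finite_Q: "p > 0 \<Longrightarrow> finite (carrier (Q p n m i j r s))"
  by (simp add: range_nf)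

lemma card_Q: "p > 0 \<Longrightarrow> card (carrier (Q p n m i j r s)) = p ^ (n + m + 2)"
  by (simp add: range_nf card_cartesian_product power_add power2_eq_square nat_power_eq)

section \<open>The collection homomorphism\<close>

text \<open>Cancelling g extends the recurrence to negative exponents, so a closed form for integer
  powers takes one identity.\<close>

lemma (in group) int_pow_unique:
  assumes "g \<in> carrier G" "f 0 = \<one>" "\<And>k. f k \<in> carrier G" "\<And>k. f (k + 1) = f k \<otimes> g"
  shows "g [^] (k::int) = f k"
proof (induction k rule: int_induct[where k = 0])
  case (step1 k)
  then show ?case using assms by (simp add: int_pow_mult)
next
  case (step2 k)
  have "f (k - 1) \<otimes> g = g [^] (k - 1) \<otimes> g"
    using assms(1) assms(4)[of "k - 1"] step2 int_pow_mult[OF assms(1), of "k - 1" 1] by simp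
  then show ?case using assms by simp
qed (simp add: assms)

text \<open>Conjugation by x is a homomorphism taking u to v. Stated without inverses, this is the
  rule that moves x past a power during collection.\<close>

lemma (in group) int_pow_conj:
  assumes "u \<in> carrier G" "v \<in> carrier G" "x \<in> carrier G" "u \<otimes> x = x \<otimes> v"
  shows "u [^] (k::int) \<otimes> x = x \<otimes> v [^] k"
proof -
  have "v [^] k = inv x \<otimes> (u [^] k \<otimes> x)"
  proof (rule int_pow_unique)
    fix k :: int
    have "inv x \<otimes> (u [^] (k + 1) \<otimes> x) = inv x \<otimes> (u [^] k \<otimes> (u \<otimes> x))"
      using assms(1-3) by (simp add: int_pow_mult m_assoc)
    also have "\<dots> = inv x \<otimes> (u [^] k \<otimes> x) \<otimes> v"
      using assms(1-3) by (simp add: assms(4) m_assoc)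
    finally show "inv x \<otimes> (u [^] (k + 1) \<otimes> x) = inv x \<otimes> (u [^] k \<otimes> x) \<otimes> v" .
  qed (use assms in auto)
  then have "x \<otimes> v [^] k = x \<otimes> (inv x \<otimes> (u [^] k \<otimes> x))" by simp
  also have "\<dots> = u [^] k \<otimes> x"
    using assms(1-3) m_assoc[of x "inv x" "u [^] k \<otimes> x"] by simp
  finally show ?thesis by simp
qed

lemma (in group) int_pow_commute:
  assumes "u \<in> carrier G" "x \<in> carrier G" "u \<otimes> x = x \<otimes> u"
  shows "u [^] (k::int) \<otimes> x [^] (l::int) = x [^] l \<otimes> u [^] k"
proof -
  have "u [^] k \<otimes> x = x \<otimes> u [^] k" using int_pow_conj assms by blast
  then show ?thesis using int_pow_conj[of x x "u [^] k" l] assms by simp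
qed

text \<open>Only commutator relations are imposed, so the infinite group \<open>U i j\<close> maps
  to every such group; the power relations are added in \<open>rel\<close>.\<close>

locale class3 = group G for G (structure) +
  fixes i j :: int and a b c d
  assumes carr [simp]: "a \<in> carrier G" "b \<in> carrier G" "c \<in> carrier G" "d \<in> carrier G"
    and ab: "commutator G a b = c"
    and ca: "commutator G c a = d [^] i" and cb: "commutator G c b = d [^] j"
    and da: "d \<otimes> a = a \<otimes> d" and db: "d \<otimes> b = b \<otimes> d" and dc: "d \<otimes> c = c \<otimes> d"
begin

definition collect :: "quad \<Rightarrow> 'a" where
  "collect = (\<lambda>(x, y, z, w). a [^] x \<otimes> b [^] y \<otimes> c [^] z \<otimes> d [^] w)"

lemma collect_simp: "collect (x, y, z, w) = a [^] x \<otimes> b [^] y \<otimes> c [^] z \<otimes> d [^] w"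
  by (simp add: collect_def)

lemma collect_closed [simp]: "collect u \<in> carrier G"
  by (cases u) (simp add: collect_simp)

lemma d_pow_commute:
  "d [^] (k::int) \<otimes> a [^] (l::int) = a [^] l \<otimes> d [^] k"
  "d [^] (k::int) \<otimes> b [^] (l::int) = b [^] l \<otimes> d [^] k"
  "d [^] (k::int) \<otimes> c [^] (l::int) = c [^] l \<otimes> d [^] k"
  by (simp_all add: int_pow_commute da db dc)

lemma d_commute1:
  "d [^] (k::int) \<otimes> a = a \<otimes> d [^] k" "d [^] (k::int) \<otimes> b = b \<otimes> d [^] k"
  "d [^] (k::int) \<otimes> c = c \<otimes> d [^] k" "d [^] (k::int) \<otimes> inv c = inv c \<otimes> d [^] k"
  using d_pow_commute[of k 1] d_pow_commute(3)[of k "-1"] by (simp_all add: int_pow_neg)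

lemma c_pow_a: "c [^] (z::int) \<otimes> a = a \<otimes> (c [^] z \<otimes> d [^] (i * z))"
proof -
  have "c \<otimes> a = a \<otimes> (c \<otimes> d [^] i)"
    using mult_commutator[of c a] by (simp add: ca m_assoc)
  then have "c [^] z \<otimes> a = a \<otimes> (c \<otimes> d [^] i) [^] z"
    by (intro int_pow_conj) auto
  also have "(c \<otimes> d [^] i) [^] z = c [^] z \<otimes> d [^] (i * z)"
    by (subst int_pow_mult_distrib) (simp_all add: d_commute1 int_pow_pow)
  finally show ?thesis .
qed

lemma c_pow_b: "c [^] (z::int) \<otimes> b = b \<otimes> (c [^] z \<otimes> d [^] (j * z))"
proof -
  have "c \<otimes> b = b \<otimes> (c \<otimes> d [^] j)"
    using mult_commutator[of c b] by (simp add: cb m_assoc)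
  then have "c [^] z \<otimes> b = b \<otimes> (c \<otimes> d [^] j) [^] z"
    by (intro int_pow_conj) auto
  also have "(c \<otimes> d [^] j) [^] z = c [^] z \<otimes> d [^] (j * z)"
    by (subst int_pow_mult_distrib) (simp_all add: d_commute1 int_pow_pow)
  finally show ?thesis .
qed

text \<open>Since b a = a (b c^-1), the power b^y passes a as (b c^-1)^y. Gathering the factors c^-1
  on the right moves them past later factors b, each passage costing d^-j; for y >= 0 there are
  \<open>tri y\<close> passages.\<close>

lemma b_pow_a: "b [^] (y::int) \<otimes> a = a \<otimes> (b [^] y \<otimes> c [^] (- y) \<otimes> d [^] (- j * tri y))"
proof -
  have "a \<otimes> b = b \<otimes> a \<otimes> c" using mult_commutator[of a b] by (simp add: ab)
  then have "a \<otimes> b \<otimes> inv c = b \<otimes> a" by (simp add: m_assoc)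
  then have "b \<otimes> a = a \<otimes> (b \<otimes> inv c)" by (simp add: m_assoc)
  then have "b [^] y \<otimes> a = a \<otimes> (b \<otimes> inv c) [^] y"
    by (intro int_pow_conj) auto
  also have "(b \<otimes> inv c) [^] y = b [^] y \<otimes> c [^] (- y) \<otimes> d [^] (- j * tri y)"
  proof (rule int_pow_unique)
    fix y :: int
    have "b [^] y \<otimes> c [^] (- y) \<otimes> d [^] (- j * tri y) \<otimes> (b \<otimes> inv c)
      = b [^] y \<otimes> c [^] (- y) \<otimes> (d [^] (- j * tri y) \<otimes> b) \<otimes> inv c"
      by (simp add: m_assoc)
    also have "\<dots> = b [^] y \<otimes> (c [^] (- y) \<otimes> b) \<otimes> (d [^] (- j * tri y) \<otimes> inv c)"
      unfolding d_commute1(2) by (simp add: m_assoc)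
    also have "\<dots> = b [^] y \<otimes> b \<otimes> c [^] (- y) \<otimes> (d [^] (- j * y) \<otimes> inv c) \<otimes> d [^] (- j * tri y)"
      unfolding d_commute1(4)[of "- j * tri y"] c_pow_b by (simp add: m_assoc)
    also have "\<dots> = (b [^] y \<otimes> b) \<otimes> (c [^] (- y) \<otimes> inv c) \<otimes> (d [^] (- j * y) \<otimes> d [^] (- j * tri y))"
      unfolding d_commute1 by (simp add: m_assoc)
    also have "b [^] y \<otimes> b = b [^] (y + 1)"
      by (simp add: int_pow_mult)
    also have "c [^] (- y) \<otimes> inv c = c [^] (- (y + 1))"
      using int_pow_mult[of c "- y" "- 1"] int_pow_neg[of c 1] by simp
    also have "d [^] (- j * y) \<otimes> d [^] (- j * tri y) = d [^] (- j * tri (y + 1))"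
      using int_pow_mult[of d "- j * y" "- j * tri y"] by (simp add: tri_add algebra_simps)
    finally show "b [^] (y + 1) \<otimes> c [^] (- (y + 1)) \<otimes> d [^] (- j * tri (y + 1))
      = b [^] y \<otimes> c [^] (- y) \<otimes> d [^] (- j * tri y) \<otimes> (b \<otimes> inv c)" by (rule sym)
  qed simp_all
  finally show ?thesis .
qed

lemma collect_mult_d: "collect u \<otimes> d = collect (umult i j u (0, 0, 0, 1))"
proof -
  obtain x y z w where u: "u = (x, y, z, w)" by (cases u)
  show ?thesis by (simp add: u collect_simp int_pow_mult m_assoc)
qed

lemma collect_mult_c: "collect u \<otimes> c = collect (umult i j u (0, 0, 1, 0))"
proof -
  obtain x y z w where u: "u = (x, y, z, w)" by (cases u)
  have "collect u \<otimes> c = a [^] x \<otimes> b [^] y \<otimes> c [^] z \<otimes> (d [^] w \<otimes> c)"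
    by (simp add: u collect_simp m_assoc)
  then show ?thesis
    by (simp add: u collect_simp int_pow_mult m_assoc d_commute1)
qed

lemma collect_mult_b: "collect u \<otimes> b = collect (umult i j u (0, 1, 0, 0))"
proof -
  obtain x y z w where u: "u = (x, y, z, w)" by (cases u)
  have "collect u \<otimes> b = a [^] x \<otimes> b [^] y \<otimes> c [^] z \<otimes> (d [^] w \<otimes> b)"
    by (simp add: u collect_simp m_assoc)
  also have "\<dots> = a [^] x \<otimes> b [^] y \<otimes> (c [^] z \<otimes> b) \<otimes> d [^] w"
    by (simp add: d_commute1 m_assoc)
  also have "\<dots> = a [^] x \<otimes> (b [^] y \<otimes> b) \<otimes> c [^] z \<otimes> (d [^] (j * z) \<otimes> d [^] w)"
    unfolding c_pow_b by (simp add: m_assoc)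
  also have "\<dots> = collect (umult i j u (0, 1, 0, 0))"
    using int_pow_mult[of b y 1] int_pow_mult[of d "j * z" w]
    by (simp add: u collect_simp add.commute)
  finally show ?thesis .
qed

lemma collect_mult_a: "collect u \<otimes> a = collect (umult i j u (1, 0, 0, 0))"
proof -
  obtain x y z w where u: "u = (x, y, z, w)" by (cases u)
  have "collect u \<otimes> a = a [^] x \<otimes> b [^] y \<otimes> c [^] z \<otimes> (d [^] w \<otimes> a)"
    by (simp add: u collect_simp m_assoc)
  also have "\<dots> = a [^] x \<otimes> b [^] y \<otimes> (c [^] z \<otimes> a) \<otimes> d [^] w"
    by (simp add: d_commute1 m_assoc)
  also have "\<dots> = a [^] x \<otimes> (b [^] y \<otimes> a) \<otimes> c [^] z \<otimes> (d [^] (i * z) \<otimes> d [^] w)"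
    unfolding c_pow_a by (simp add: m_assoc)
  also have "\<dots> = (a [^] x \<otimes> a) \<otimes> b [^] y \<otimes> c [^] (- y) \<otimes> (d [^] (- j * tri y) \<otimes> c [^] z)
      \<otimes> (d [^] (i * z) \<otimes> d [^] w)"
    unfolding b_pow_a by (simp add: m_assoc)
  also have "\<dots> = (a [^] x \<otimes> a) \<otimes> b [^] y \<otimes> (c [^] (- y) \<otimes> c [^] z)
      \<otimes> (d [^] (- j * tri y) \<otimes> (d [^] (i * z) \<otimes> d [^] w))"
    unfolding d_pow_commute by (simp add: m_assoc)
  also have "a [^] x \<otimes> a = a [^] (x + 1)" by (simp add: int_pow_mult)
  also have "c [^] (- y) \<otimes> c [^] z = c [^] (z - y)" by (simp add: int_pow_mult[symmetric])
  also have "d [^] (- j * tri y) \<otimes> (d [^] (i * z) \<otimes> d [^] w) = d [^] (w + i * z - j * tri y)"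
    by (simp add: int_pow_mult[symmetric] algebra_simps)
  finally show ?thesis by (simp add: u collect_simp)
qed

lemma collect_gens [simp]:
  "collect (1, 0, 0, 0) = a" "collect (0, 1, 0, 0) = b" "collect (0, 0, 1, 0) = c"
  "collect (0, 0, 0, 1) = d" "collect (0, 0, 0, 0) = \<one>" "collect (0, 0, 0, w) = d [^] w"
  by (simp_all add: collect_simp)

text \<open>
  The right factors for which \<open>collect\<close> is multiplicative form a subgroup, so it suffices to collect
  a single generator.
\<close>

lemma collect_hom: "collect \<in> hom (U i j) G"
proof -
  interpret U: group "U i j" by (rule group_U)
  define S where "S = {v. \<forall>u. collect (umult i j u v) = collect u \<otimes> collect v}"
  have SD: "collect (umult i j u v) = collect u \<otimes> collect v" if "v \<in> S" for u v
    using that unfolding S_def by blast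
  have mult: "umult i j v v' \<in> S" if "v \<in> S" "v' \<in> S" for v v'
    unfolding S_def mem_Collect_eq
    by (metis SD that umult_assoc m_assoc collect_closed)
  have inv: "inv\<^bsub>U i j\<^esub> v \<in> S" if "v \<in> S" for v
  proof -
    have *: "umult i j (umult i j u (inv\<^bsub>U i j\<^esub> v)) v = u" for u
      using U.m_assoc[of u "inv\<^bsub>U i j\<^esub> v" v] U.l_inv[of v] U.r_one[of u] by simp
    have "collect (umult i j u (inv\<^bsub>U i j\<^esub> v)) \<otimes> collect v = collect u" for u
      using SD[OF that] *[of u] by metis
    then have **: "collect (umult i j u (inv\<^bsub>U i j\<^esub> v)) = collect u \<otimes> inv collect v" for u
      by (metis collect_closed inv_solve_right)
    from **[of "(0, 0, 0, 0)"] have "collect (inv\<^bsub>U i j\<^esub> v) = inv collect v" by simp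
    with ** show ?thesis by (simp add: S_def)
  qed
  have g: "(1, 0, 0, 0) \<in> S" "(0, 1, 0, 0) \<in> S" "(0, 0, 1, 0) \<in> S" "(0, 0, 0, 1) \<in> S"
    using collect_mult_a collect_mult_b collect_mult_c collect_mult_d
    by (auto simp: S_def simp del: umult.simps)
  have "subgroup S (U i j)"
    using mult inv g(1) by (intro U.subgroupI) auto
  note pow = U.subgroup_int_pow_closed[OF this]
  have "v \<in> S" for v
  proof -
    obtain x y z w where "v = (x, y, z, w)" by (cases v)
    moreover have "umult i j (umult i j (umult i j ((1, 0, 0, 0) [^]\<^bsub>U i j\<^esub> x) ((0, 1, 0, 0) [^]\<^bsub>U i j\<^esub> y))
        ((0, 0, 1, 0) [^]\<^bsub>U i j\<^esub> z)) ((0, 0, 0, 1) [^]\<^bsub>U i j\<^esub> w) \<in> S"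
      by (intro mult pow g)
    ultimately show ?thesis by (simp add: U_int_pow)
  qed
  then show ?thesis by (auto simp: hom_def S_def)
qed

lemma subgroup_range_collect: "subgroup (range collect) G"
proof -
  interpret U: group "U i j" by (rule group_U)
  interpret h: group_hom "U i j" G collect using collect_hom by unfold_locales
  show ?thesis using h.img_is_subgroup by simp
qed

end

text \<open>A tuple may be degenerate, even all identities. By itself it gives a homomorphism from
  \<open>Q\<close>; generation and injectivity are separate matters.\<close>

definition rel where
  "rel G p n m i j r s a b c d \<longleftrightarrow> class3 G i j a b c d \<and>
    c [^]\<^bsub>G\<^esub> (p::nat) = \<one>\<^bsub>G\<^esub> \<and> d [^]\<^bsub>G\<^esub> p = \<one>\<^bsub>G\<^esub> \<and>
    a [^]\<^bsub>G\<^esub> (p ^ n) = d [^]\<^bsub>G\<^esub> (r::int) \<and> b [^]\<^bsub>G\<^esub> (p ^ m) = d [^]\<^bsub>G\<^esub> (s::int)"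

text \<open>A multiple p^n k in the exponent of a becomes d^(r k), likewise for b; both cancel
  against the correction of the last coordinate in \<open>nf_eq_iff\<close>.\<close>

lemma (in class3) collect_nf:
  assumes rel: "rel G p n m i j r s a b c d" and p: "p > 0"
    and eq: "nf p n m r s u = nf p n m r s u'"
  shows "collect u = collect u'"
proof -
  obtain x y z w where U: "u = (x, y, z, w)" by (cases u)
  obtain x' y' z' w' where U': "u' = (x', y', z', w')" by (cases u')
  obtain k l t e where *: "x' = x + int p ^ n * k" "y' = y + int p ^ m * l" "z' = z + int p * t"
       "w' = w - r * k - s * l + int p * e"
    using eq unfolding U U' nf_eq_iff[OF p] by blast
  have "a [^] (int p ^ n) = d [^] r" "b [^] (int p ^ m) = d [^] s" "c [^] int p = \<one>" "d [^] int p = \<one>"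
    using rel int_pow_int[of G a "p ^ n"] int_pow_int[of G b "p ^ m"] by (auto simp: rel_def int_pow_int)
  then have "a [^] x' = a [^] x \<otimes> d [^] (r * k)" "b [^] y' = b [^] y \<otimes> d [^] (s * l)"
    "c [^] z' = c [^] z" "d [^] (int p * e) = \<one>"
    by (simp_all add: * int_pow_mult int_pow_pow[symmetric])
  then have "collect u' = a [^] x \<otimes> (d [^] (r * k) \<otimes> b [^] y) \<otimes> (d [^] (s * l) \<otimes> c [^] z) \<otimes> d [^] w'"
    by (simp add: U' collect_simp m_assoc)
  also have "\<dots> = a [^] x \<otimes> b [^] y \<otimes> (d [^] (r * k) \<otimes> c [^] z) \<otimes> (d [^] (s * l) \<otimes> d [^] w')"
    unfolding d_pow_commute(2) d_pow_commute(3)[of "s * l"] by (simp add: m_assoc)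
  also have "\<dots> = a [^] x \<otimes> b [^] y \<otimes> c [^] z \<otimes> (d [^] (r * k) \<otimes> (d [^] (s * l) \<otimes> d [^] w'))"
    unfolding d_pow_commute by (simp add: m_assoc)
  also have "d [^] (r * k) \<otimes> (d [^] (s * l) \<otimes> d [^] w') = d [^] (w + int p * e)"
    by (simp add: int_pow_mult[symmetric] * algebra_simps)
  also have "\<dots> = d [^] w" using \<open>d [^] (int p * e) = \<one>\<close> by (simp add: int_pow_mult)
  finally show ?thesis by (simp add: U collect_simp)
qed

lemma (in class3) collect_hom_Q:
  assumes rel: "rel G p n m i j r s a b c d" and p: "p > 0"
  shows "collect \<in> hom (Q p n m i j r s) G"
proof (rule homI)
  fix u v
  show "collect (u \<otimes>\<^bsub>Q p n m i j r s\<^esub> v) = collect u \<otimes> collect v"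
    using collect_nf[OF rel p, of "nf p n m r s (umult i j u v)" "umult i j u v"]
      hom_mult[OF collect_hom, of u v] p by simp
qed simp

lemma (in class3) collect_image_Q:
  assumes rel: "rel G p n m i j r s a b c d" and p: "p > 0"
  shows "collect ` carrier (Q p n m i j r s) = range collect"
  using collect_nf[OF rel p, of "nf p n m r s u" u for u] p
  by (auto simp: image_iff) (metis nf_idem)

text \<open>A surjection from p^(n+m+2) elements onto at least as many is injective. An isomorphism
  therefore costs three things: relations, generation and a lower bound for the order.\<close>

lemma rel_imp_iso_Q:
  assumes rel: "rel G p n m i j r s a b c d" and p: "p > 0"
    and gen: "carrier G \<subseteq> range (class3.collect G a b c d)"
    and card: "p ^ (n + m + 2) \<le> card (carrier G)"
  shows "Q p n m i j r s \<cong> G"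
proof -
  interpret class3 G i j a b c d using rel by (simp add: rel_def)
  have img: "collect ` carrier (Q p n m i j r s) = carrier G"
    unfolding collect_image_Q[OF rel p] using gen by auto
  have "card (collect ` carrier (Q p n m i j r s)) = card (carrier (Q p n m i j r s))"
    using card_image_le[OF finite_Q[OF p], of collect n m i j r s] card
    unfolding img card_Q[OF p] by (rule antisym)
  then have "inj_on collect (carrier (Q p n m i j r s))"
    by (rule eq_card_imp_inj_on[OF finite_Q[OF p]])
  then have "collect \<in> iso (Q p n m i j r s) G"
    using collect_hom_Q[OF rel p] img by (simp add: iso_def bij_betw_def del: Q_simps)
  then show ?thesis by (rule is_isoI)
qed

lemma rel_hom_image:
  assumes rel: "rel G p n m i j r s a b c d" and H: "group H" and h: "h \<in> hom G H"
  shows "rel H p n m i j r s (h a) (h b) (h c) (h d)"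
proof -
  interpret class3 G i j a b c d using rel by (simp add: rel_def)
  interpret H: group H by fact
  interpret h: group_hom G H h using h by unfold_locales
  have "class3 H i j (h a) (h b) (h c) (h d)"
  proof
    show "commutator H (h a) (h b) = h c"
      using hom_commutator[OF H h, of a b] ab by simp
    show "commutator H (h c) (h a) = h d [^]\<^bsub>H\<^esub> i"
      using hom_commutator[OF H h, of c a] ca h.hom_int_pow[of d i] by simp
    show "commutator H (h c) (h b) = h d [^]\<^bsub>H\<^esub> j"
      using hom_commutator[OF H h, of c b] cb h.hom_int_pow[of d j] by simp
    show "h d \<otimes>\<^bsub>H\<^esub> h a = h a \<otimes>\<^bsub>H\<^esub> h d"
      using h.hom_mult[of d a] h.hom_mult[of a d] da by simp
    show "h d \<otimes>\<^bsub>H\<^esub> h b = h b \<otimes>\<^bsub>H\<^esub> h d"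
      using h.hom_mult[of d b] h.hom_mult[of b d] db by simp
    show "h d \<otimes>\<^bsub>H\<^esub> h c = h c \<otimes>\<^bsub>H\<^esub> h d"
      using h.hom_mult[of d c] h.hom_mult[of c d] dc by simp
  qed simp_all
  moreover have "h c [^]\<^bsub>H\<^esub> p = \<one>\<^bsub>H\<^esub>" "h d [^]\<^bsub>H\<^esub> p = \<one>\<^bsub>H\<^esub>"
    using rel h.hom_nat_pow[of c p] h.hom_nat_pow[of d p] by (simp_all add: rel_def)
  moreover have "h a [^]\<^bsub>H\<^esub> (p ^ n) = h d [^]\<^bsub>H\<^esub> r" "h b [^]\<^bsub>H\<^esub> (p ^ m) = h d [^]\<^bsub>H\<^esub> s"
    using rel h.hom_nat_pow[of a "p ^ n"] h.hom_nat_pow[of b "p ^ m"] h.hom_int_pow[of d r] h.hom_int_pow[of d s]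
    by (simp_all add: rel_def)
  ultimately show ?thesis by (simp add: rel_def)
qed

lemma Q_pow:
  assumes "admissible p n m j"
  shows "nf p n m r s u [^]\<^bsub>Q p n m i j r s\<^esub> (k::nat) = nf p n m r s (u [^]\<^bsub>U i j\<^esub> k)"
  using hom_nat_pow[OF nf_hom[OF assms] _ group_U group_Q[OF assms]] by simp

lemma Q_int_pow:
  assumes "admissible p n m j"
  shows "nf p n m r s u [^]\<^bsub>Q p n m i j r s\<^esub> (k::int) = nf p n m r s (u [^]\<^bsub>U i j\<^esub> k)"
  using hom_int_pow[OF nf_hom[OF assms] _ group_U group_Q[OF assms]] by simp

lemma Q_commutator:
  assumes "admissible p n m j"
  shows "commutator (Q p n m i j r s) (nf p n m r s u) (nf p n m r s v) =
    nf p n m r s (commutator (U i j) u v)"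
  using group.hom_commutator[OF group_U group_Q[OF assms] nf_hom[OF assms]] by simp

section \<open>Change of generators\<close>

lemma admissible_p:
  assumes "admissible p n m j"
  shows "prime p" "p > 0" "p > 1" "prime (int p)" "1 \<le> m" "m \<le> n"
  using assms prime_gt_1_nat[of p] by (auto simp: admissible_def prime_gt_0_nat)

lemma nf_d_eq_iff: "nf p n m r s (0, 0, 0, w) = nf p n m r s (0, 0, 0, w') \<longleftrightarrow> [w = w'] (mod int p)"
  by (simp add: cong_def)

lemma nf_eq_d_iff:
  "nf p n m r s (x, y, z, w') = nf p n m r s (0, 0, 0, w) \<longleftrightarrow>
    int p ^ n dvd x \<and> int p ^ m dvd y \<and> int p dvd z \<and>
    [w' + r * (x div int p ^ n) + s * (y div int p ^ m) = w] (mod int p)"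
  by (simp add: cong_def mod_eq_0_iff_dvd)

lemma rel_Q:
  assumes "admissible p n m j"
  shows "rel (Q p n m i j r s) p n m i j r s (nf p n m r s (1, 0, 0, 0)) (nf p n m r s (0, 1, 0, 0))
    (nf p n m r s (0, 0, 1, 0)) (nf p n m r s (0, 0, 0, 1))"
proof -
  note p = admissible_p[OF assms]
  interpret group "Q p n m i j r s" by (rule group_Q[OF assms])
  have "class3 (Q p n m i j r s) i j (nf p n m r s (1, 0, 0, 0)) (nf p n m r s (0, 1, 0, 0))
    (nf p n m r s (0, 0, 1, 0)) (nf p n m r s (0, 0, 0, 1))"
    by unfold_locales
      (simp_all add: Q_commutator[OF assms] Q_int_pow[OF assms] commutator_U_gens commutator_U_derived
        U_int_pow nf_hom_mult[OF assms] del: nf.simps)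
  then show ?thesis
    unfolding rel_def Q_pow[OF assms] Q_int_pow[OF assms] U_pow_gen U_int_pow
    using p by (auto simp: cong_def)
qed

section \<open>Powers of the new generators\<close>

lemma prime_dvd_choose_2:
  assumes "prime p" "1 \<le> n" "p = 2 \<longrightarrow> n > 1"
  shows "int p dvd int (p ^ n choose 2)"
  using prime_dvd_tri[OF assms, of 1] tri_int[of "p ^ n"] by simp

text \<open>Here 3 (N choose 3) = N (N - 1 choose 2) with N = p^n, so only p = 3 can lose a factor,
  and n > 1 provides a spare one. The excluded value is 3 choose 3 = 1.\<close>

lemma prime_dvd_choose_3:
  assumes p: "prime p" and n: "1 \<le> n" "p = 3 \<longrightarrow> n > 1"
  shows "int p dvd int (p ^ n choose 3)"
proof -
  have eq: "3 * (p ^ n choose 3) = p ^ n * ((p ^ n - 1) choose 2)"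
    using times_binomial_minus1_eq[of 3 "p ^ n"] by simp
  have "p dvd p ^ n choose 3"
  proof (cases "p = 3")
    case True
    then obtain l where "n = Suc (Suc l)" using n by (metis less_imp_Suc_add One_nat_def add_Suc)
    then have "p ^ n choose 3 = p * (p ^ l * ((p ^ n - 1) choose 2))"
      using eq True by simp
    then show ?thesis by simp
  next
    case False
    then have "coprime p 3" using p by (simp add: primes_coprime)
    moreover have "p dvd 3 * (p ^ n choose 3)"
      unfolding eq using n by (simp add: dvd_power)
    ultimately show ?thesis by (simp add: coprime_dvd_mult_right_iff)
  qed
  then show ?thesis by simp
qed

text \<open>All binomial corrections vanish modulo p, so the p^n-th power is linear in (x, y);
  b^(p^n y) is the p^(n-m) y-th power of b^(p^m), that is, of d^s.\<close>

lemma nf_pow_a: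
  assumes adm: "admissible p n m j" and 3: "\<not> (p = 3 \<and> n = 1)"
  shows "nf p n m r s ((x, y, z, w) [^]\<^bsub>U i j\<^esub> (p ^ n)) = nf p n m r s (0, 0, 0, r * x + s * int p ^ (n - m) * y)"
proof -
  note p = admissible_p[OF adm]
  have n: "int p dvd int p ^ n" using p by (simp add: dvd_power)
  have c2: "int p dvd int (p ^ n choose 2)"
    using adm by (intro prime_dvd_choose_2) (auto simp: admissible_def)
  have c3: "int p dvd int (p ^ n choose 3)"
    using adm 3 by (intro prime_dvd_choose_3) (auto simp: admissible_def)
  have nm: "int p ^ n = int p ^ m * int p ^ (n - m)"
    using p by (simp flip: power_add)
  have "int p ^ n * y div int p ^ m = int p ^ (n - m) * y"
    using p by (simp add: nm mult.assoc)
  moreover have "[int p ^ n * w + int (p ^ n choose 2) * A - int (p ^ n choose 3) * B = 0] (mod int p)" for A B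
    using n c2 c3 by (simp add: cong_0_iff)
  then have "[int p ^ n * w + int (p ^ n choose 2) * A - int (p ^ n choose 3) * B + (r * x + s * (int p ^ (n - m) * y))
     = r * x + s * (int p ^ (n - m) * y)] (mod int p)" for A B
    using cong_add[OF _ cong_refl] by fastforce
  ultimately show ?thesis
    unfolding U_pow nf_eq_d_iff using p n c2 by (simp add: nm mult.assoc add.assoc)
qed

text \<open>
  The contribution of \<open>[c, a]\<close> to the \<open>p ^ m\<close>-th power of \<open>a ^ (p ^ (n - m) * x) b\<^sup>y\<close>; it survives only
  for the groups with \<open>G/G\<^sub>3 = M\<^sub>2(2,1,1)\<close>.
\<close>

definition twist :: "nat \<Rightarrow> nat \<Rightarrow> nat \<Rightarrow> int \<Rightarrow> int" where
  "twist p n m t = (if p = 2 \<and> m = 1 \<and> n = 2 then t else 0)"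

text \<open>The first exponent has to be a multiple of p^(n-m) for the p^m-th power to fall into the
  subgroup generated by d. When a binomial coefficient is a unit modulo p, this factor, divisible by
  p for m < n, takes over.\<close>

lemma nf_pow_b:
  assumes adm: "admissible p n m j" and 3: "\<not> (p = 3 \<and> n = 1)"
  shows "nf p n m r s ((int p ^ (n - m) * x, y, z, w) [^]\<^bsub>U i j\<^esub> (p ^ m)) =
    nf p n m r s (0, 0, 0, r * x + s * y + twist p n m (i * x * y))"
proof -
  note p = admissible_p[OF adm]
  have m: "int p dvd int p ^ m" using p by (simp add: dvd_power)
  have nm: "int p ^ n = int p ^ m * int p ^ (n - m)"
    using p by (simp flip: power_add)
  define X where "X = int p ^ (n - m) * x"
  define A where "A = i * X * z - j * X * tri y - i * y * tri X + j * y * z - j * X * y\<^sup>2"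
  define B where "B = i * X\<^sup>2 * y + 2 * j * X * y\<^sup>2"
  have X: "int p dvd X" if "m < n"
    using that by (simp add: X_def dvd_power)
  have c2: "int p dvd int (p ^ m choose 2)" if "\<not> (p = 2 \<and> m = 1)"
    using p that by (intro prime_dvd_choose_2) auto
  have c3: "int p dvd int (p ^ m choose 3)" if "\<not> (p = 3 \<and> m = 1)"
    using p that by (intro prime_dvd_choose_3) auto
  \<comment> \<open>For p = 3, m = 1 the binomial coefficient is 1, but then m < n and both terms of
    \<open>B\<close> contain \<open>X\<close>.\<close>
  have 1: "int p dvd int (p ^ m choose 3) * B"
  proof (cases "p = 3 \<and> m = 1")
    case True
    then have "m < n" using 3 p by auto
    then show ?thesis using X by (auto simp: B_def power2_eq_square)
  qed (use c3 in auto)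
  have 2: "int p dvd X * y * int (p ^ m choose 2)"
  proof (cases "p = 2 \<and> m = 1")
    case True
    then have "m < n" using adm by (auto simp: admissible_def)
    then show ?thesis using X by auto
  qed (use c2 in auto)
  have 3: "[int (p ^ m choose 2) * A = twist p n m (i * x * y)] (mod int p)"
  proof (cases "p = 2 \<and> m = 1")
    case True
    then have mn: "m < n" and j: "even j" using adm by (auto simp: admissible_def)
    have "even X" using X[OF mn] True by simp
    have c: "int (p ^ m choose 2) = 1" using True by simp
    show ?thesis
    proof (cases "n = 2")
      case True2: True
      have X2: "X = 2 * x" using True True2 by (simp add: X_def)
      \<comment> \<open>Here X = 2 x, and \<open>tri X\<close> has the parity of x: this is the
        source of \<open>twist\<close>. For n > 2, X carries a factor 4 and \<open>tri X\<close> is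
        even.\<close>
      have tX: "tri X = x * (2 * x - 1)"
        using two_tri[of X] by (simp add: X2)
      have "A - i * x * y = 2 * (i * x * z - i * x * y * x) - j * (X * tri y + X * y\<^sup>2 - y * z)"
        unfolding A_def tX by (simp add: X2 algebra_simps)
      then have "even (A - i * x * y)" using j by simp
      then show ?thesis using True True2 c by (simp add: twist_def cong_iff_dvd_diff)
    next
      case False
      have "int p dvd tri (int p ^ (n - m) * x)"
        using p(1) True mn False by (intro prime_dvd_tri) auto
      then have "even A" using \<open>even X\<close> True j by (simp add: A_def X_def)
      then show ?thesis using True False c by (simp add: twist_def cong_0_iff)
    qed
  next
    case False
    then show ?thesis using c2 by (auto simp: twist_def cong_0_iff)
  qed
  have "[int p ^ m * w + int (p ^ m choose 2) * A - int (p ^ m choose 3) * B + r * x + s * y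
    = 0 + twist p n m (i * x * y) - 0 + r * x + s * y] (mod int p)"
    using m 1 by (intro cong_add cong_diff 3 cong_refl) (simp_all add: cong_0_iff)
  then have "[int p ^ m * w + int (p ^ m choose 2) * A - int (p ^ m choose 3) * B + r * x + s * y
    = r * x + s * y + twist p n m (i * x * y)] (mod int p)" by (simp add: algebra_simps)
  moreover have "int p ^ m * X div int p ^ n = x" "int p ^ n dvd int p ^ m * X"
    using p by (simp_all add: nm X_def)
  ultimately show ?thesis
    unfolding U_pow nf_eq_d_iff X_def[symmetric] A_def[symmetric] B_def[symmetric] using p m 2 by simp
qed

text \<open>
  The new generators are \<open>a\<^sup>\<alpha> b\<^sup>\<beta>\<close> and \<open>a ^ (p ^ (n - m) * \<gamma>) b\<^sup>\<delta>\<close>, and \<open>d\<^sup>l\<close> replaces \<open>d\<close>.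
\<close>

definition basis_change where
  "basis_change p n m i j r s i' j' r' s' \<alpha> \<beta> \<gamma> \<delta> l \<longleftrightarrow>
    (let q = int p ^ (n - m); D = \<alpha> * \<delta> - \<beta> * (q * \<gamma>) in
      \<not> int p dvd l \<and>
      [D * (i * \<alpha> + j * \<beta>) = l * i'] (mod int p) \<and>
      [D * (i * (q * \<gamma>) + j * \<delta>) = l * j'] (mod int p) \<and>
      [r * \<alpha> + s * q * \<beta> = l * r'] (mod int p) \<and>
      [r * \<gamma> + s * \<delta> + twist p n m (i * \<gamma> * \<delta>) = l * s'] (mod int p))"

section \<open>Isomorphism of models as change of generators\<close>

lemma (in group) int_pow_root:
  assumes g: "g \<in> carrier G" "g [^] int N = \<one>" and k: "coprime k (int N)"
  obtains x where "g = (g [^] k) [^] (x::int)"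
proof -
  obtain x where "[k * x = 1] (mod int N)" using cong_solve_coprime_int k by blast
  then obtain y where y: "k * x = 1 + int N * y" by (metis cong_iff_lin cong_sym)
  have "g = g [^] (k * x)"
    unfolding y using int_pow_mult[of g 1 "int N * y"] int_pow_pow[of g "int N" y] g by simp
  then show thesis using that g by (simp add: int_pow_pow)
qed

text \<open>Any tuple satisfying the relations is written in coordinates and the relations are read
  off there. The exponents n', m' are kept apart from n, m because this is also used to prove that
  they agree.\<close>

lemma rel_in_Q:
  assumes adm: "admissible p n m j" and nz: "\<not> (int p dvd i' \<and> int p dvd j')"
    and rel: "rel (Q p n m i j r s) p n' m' i' j' r' s' a b c d" and d: "d \<noteq> (0, 0, 0, 0)"
  obtains \<alpha> \<beta> z w \<gamma> \<delta> z' w' l where "\<not> int p dvd l"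
    "[(\<alpha> * \<delta> - \<beta> * \<gamma>) * (i * \<alpha> + j * \<beta>) = l * i'] (mod int p)"
    "[(\<alpha> * \<delta> - \<beta> * \<gamma>) * (i * \<gamma> + j * \<delta>) = l * j'] (mod int p)"
    "nf p n m r s ((\<alpha>, \<beta>, z, w) [^]\<^bsub>U i j\<^esub> (p ^ n')) = nf p n m r s (0, 0, 0, l * r')"
    "nf p n m r s ((\<gamma>, \<delta>, z', w') [^]\<^bsub>U i j\<^esub> (p ^ m')) = nf p n m r s (0, 0, 0, l * s')"
proof -
  note p = admissible_p[OF adm]
  let ?f = "nf p n m r s" and ?Q = "Q p n m i j r s"
  interpret class3 ?Q i' j' a b c d using rel by (simp add: rel_def)
  obtain \<alpha> \<beta> z w where a: "a = ?f (\<alpha>, \<beta>, z, w)"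
    using carr(1) by (metis Q_simps(1) rangeE prod_cases4)
  obtain \<gamma> \<delta> z' w' where b: "b = ?f (\<gamma>, \<delta>, z', w')"
    using carr(2) by (metis Q_simps(1) rangeE prod_cases4)
  obtain e where e: "commutator (U i j) (\<alpha>, \<beta>, z, w) (\<gamma>, \<delta>, z', w') = (0, 0, \<alpha> * \<delta> - \<beta> * \<gamma>, e)"
    using commutator_U by blast
  have c: "c = ?f (0, 0, \<alpha> * \<delta> - \<beta> * \<gamma>, e)"
    using ab unfolding a b Q_commutator[OF adm] e by simp
  have i: "d [^]\<^bsub>?Q\<^esub> i' = ?f (0, 0, 0, (\<alpha> * \<delta> - \<beta> * \<gamma>) * (i * \<alpha> + j * \<beta>))"
    using ca unfolding a c Q_commutator[OF adm] commutator_U_derived by simp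
  have j: "d [^]\<^bsub>?Q\<^esub> j' = ?f (0, 0, 0, (\<alpha> * \<delta> - \<beta> * \<gamma>) * (i * \<gamma> + j * \<delta>))"
    using cb unfolding b c Q_commutator[OF adm] commutator_U_derived by simp
  have dp: "d [^]\<^bsub>?Q\<^esub> int p = (0, 0, 0, 0)"
    using rel by (simp add: rel_def int_pow_int)
  \<comment> \<open>One of i', j' is a unit modulo p, so the corresponding power of d, which is a
    commutator with only a last coordinate, determines d by taking a root.\<close>
  have "\<exists>l. d = ?f (0, 0, 0, l)" if k: "d [^]\<^bsub>?Q\<^esub> k = ?f (0, 0, 0, t)" "\<not> int p dvd k" for k t
  proof -
    have "coprime k (int p)" using k(2) p(4) by (metis coprime_commute prime_imp_coprime)
    then obtain x :: int where "d = (d [^]\<^bsub>?Q\<^esub> k) [^]\<^bsub>?Q\<^esub> x"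
      by (rule int_pow_root[OF carr(4) dp[folded Q_simps(3)[of p n m i j r s]]])
    also have "\<dots> = ?f (0, 0, 0, x * t)"
      by (simp add: k(1) Q_int_pow[OF adm] U_int_pow del: nf.simps)
    finally show ?thesis by blast
  qed
  then obtain l where l: "d = ?f (0, 0, 0, l)" using i j nz by blast
  have pow: "d [^]\<^bsub>?Q\<^esub> (k::int) = ?f (0, 0, 0, l * k)" for k
    by (simp add: l Q_int_pow[OF adm] U_int_pow mult.commute del: nf.simps)
  show thesis
  proof (rule that)
    show "\<not> int p dvd l" using d unfolding l by (auto simp: mod_eq_0_iff_dvd)
    show "[(\<alpha> * \<delta> - \<beta> * \<gamma>) * (i * \<alpha> + j * \<beta>) = l * i'] (mod int p)"
      using i unfolding pow nf_d_eq_iff by (rule cong_sym)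
    show "[(\<alpha> * \<delta> - \<beta> * \<gamma>) * (i * \<gamma> + j * \<delta>) = l * j'] (mod int p)"
      using j unfolding pow nf_d_eq_iff by (rule cong_sym)
    show "?f ((\<alpha>, \<beta>, z, w) [^]\<^bsub>U i j\<^esub> (p ^ n')) = ?f (0, 0, 0, l * r')"
      using rel unfolding rel_def pow a Q_pow[OF adm] by blast
    show "?f ((\<gamma>, \<delta>, z', w') [^]\<^bsub>U i j\<^esub> (p ^ m')) = ?f (0, 0, 0, l * s')"
      using rel unfolding rel_def pow b Q_pow[OF adm] by blast
  qed
qed

lemma iso_Q_rel:
  assumes adm: "admissible p n m j" and adm': "admissible p n' m' j'"
    and iso: "Q p n' m' i' j' r' s' \<cong> Q p n m i j r s"
  obtains a b c d where "rel (Q p n m i j r s) p n' m' i' j' r' s' a b c d" "d \<noteq> (0, 0, 0, 0)"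
proof -
  note p = admissible_p[OF adm]
  obtain h where h: "h \<in> iso (Q p n' m' i' j' r' s') (Q p n m i j r s)"
    using iso by (auto simp: is_iso_def)
  interpret Q: group "Q p n m i j r s" by (rule group_Q[OF adm])
  interpret Q': group "Q p n' m' i' j' r' s'" by (rule group_Q[OF adm'])
  interpret h: group_hom "Q p n' m' i' j' r' s'" "Q p n m i j r s" h
    using h by unfold_locales (simp add: iso_def)
  have "nf p n' m' r' s' (0, 0, 0, 1) \<noteq> (0, 0, 0, 0)" using p by simp
  then have "h (nf p n' m' r' s' (0, 0, 0, 1)) \<noteq> (0, 0, 0, 0)"
    using h.iso_iff h by (simp del: nf.simps) blast
  moreover have "rel (Q p n m i j r s) p n' m' i' j' r' s' (h (nf p n' m' r' s' (1, 0, 0, 0)))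
     (h (nf p n' m' r' s' (0, 1, 0, 0))) (h (nf p n' m' r' s' (0, 0, 1, 0))) (h (nf p n' m' r' s' (0, 0, 0, 1)))"
    using rel_hom_image[OF rel_Q[OF adm'] Q.is_group h.homh] .
  ultimately show thesis using that by blast
qed

lemma prime_power_dvd_imp:
  assumes "prime (p::int)" "p ^ n dvd p ^ k * x" "k < n"
  shows "p dvd x"
proof -
  obtain l where "n = k + Suc l" using assms(3) by (metis less_iff_Suc_add add_Suc_right)
  then show ?thesis
    using assms by (auto simp: power_add dvd_mult_left)
qed

text \<open>If n' < n, then both new generators have p^n'-th powers with first coordinate 0 modulo
  p^n, so their first exponents are divisible by p. The determinant then vanishes modulo p and with
  it [c, a] and [c, b], contrary to \<open>nz\<close>.\<close>

lemma iso_Q_le: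
  assumes adm: "admissible p n m j" and adm': "admissible p n' m' j'"
    and nz: "\<not> (int p dvd i' \<and> int p dvd j')"
    and iso: "Q p n' m' i' j' r' s' \<cong> Q p n m i j r s"
  shows "n \<le> n'"
proof (rule ccontr)
  assume "\<not> n \<le> n'"
  note p = admissible_p[OF adm] and p' = admissible_p[OF adm']
  obtain a b c d where "rel (Q p n m i j r s) p n' m' i' j' r' s' a b c d" "d \<noteq> (0, 0, 0, 0)"
    using iso_Q_rel[OF adm adm' iso] .
  from rel_in_Q[OF adm nz this] obtain \<alpha> \<beta> z w \<gamma> \<delta> z' w' l where *: "\<not> int p dvd l"
    "[(\<alpha> * \<delta> - \<beta> * \<gamma>) * (i * \<alpha> + j * \<beta>) = l * i'] (mod int p)"
    "[(\<alpha> * \<delta> - \<beta> * \<gamma>) * (i * \<gamma> + j * \<delta>) = l * j'] (mod int p)"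
    "nf p n m r s ((\<alpha>, \<beta>, z, w) [^]\<^bsub>U i j\<^esub> (p ^ n')) = nf p n m r s (0, 0, 0, l * r')"
    "nf p n m r s ((\<gamma>, \<delta>, z', w') [^]\<^bsub>U i j\<^esub> (p ^ m')) = nf p n m r s (0, 0, 0, l * s')" .
  have "int p dvd \<alpha>"
    using *(4) \<open>\<not> n \<le> n'\<close> prime_power_dvd_imp[of "int p" n n' \<alpha>] p unfolding U_pow nf_eq_d_iff by simp
  moreover have "int p dvd \<gamma>"
    using *(5) \<open>\<not> n \<le> n'\<close> prime_power_dvd_imp[of "int p" n m' \<gamma>] p p' unfolding U_pow nf_eq_d_iff by simp
  ultimately have "int p dvd \<alpha> * \<delta> - \<beta> * \<gamma>" by simp
  then have "int p dvd l * i'" "int p dvd l * j'"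
    using *(2,3) by (metis cong_dvd_iff dvd_mult2)+
  then show False using *(1) nz p(4) by (simp add: prime_dvd_mult_iff)
qed

lemma iso_Q_imp_basis_change:
  assumes adm: "admissible p n m j" and adm': "admissible p n' m' j'"
    and nz: "\<not> (int p dvd i \<and> int p dvd j)" and nz': "\<not> (int p dvd i' \<and> int p dvd j')"
    and 3: "\<not> (p = 3 \<and> n = 1)"
    and iso: "Q p n' m' i' j' r' s' \<cong> Q p n m i j r s"
  shows "n = n' \<and> m = m' \<and> (\<exists>\<alpha> \<beta> \<gamma> \<delta> l. basis_change p n m i j r s i' j' r' s' \<alpha> \<beta> \<gamma> \<delta> l)"
proof -
  note p = admissible_p[OF adm] and p' = admissible_p[OF adm']
  have "Q p n m i j r s \<cong> Q p n' m' i' j' r' s'"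
    using group.iso_sym[OF group_Q[OF adm'] iso] .
  then have n: "n = n'" using iso_Q_le[OF adm adm' nz' iso] iso_Q_le[OF adm' adm nz] by (simp add: le_antisym)
  have "p ^ (n + m + 2) = p ^ (n' + m' + 2)"
    using iso_same_card[OF iso] unfolding card_Q[OF p(2)] by (rule sym)
  then have "n + m + 2 = n' + m' + 2" using p power_inject_exp by blast
  then have m: "m = m'" using n by simp
  obtain a b c d where "rel (Q p n m i j r s) p n' m' i' j' r' s' a b c d" "d \<noteq> (0, 0, 0, 0)"
    using iso_Q_rel[OF adm adm' iso] .
  from rel_in_Q[OF adm nz' this] obtain \<alpha> \<beta> z w \<gamma> \<delta> z' w' l where *: "\<not> int p dvd l"
    "[(\<alpha> * \<delta> - \<beta> * \<gamma>) * (i * \<alpha> + j * \<beta>) = l * i'] (mod int p)"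
    "[(\<alpha> * \<delta> - \<beta> * \<gamma>) * (i * \<gamma> + j * \<delta>) = l * j'] (mod int p)"
    "nf p n m r s ((\<alpha>, \<beta>, z, w) [^]\<^bsub>U i j\<^esub> (p ^ n)) = nf p n m r s (0, 0, 0, l * r')"
    "nf p n m r s ((\<gamma>, \<delta>, z', w') [^]\<^bsub>U i j\<^esub> (p ^ m)) = nf p n m r s (0, 0, 0, l * s')"
    unfolding n[symmetric] m[symmetric] .
  have nm: "int p ^ n = int p ^ m * int p ^ (n - m)"
    using p by (simp flip: power_add)
  \<comment> \<open>The power of the second generator lies in the subgroup generated by d; this
    forces the factor p^(n-m) built into \<open>basis_change\<close>.\<close>
  have "int p ^ n dvd int p ^ m * \<gamma>" using *(5) unfolding U_pow nf_eq_d_iff by simp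
  then obtain g where g: "\<gamma> = int p ^ (n - m) * g"
    using p unfolding nm by auto
  show ?thesis
    using n m * unfolding g nf_pow_a[OF adm 3] nf_pow_b[OF adm 3] nf_d_eq_iff
    unfolding basis_change_def Let_def by blast
qed

lemma (in group) pow_mem_subgroup_imp:
  assumes "subgroup H G" "g \<in> carrier G" "g [^] k \<in> H" "coprime k (int (order G))"
  shows "g \<in> H"
  using int_pow_root[of g "order G" k] pow_order_eq_1[of g] assms
  by (metis int_pow_int subgroup_int_pow_closed)

text \<open>The congruences say that the new tuple satisfies the new relations; what remains is that
  it generates \<open>Q\<close>. This holds because its determinant D is a unit modulo p and the
  order of \<open>Q\<close> is a power of p.\<close>

lemma basis_change_imp_iso_Q:
  assumes adm: "admissible p n m j" and 3: "\<not> (p = 3 \<and> n = 1)"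
    and nz': "\<not> (int p dvd i' \<and> int p dvd j')"
    and bc: "basis_change p n m i j r s i' j' r' s' \<alpha> \<beta> \<gamma> \<delta> l"
  shows "Q p n m i' j' r' s' \<cong> Q p n m i j r s"
proof -
  note p = admissible_p[OF adm]
  let ?f = "nf p n m r s" and ?Q = "Q p n m i j r s"
  interpret Q: group ?Q by (rule group_Q[OF adm])
  define g where "g = int p ^ (n - m) * \<gamma>"
  define D where "D = \<alpha> * \<delta> - \<beta> * g"
  obtain e where e: "commutator (U i j) (\<alpha>, \<beta>, 0, 0) (g, \<delta>, 0, 0) = (0, 0, D, e)"
    using commutator_U unfolding D_def by blast
  have bc': "\<not> int p dvd l" "[D * (i * \<alpha> + j * \<beta>) = l * i'] (mod int p)"
      "[D * (i * g + j * \<delta>) = l * j'] (mod int p)"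
      "[r * \<alpha> + s * int p ^ (n - m) * \<beta> = l * r'] (mod int p)"
      "[r * \<gamma> + s * \<delta> + twist p n m (i * \<gamma> * \<delta>) = l * s'] (mod int p)"
    using bc by (simp_all add: basis_change_def Let_def g_def D_def)
  have D: "\<not> int p dvd D"
  proof
    assume "int p dvd D"
    then have "int p dvd l * i'" "int p dvd l * j'"
      using bc'(2,3) by (metis cong_dvd_iff dvd_mult2)+
    then show False using bc'(1) nz' p(4) by (simp add: prime_dvd_mult_iff)
  qed
  let ?a = "?f (\<alpha>, \<beta>, 0, 0)" and ?b = "?f (g, \<delta>, 0, 0)" and ?c = "?f (0, 0, D, e)" and ?d = "?f (0, 0, 0, l)"
  interpret class3 ?Q i' j' ?a ?b ?c ?d
  proof
    show "commutator ?Q ?a ?b = ?c" unfolding Q_commutator[OF adm] e ..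
    show "commutator ?Q ?c ?a = ?d [^]\<^bsub>?Q\<^esub> i'"
      unfolding Q_commutator[OF adm] commutator_U_derived Q_int_pow[OF adm] U_int_pow
      using bc'(2) by (simp add: nf_d_eq_iff mult.commute del: nf.simps)
    show "commutator ?Q ?c ?b = ?d [^]\<^bsub>?Q\<^esub> j'"
      unfolding Q_commutator[OF adm] commutator_U_derived Q_int_pow[OF adm] U_int_pow
      using bc'(3) by (simp add: nf_d_eq_iff mult.commute del: nf.simps)
  qed (simp_all add: nf_hom_mult[OF adm] add.commute del: nf.simps)
  have rel: "rel ?Q p n m i' j' r' s' ?a ?b ?c ?d"
    unfolding rel_def
  proof (intro conjI)
    show "class3 ?Q i' j' ?a ?b ?c ?d" by unfold_locales
    show "?c [^]\<^bsub>?Q\<^esub> p = \<one>\<^bsub>?Q\<^esub>" "?d [^]\<^bsub>?Q\<^esub> p = \<one>\<^bsub>?Q\<^esub>"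
      unfolding Q_pow[OF adm] U_pow_gen by simp_all
    show "?a [^]\<^bsub>?Q\<^esub> (p ^ n) = ?d [^]\<^bsub>?Q\<^esub> r'"
      unfolding Q_pow[OF adm] nf_pow_a[OF adm 3] Q_int_pow[OF adm] U_int_pow
      using bc'(4) by (simp add: nf_d_eq_iff mult.commute del: nf.simps)
    show "?b [^]\<^bsub>?Q\<^esub> (p ^ m) = ?d [^]\<^bsub>?Q\<^esub> s'"
      unfolding g_def Q_pow[OF adm] nf_pow_b[OF adm 3] Q_int_pow[OF adm] U_int_pow
      using bc'(5) by (simp add: nf_d_eq_iff mult.commute del: nf.simps)
  qed
  define H where "H = range collect"
  have H: "subgroup H ?Q" unfolding H_def by (rule subgroup_range_collect)
  have gens: "?a \<in> H" "?b \<in> H" "?c \<in> H" "?d \<in> H"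
    unfolding H_def by (metis collect_gens(1) rangeI, metis collect_gens(2) rangeI,
      metis collect_gens(3) rangeI, metis collect_gens(4) rangeI)
  have mult: "?f (umult i j u v) \<in> H" if "?f u \<in> H" "?f v \<in> H" for u v
    using subgroup.m_closed[OF H that] by (simp add: nf_hom_mult[OF adm] del: nf.simps)
  have pow: "?f (u [^]\<^bsub>U i j\<^esub> (k::int)) \<in> H" if "?f u \<in> H" for u k
    using Q.subgroup_int_pow_closed[OF H that, of k] by (simp add: Q_int_pow[OF adm] del: nf.simps)
  \<comment> \<open>The group order is a power of p, so u is itself a power of its k-th power. This
    allows division by l and by D.\<close>
  have root: "?f u \<in> H" if "?f (u [^]\<^bsub>U i j\<^esub> k) \<in> H" "\<not> int p dvd k" for u k
  proof (rule Q.pow_mem_subgroup_imp[OF H])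
    have "coprime k (int p)" using that(2) p(4) by (metis coprime_commute prime_imp_coprime)
    then show "coprime k (int (order ?Q))" by (simp add: order_def card_Q p del: Q_simps)
    show "?f u [^]\<^bsub>?Q\<^esub> k \<in> H" using that(1) by (simp add: Q_int_pow[OF adm] del: nf.simps)
  qed simp
  have d: "?f (0, 0, 0, k) \<in> H" for k
  proof -
    have "?f (0, 0, 0, 1) \<in> H"
      using gens(4) bc'(1) root[of "(0, 0, 0, 1)" l] by (simp add: U_int_pow del: nf.simps)
    from pow[OF this, of k] show ?thesis by (simp add: U_int_pow del: nf.simps)
  qed
  have cd: "?f (0, 0, z, w) \<in> H" for z w
  proof -
    have "?f (0, 0, D, 0) \<in> H"
      using mult[OF gens(3) d[of "- e"]] by (simp del: nf.simps)
    then have "?f (0, 0, 1, 0) \<in> H"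
      using D root[of "(0, 0, 1, 0)" D] by (simp add: U_int_pow del: nf.simps)
    from mult[OF pow[OF this, of z] d[of w]] show ?thesis by (simp add: U_int_pow del: nf.simps)
  qed
  \<comment> \<open>With all c^z d^w in \<open>H\<close>, membership depends on the first two
    coordinates alone, and these add like vectors.\<close>
  have zw: "?f (x, y, z, w) \<in> H" if "?f (x, y, z', w') \<in> H" for x y z w z' w'
    using mult[OF that cd[of "z - z'" "w - w'"]] by (simp add: algebra_simps del: nf.simps)
  have add: "?f (x + x', y + y', 0, 0) \<in> H" if "?f (x, y, 0, 0) \<in> H" "?f (x', y', 0, 0) \<in> H" for x y x' y'
    using zw[OF mult[OF that, unfolded umult.simps]] .
  have minus: "?f (- x, - y, 0, 0) \<in> H" if "?f (x, y, 0, 0) \<in> H" for x y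
  proof -
    obtain x' y' z' w' where i: "inv\<^bsub>U i j\<^esub> (x, y, 0, 0) = (x', y', z', w')" by (cases "inv\<^bsub>U i j\<^esub> (x, y, 0, 0)")
    have "umult i j (inv\<^bsub>U i j\<^esub> (x, y, 0, 0)) (x, y, 0, 0) = (0, 0, 0, 0)"
      using group.l_inv[OF group_U[of i j], of "(x, y, 0, 0)"] by simp
    then have "x' = - x" "y' = - y" unfolding i by auto
    then show ?thesis using pow[OF that, of "- 1"] zw i
      by (simp add: group.int_pow_neg[OF group_U] group.int_pow_1[OF group_U] del: nf.simps)
  qed
  have scale: "?f (k * x, k * y, 0, 0) \<in> H" if "?f (x, y, 0, 0) \<in> H" for x y k
  proof (induction k rule: int_induct[where k = 0])
    case base
    show ?case using cd[of 0 0] by simp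
  next
    case (step1 k)
    then show ?case using add[OF step1(2) that] by (simp add: algebra_simps del: nf.simps)
  next
    case (step2 k)
    then show ?case using add[OF step2(2) minus[OF that]] by (simp add: algebra_simps del: nf.simps)
  qed
  \<comment> \<open>Cramer's rule: \<delta> (\<alpha>, \<beta>) - \<beta> (g, \<delta>) = (D, 0),
    and below \<alpha> (g, \<delta>) - g (\<alpha>, \<beta>) = (0, D).\<close>
  have "?f (D, 0, 0, 0) \<in> H"
    using add[OF scale[OF gens(1), of \<delta>] scale[OF gens(2), of "- \<beta>"]]
    by (simp add: D_def mult.commute del: nf.simps)
  then have a: "?f (1, 0, 0, 0) \<in> H"
      using D root[of "(1, 0, 0, 0)" D] by (simp add: U_int_pow del: nf.simps)
  have "?f (0, D, 0, 0) \<in> H"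
    using add[OF scale[OF gens(1), of "- g"] scale[OF gens(2), of \<alpha>]]
    by (simp add: D_def mult.commute del: nf.simps)
  then have b: "?f (0, 1, 0, 0) \<in> H"
      using D root[of "(0, 1, 0, 0)" D] by (simp add: U_int_pow del: nf.simps)
  have "?f u \<in> H" for u
  proof -
    obtain x y z w where u: "u = (x, y, z, w)" by (cases u)
    show ?thesis unfolding u
      using zw[OF add[OF scale[OF a, of x] scale[OF b, of y]]] by (simp del: nf.simps)
  qed
  then have "carrier ?Q \<subseteq> range collect" by (auto simp: H_def)
  then show ?thesis
    by (rule rel_imp_iso_Q[OF rel p(2)]) (simp add: card_Q p del: Q_simps)
qed

section \<open>Free groups and presentations\<close>

lemma words_simps [simp]:
  "[] \<in> words A" "x # u \<in> words A \<longleftrightarrow> fst x \<in> A \<and> u \<in> words A"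
  "u @ v \<in> words A \<longleftrightarrow> u \<in> words A \<and> v \<in> words A"
  by (auto simp: words_def mem_Times_iff)

lemma equiv_free_eq: "equiv UNIV (free_eq A)"
proof (rule equivI)
  show "sym (free_eq A)"
    unfolding free_eq_def by (intro sym_rtrancl symI) auto
qed (auto simp: free_eq_def refl_on_def trans_rtrancl)

lemma free_eq_append:
  assumes "(u, u') \<in> free_eq A" "v \<in> words A" "w \<in> words A"
  shows "(v @ u @ w, v @ u' @ w) \<in> free_eq A"
  using assms(1) unfolding free_eq_def
proof (induction rule: rtrancl_induct)
  case (step y z)
  have *: "(v @ y @ w, v @ z @ w) \<in> cancellation A" if yz: "(y, z) \<in> cancellation A" for y z
  proof -
    obtain s t x e where "y = s @ [(x, e), (x, \<not> e)] @ t" "z = s @ t" "s \<in> words A" "t \<in> words A" "x \<in> A"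
      using yz unfolding cancellation_def by blast
    then have "v @ y @ w = (v @ s) @ [(x, e), (x, \<not> e)] @ (t @ w)" "v @ z @ w = (v @ s) @ (t @ w)"
      "v @ s \<in> words A" "t @ w \<in> words A" using assms by simp_all
    then show ?thesis unfolding cancellation_def using \<open>x \<in> A\<close> by blast
  qed
  have "(v @ y @ w, v @ z @ w) \<in> cancellation A \<union> (cancellation A)\<inverse>"
    using step(2) * by blast
  then show ?case using step(3) by (rule rtrancl_into_rtrancl[rotated])
qed simp

lemma free_eq_words: "(u, u') \<in> free_eq A \<Longrightarrow> u \<in> words A \<Longrightarrow> u' \<in> words A"
  unfolding free_eq_def
  by (induction rule: rtrancl_induct) (auto simp: cancellation_def)

abbreviation word_class where "word_class A u \<equiv> free_eq A `` {u}"

lemma word_class_eq_iff: "word_class A u = word_class A v \<longleftrightarrow> (u, v) \<in> free_eq A"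
  using eq_equiv_class_iff[OF equiv_free_eq] by blast

lemma carrier_free_group: "carrier (free_group A) = word_class A ` words A"
  by (auto simp: free_group_def quotient_def)

text \<open>The product in \<open>free_group\<close> is a union over all representatives; it
  collapses to one class because \<open>free_eq\<close> is a congruence on words.\<close>

lemma word_class_mult:
  assumes "u \<in> words A" "v \<in> words A"
  shows "word_class A u \<otimes>\<^bsub>free_group A\<^esub> word_class A v = word_class A (u @ v)"
proof -
  have "word_class A (u' @ v') = word_class A (u @ v)" if "(u, u') \<in> free_eq A" "(v, v') \<in> free_eq A" for u' v'
  proof -
    have "(u @ v, u' @ v) \<in> free_eq A" "(u' @ v, u' @ v') \<in> free_eq A"
      using free_eq_append[OF that(1), of "[]" v] free_eq_append[OF that(2), of u' "[]"]
        assms free_eq_words[OF that(1)] by auto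
    then show ?thesis
      unfolding word_class_eq_iff by (meson equiv_free_eq equivE transD symD)
  qed
  then have "(\<Union>u'\<in>word_class A u. \<Union>v'\<in>word_class A v. word_class A (u' @ v')) =
      (\<Union>u'\<in>word_class A u. \<Union>v'\<in>word_class A v. word_class A (u @ v))"
    by (intro SUP_cong refl) simp
  also have "\<dots> = word_class A (u @ v)"
  proof -
    have "u \<in> word_class A u" "v \<in> word_class A v" by (simp_all add: free_eq_def)
    then show ?thesis by blast
  qed
  finally show ?thesis by (simp add: free_group_def)
qed

lemma one_free_group: "\<one>\<^bsub>free_group A\<^esub> = word_class A []"
  by (simp add: free_group_def)

lemma letter_cancel:
  assumes "x \<in> A" shows "word_class A [(x, e), (x, \<not> e)] = word_class A []"
proof -
  have "([] @ [(x, e), (x, \<not> e)] @ [], [] @ []) \<in> cancellation A"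
    unfolding cancellation_def using assms words_simps(1) by blast
  then have "([(x, e), (x, \<not> e)], []) \<in> free_eq A"
    unfolding free_eq_def by auto
  then show ?thesis by (simp only: word_class_eq_iff)
qed

lemma group_free_group: "group (free_group A)"
proof (rule groupI)
  fix U assume "U \<in> carrier (free_group A)"
  then obtain u where u: "u \<in> words A" "U = word_class A u" by (auto simp: carrier_free_group)
  have "\<exists>v\<in>words A. word_class A (v @ u) = word_class A []" using u(1)
  proof (induction u)
    case (Cons l u)
    obtain x e where l: "l = (x, e)" by (cases l)
    obtain v where v: "v \<in> words A" "word_class A (v @ u) = word_class A []" using Cons by auto
    have "(v @ [(x, \<not> e), (x, e)] @ u, v @ [] @ u) \<in> free_eq A"
      using letter_cancel[of x A "\<not> e"] Cons(2) v l by (intro free_eq_append) (auto simp: word_class_eq_iff)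
    then have "word_class A ((v @ [(x, \<not> e)]) @ l # u) = word_class A (v @ u)"
      unfolding l by (simp add: word_class_eq_iff)
    then have "word_class A ((v @ [(x, \<not> e)]) @ l # u) = word_class A []"
      using v(2) by (rule trans)
    then show ?case using v(1) Cons(2) l by (intro bexI[of _ "v @ [(x, \<not> e)]"]) auto
  qed auto
  then show "\<exists>V\<in>carrier (free_group A). V \<otimes>\<^bsub>free_group A\<^esub> U = \<one>\<^bsub>free_group A\<^esub>"
    using u by (auto simp: carrier_free_group word_class_mult one_free_group)
next
  fix U V W assume "U \<in> carrier (free_group A)" "V \<in> carrier (free_group A)" "W \<in> carrier (free_group A)"
  then obtain u v w where "u \<in> words A" "v \<in> words A" "w \<in> words A"
    "U = word_class A u" "V = word_class A v" "W = word_class A w"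
    by (auto simp: carrier_free_group)
  then show "U \<otimes>\<^bsub>free_group A\<^esub> V \<otimes>\<^bsub>free_group A\<^esub> W = U \<otimes>\<^bsub>free_group A\<^esub> (V \<otimes>\<^bsub>free_group A\<^esub> W)"
    by (simp add: word_class_mult)
next
  fix U V assume "U \<in> carrier (free_group A)" "V \<in> carrier (free_group A)"
  then obtain u v where "u \<in> words A" "v \<in> words A" "U = word_class A u" "V = word_class A v"
    by (auto simp: carrier_free_group)
  then show "U \<otimes>\<^bsub>free_group A\<^esub> V \<in> carrier (free_group A)"
    by (auto simp: word_class_mult carrier_free_group)
qed (auto simp: carrier_free_group one_free_group word_class_mult)

lemma free_gen_closed: "x \<in> A \<Longrightarrow> free_gen A x \<in> carrier (free_group A)"
  by (auto simp: free_gen_def carrier_free_group)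

lemma free_group_generated:
  assumes K: "subgroup K (free_group A)" and gens: "\<And>x. x \<in> A \<Longrightarrow> free_gen A x \<in> K"
  shows "K = carrier (free_group A)"
proof -
  interpret group "free_group A" by (rule group_free_group)
  have letter: "word_class A [(x, e)] \<in> K" if x: "x \<in> A" for x e
  proof (cases e)
    case True
    then show ?thesis using gens[OF x] by (simp add: free_gen_def)
  next
    case False
    have "inv\<^bsub>free_group A\<^esub> (free_gen A x) = word_class A [(x, False)]"
      using x letter_cancel[OF x, of False]
      by (intro inv_equality) (auto simp: free_gen_def word_class_mult one_free_group carrier_free_group)
    then show ?thesis using False subgroup.m_inv_closed[OF K gens[OF x]] by simp
  qed
  have "word_class A u \<in> K" if "u \<in> words A" for u using that
  proof (induction u)
    case Nil
    then show ?case using subgroup.one_closed[OF K] by (simp add: one_free_group)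
  next
    case (Cons l u)
    then have "word_class A [l] \<otimes>\<^bsub>free_group A\<^esub> word_class A u \<in> K"
      using letter[of "fst l" "snd l"] by (intro subgroup.m_closed[OF K]) auto
    then show ?case using Cons(2) by (simp add: word_class_mult)
  qed
  then show ?thesis using subgroup.subset[OF K] by (auto simp: carrier_free_group)
qed

lemma free_group_universal:
  assumes H: "group H" and f: "\<And>x. x \<in> A \<Longrightarrow> f x \<in> carrier H"
  obtains h where "h \<in> hom (free_group A) H" "\<And>x. x \<in> A \<Longrightarrow> h (free_gen A x) = f x"
proof -
  interpret H: group H by fact
  define l where "l = (\<lambda>(x, e). if e then f x else inv\<^bsub>H\<^esub> f x)"
  define ev where "ev u = foldr (\<lambda>y t. l y \<otimes>\<^bsub>H\<^esub> t) u \<one>\<^bsub>H\<^esub>" for u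
  have l: "l y \<in> carrier H" if "fst y \<in> A" for y
    using f that by (cases y) (auto simp: l_def)
  have ev_simps: "ev [] = \<one>\<^bsub>H\<^esub>" "ev (y # u) = l y \<otimes>\<^bsub>H\<^esub> ev u" for y u
    by (simp_all add: ev_def)
  have ev_closed: "ev u \<in> carrier H" if "u \<in> words A" for u
    using that by (induction u) (auto simp: ev_simps l)
  have ev_append: "ev (u @ v) = ev u \<otimes>\<^bsub>H\<^esub> ev v" if "u \<in> words A" "v \<in> words A" for u v
    using that by (induction u) (auto simp: ev_simps l ev_closed H.m_assoc)
  have canc: "ev u = ev v" if uv: "(u, v) \<in> cancellation A" for u v
  proof -
    obtain s t x e where st: "u = s @ [(x, e), (x, \<not> e)] @ t" "v = s @ t" "s \<in> words A" "t \<in> words A" "x \<in> A"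
      using uv unfolding cancellation_def by blast
    have "ev ((x, e) # (x, \<not> e) # t) = ev t"
      using f[OF st(5)] ev_closed[OF st(4)] by (cases e) (simp_all add: ev_simps l_def flip: H.m_assoc)
    moreover have "(x, e) # (x, \<not> e) # t \<in> words A" using st by simp
    ultimately show ?thesis using st ev_append[of s "(x, e) # (x, \<not> e) # t"] ev_append[of s t] by simp
  qed
  have ev_eq: "ev u = ev v" if "(u, v) \<in> free_eq A" for u v
    using that unfolding free_eq_def by (induction rule: rtrancl_induct) (auto dest: canc)
  \<comment> \<open>Cancelling pairs evaluate to the identity, so \<open>ev\<close> is constant on
    each class and its image there is a singleton.\<close>
  define h where "h U = the_elem (ev ` U)" for U
  have h: "h (word_class A u) = ev u" for u
  proof -
    have "ev ` word_class A u = {ev u}"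
      using ev_eq[of u] equiv_free_eq[of A] by (auto simp: image_iff equiv_def refl_on_def) 
    then show ?thesis by (simp add: h_def)
  qed
  show thesis
  proof
    show "h \<in> hom (free_group A) H"
      by (rule homI) (auto simp: carrier_free_group h ev_closed word_class_mult ev_append)
    show "h (free_gen A x) = f x" if "x \<in> A" for x
      using f[OF that] by (simp add: free_gen_def h ev_simps l_def)
  qed
qed

lemma (in group) normal_Inter:
  assumes "\<A> \<noteq> {}" "\<And>N. N \<in> \<A> \<Longrightarrow> N \<lhd> G"
  shows "\<Inter>\<A> \<lhd> G"
  using assms subgroups_Inter[of \<A>] unfolding normal_inv_iff by blast

lemma (in group) normal_closure_normal:
  assumes "S \<subseteq> carrier G"
  shows "normal_closure G S \<lhd> G"
  unfolding normal_closure_def using assms normal_self by (intro normal_Inter) auto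

lemma (in group_hom) subgroup_preimage:
  assumes "subgroup K H" shows "subgroup {u \<in> carrier G. h u \<in> K} G"
proof -
  interpret K: subgroup K H by fact
  show ?thesis by (rule subgroup.intro) auto
qed

text \<open>These properties are all that is used of presentations: the relations hold, the
  generators generate, and any group satisfying the relations receives a homomorphism.\<close>

lemma presented_group_facts:
  fixes A :: "'x set" and R
  defines "F \<equiv> free_group A"
  assumes R: "R \<subseteq> carrier F \<times> carrier F"
  obtains \<pi> where "\<pi> \<in> hom F (presented_group A R)" "group (presented_group A R)"
    "\<And>u v. (u, v) \<in> R \<Longrightarrow> \<pi> u = \<pi> v"
    "\<And>K. subgroup K (presented_group A R) \<Longrightarrow> (\<And>x. x \<in> A \<Longrightarrow> \<pi> (free_gen A x) \<in> K)
       \<Longrightarrow> K = carrier (presented_group A R)"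
    "\<And>(H :: ('h, 'i) monoid_scheme) h. group H \<Longrightarrow> h \<in> hom F H \<Longrightarrow> (\<And>u v. (u, v) \<in> R \<Longrightarrow> h u = h v) \<Longrightarrow>
       \<exists>g\<in>hom (presented_group A R) H. \<forall>u\<in>carrier F. g (\<pi> u) = h u"
proof -
  interpret F: group F unfolding F_def by (rule group_free_group)
  define S where "S = {u \<otimes>\<^bsub>F\<^esub> inv\<^bsub>F\<^esub> v | u v. (u, v) \<in> R}"
  have S: "S \<subseteq> carrier F" using R by (auto simp: S_def)
  define N where "N = normal_closure F S"
  have L: "presented_group A R = F Mod N"
    by (simp add: presented_group_def Let_def F_def N_def S_def)
  interpret N: normal N F unfolding N_def by (rule F.normal_closure_normal[OF S])
  have SN: "S \<subseteq> N" by (auto simp: N_def normal_closure_def)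
  interpret Q: group "F Mod N" by (rule N.factorgroup_is_group)
  interpret pi: group_hom F "F Mod N" "\<lambda>u. N #>\<^bsub>F\<^esub> u"
    using N.r_coset_hom_Mod by unfold_locales
  show thesis
  proof
    show "(\<lambda>u. N #>\<^bsub>F\<^esub> u) \<in> hom F (presented_group A R)" unfolding L by (rule N.r_coset_hom_Mod)
    show "group (presented_group A R)" unfolding L by (rule Q.is_group)
  next
    fix u v assume uv: "(u, v) \<in> R"
    then have "u \<otimes>\<^bsub>F\<^esub> inv\<^bsub>F\<^esub> v \<in> N" using SN by (auto simp: S_def)
    then have "N #>\<^bsub>F\<^esub> (u \<otimes>\<^bsub>F\<^esub> inv\<^bsub>F\<^esub> v) = N"
      by (rule N.rcos_const[OF F.is_group])
    then show "N #>\<^bsub>F\<^esub> u = N #>\<^bsub>F\<^esub> v"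
      using uv R N.subset by (intro F.coset_mult_inv1) auto
  next
    fix K assume K: "subgroup K (presented_group A R)" and g: "\<And>x. x \<in> A \<Longrightarrow> N #>\<^bsub>F\<^esub> free_gen A x \<in> K"
    have "subgroup {u \<in> carrier F. N #>\<^bsub>F\<^esub> u \<in> K} F"
      using pi.subgroup_preimage K unfolding L by blast
    then have "{u \<in> carrier F. N #>\<^bsub>F\<^esub> u \<in> K} = carrier F"
      unfolding F_def using g free_gen_closed by (intro free_group_generated) (auto simp: F_def)
    then show "K = carrier (presented_group A R)"
      using subgroup.subset[OF K] unfolding L by (auto simp: carrier_FactGroup)
  next
    fix H :: "('h, 'i) monoid_scheme" and h
    assume H: "group H" and h: "h \<in> hom F H" and R': "\<And>u v. (u, v) \<in> R \<Longrightarrow> h u = h v"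
    interpret H: group H by fact
    interpret h: group_hom F H h using h by unfold_locales
    \<comment> \<open>The kernel is normal and contains the relators, hence their normal
      closure.\<close>
    have "S \<subseteq> kernel F H h"
      using R R' by (auto simp: S_def kernel_def)
    then have "N \<subseteq> kernel F H h"
      using h.normal_kernel unfolding N_def normal_closure_def by blast
    then show "\<exists>g\<in>hom (presented_group A R) H. \<forall>u\<in>carrier F. g (N #>\<^bsub>F\<^esub> u) = h u"
      unfolding L using h.FactGroup_universal_kernel[OF N.normal_axioms] by metis
  qed
qed

section \<open>The listed groups\<close>

text \<open>
  \<open>params T\<close> is \<open>(n, m, i, j, r, s)\<close> with \<open>[c, a] = d\<^sup>i\<close>, \<open>[c, b] = d\<^sup>j\<close>, \<open>a ^ (p ^ n) = d\<^sup>r\<close> and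
  \<open>b ^ (p ^ m) = d\<^sup>s\<close>; for the types with three generators \<open>d\<close> is \<open>central_gen\<close>.
\<close>

fun params :: "group_type \<Rightarrow> nat \<times> nat \<times> int \<times> int \<times> int \<times> int" where
  "params (G1 m \<nu>) = (m, m, 0, \<nu>, 1, 0)"
| "params (G2 m) = (m, m, 1, 0, 0, 0)"
| "params (G3 m) = (m, m, 1, 0, 1, 0)"
| "params H1 = (2, 1, 1, 0, 0, 0)"
| "params H2 = (2, 1, 1, 0, 1, 0)"
| "params H3 = (2, 1, 1, 0, 1, 1)"
| "params (I1 n) = (n, 1, 1, 0, 0, 0)"
| "params (I2 n) = (n, 1, 1, 0, 1, 0)"
| "params (I3 n) = (n, 1, 1, 0, 0, 1)"
| "params (J1 n m \<nu>) = (n, m, 0, \<nu>, 1, 0)"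
| "params (J2 n m) = (n, m, 1, 0, 1, 0)"
| "params (J3 n m) = (n, m, 0, 1, 0, 1)"
| "params (J4 n m \<nu>) = (n, m, \<nu>, 0, 0, 1)"
| "params (J5 n m) = (n, m, 0, 1, 0, 0)"
| "params (J6 n m) = (n, m, 1, 0, 0, 0)"

text \<open>Powers are spelled with p and the exponents of \<open>params\<close> even where p = 2,
  so that they have the shape a^(p^n) or b^(p^m) demanded by \<open>rel\<close>.\<close>

fun central_gen :: "('a, 'b) monoid_scheme \<Rightarrow> nat \<Rightarrow> group_type \<Rightarrow> 'a \<Rightarrow> 'a \<Rightarrow> 'a \<Rightarrow> 'a" where
  "central_gen G p (G1 m \<nu>) a b d = a [^]\<^bsub>G\<^esub> (p ^ m)"
| "central_gen G p (G3 m) a b d = a [^]\<^bsub>G\<^esub> (p ^ m)"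
| "central_gen G p H2 a b d = a [^]\<^bsub>G\<^esub> (p ^ 2)"
| "central_gen G p H3 a b d = a [^]\<^bsub>G\<^esub> (p ^ 2)"
| "central_gen G p (I2 n) a b d = a [^]\<^bsub>G\<^esub> (p ^ n)"
| "central_gen G p (I3 n) a b d = b [^]\<^bsub>G\<^esub> (p ^ 1)"
| "central_gen G p (J1 n m \<nu>) a b d = a [^]\<^bsub>G\<^esub> (p ^ n)"
| "central_gen G p (J2 n m) a b d = a [^]\<^bsub>G\<^esub> (p ^ n)"
| "central_gen G p (J3 n m) a b d = b [^]\<^bsub>G\<^esub> (p ^ m)"
| "central_gen G p (J4 n m \<nu>) a b d = b [^]\<^bsub>G\<^esub> (p ^ m)"
| "central_gen G p _ a b d = d"

section \<open>Centrality of d in the listed presentations\<close>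

lemma listed_admissible:
  assumes "prime p" "listed p \<eta> T" "params T = (n, m, i, j, r, s)"
  shows "admissible p n m j"
  using assms prime_ge_2_nat[of p] by (cases T) (auto simp: admissible_def)

text \<open>The class 2 power formula. It is applied to a c and b c^-1 at a point where d is not yet
  known to be central.\<close>

lemma (in group) pow_mult_class2:
  assumes xy: "x \<in> carrier G" "y \<in> carrier G" "e \<in> carrier G"
    and yx: "y \<otimes> x = x \<otimes> (y \<otimes> e)" and ex: "e \<otimes> x = x \<otimes> e" and ey: "e \<otimes> y = y \<otimes> e"
  shows "(x \<otimes> y) [^] (k::nat) = x [^] k \<otimes> y [^] k \<otimes> e [^] (k choose 2)"
proof (induction k)
  case (Suc k)
  have ec: "e [^] l \<otimes> x = x \<otimes> e [^] l" "e [^] l \<otimes> y = y \<otimes> e [^] l" for l :: nat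
    using int_pow_conj[OF _ _ _ ex, of "int l"] int_pow_conj[OF _ _ _ ey, of "int l"] xy by (simp_all add: int_pow_int)
  have "(y \<otimes> e) [^] k = y [^] k \<otimes> e [^] k"
    using int_pow_mult_distrib[of y e "int k"] xy ey by (simp add: int_pow_int)
  then have yk: "y [^] k \<otimes> x = x \<otimes> (y [^] k \<otimes> e [^] k)"
    using int_pow_conj[OF _ _ _ yx, of "int k"] xy by (simp add: int_pow_int)
  have "(x \<otimes> y) [^] Suc k = x [^] k \<otimes> y [^] k \<otimes> (e [^] (k choose 2) \<otimes> x) \<otimes> y"
    using xy by (simp add: Suc m_assoc)
  also have "\<dots> = x [^] k \<otimes> (y [^] k \<otimes> x) \<otimes> (e [^] (k choose 2) \<otimes> y)"
    unfolding ec(1) using xy by (simp add: m_assoc)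
  also have "\<dots> = x [^] k \<otimes> x \<otimes> y [^] k \<otimes> (e [^] k \<otimes> y) \<otimes> e [^] (k choose 2)"
    unfolding ec(2)[of "k choose 2"] yk using xy by (simp add: m_assoc)
  also have "\<dots> = x [^] k \<otimes> x \<otimes> (y [^] k \<otimes> y) \<otimes> (e [^] k \<otimes> e [^] (k choose 2))"
    unfolding ec(2)[of k] using xy by (simp add: m_assoc)
  also have "e [^] k \<otimes> e [^] (k choose 2) = e [^] (Suc k choose 2)"
    using xy by (simp add: nat_pow_mult numeral_2_eq_2)
  finally show ?case by simp
qed (simp add: numeral_2_eq_2)

lemma (in group) pow_eq_one_dvd:
  assumes "x \<in> carrier G" "x [^] (p::nat) = \<one>" "int p dvd k"
  shows "x [^] (k::int) = \<one>"
proof -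
  obtain l where "k = int p * l" using assms(3) by blast
  then show ?thesis using assms int_pow_pow[of x "int p" l] by (simp add: int_pow_int)
qed

text \<open>If \<open>[c, x]\<close> is a power of \<open>x\<^sup>N\<close>, then \<open>c\<close> normalises \<open>\<langle>x\<rangle>\<close> and hence centralises \<open>x\<^sup>N\<close>.\<close>

lemma (in group) pow_commute_if_commutator_pow:
  assumes x: "x \<in> carrier G" "c \<in> carrier G"
    and cx: "commutator G c x = (x [^] N) [^] (k::int)" and p: "(x [^] N) [^] (p::nat) = \<one>" "p dvd N"
  shows "x [^] N \<otimes> c = c \<otimes> x [^] (N::nat)"
proof -
  have "c \<otimes> x = x \<otimes> c \<otimes> x [^] (int N * k)"
    using mult_commutator[of c x] x by (simp add: cx int_pow_pow[symmetric] int_pow_int)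
  then have "c \<otimes> x \<otimes> x [^] (- (int N * k)) = x \<otimes> c \<otimes> (x [^] (int N * k) \<otimes> x [^] (- (int N * k)))"
    using x by (simp add: m_assoc)
  then have "x \<otimes> c = c \<otimes> x [^] (1 - int N * k)"
    using x by (simp add: m_assoc int_pow_mult[symmetric] int_pow_diff) (simp add: int_pow_neg)
  then have "x [^] int N \<otimes> c = c \<otimes> (x [^] (1 - int N * k)) [^] int N"
    using x by (intro int_pow_conj) auto
  also have "(x [^] (1 - int N * k)) [^] int N = x [^] (int N + int N * (- k * int N))"
    by (simp only: int_pow_pow[OF x(1)]) (simp add: algebra_simps)
  also have "\<dots> = x [^] int N \<otimes> (x [^] N) [^] (- k * int N)"
    by (simp only: int_pow_mult[OF x(1)] int_pow_pow[OF x(1)] flip: int_pow_int)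
  also have "(x [^] N) [^] (- k * int N) = \<one>"
    using x p by (intro pow_eq_one_dvd) auto
  finally show ?thesis using x by (simp add: int_pow_int)
qed

lemma (in group) pow_eq_one_dvd_nat:
  "x \<in> carrier G \<Longrightarrow> x [^] (p::nat) = \<one> \<Longrightarrow> p dvd k \<Longrightarrow> x [^] (k::nat) = \<one>"
  by (auto simp flip: nat_pow_pow)

text \<open>The presentation does not state that d = a^(p^n) is central. It commutes with c because
  c normalises the subgroup generated by a. Conjugation by b takes a to a c, and (a c)^(p^n) =
  a^(p^n), since c^p = 1 and the binomial correction is a p-th power of d; so d commutes with
  b.\<close>

lemma rel_if_d_power_of_a:
  fixes G (structure)
  assumes G: "group G" and adm: "admissible p n m j"
    and carr: "a \<in> carrier G" "b \<in> carrier G" "c \<in> carrier G"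
    and d: "d = a [^] (p ^ n)" and ord: "a [^] (p ^ (n + 1)) = \<one>" "c [^] p = \<one>"
    and b: "b [^] (p ^ m) = d [^] s"
    and comm: "commutator G a b = c" "commutator G c a = d [^] i" "commutator G c b = d [^] j"
  shows "rel G p n m i j 1 s a b c d"
proof -
  note p = admissible_p[OF adm]
  interpret group G by fact
  have pn: "p dvd p ^ n" using p by (simp add: dvd_power)
  have dG: "d \<in> carrier G" using carr d by simp
  have dp: "d [^] p = \<one>" using ord carr by (simp add: d nat_pow_pow mult.commute)
  have da: "d \<otimes> a = a \<otimes> d"
    using carr nat_pow_comm[of a "p ^ n" 1] by (simp add: d)
  have dc: "d \<otimes> c = c \<otimes> d"
    unfolding d using carr dp pn comm(2) by (intro pow_commute_if_commutator_pow) (auto simp: d)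
  have pw: "d [^] k \<otimes> a = a \<otimes> d [^] k" "d [^] k \<otimes> c = c \<otimes> d [^] k" for k :: int
    using int_pow_conj[OF dG dG _ da] int_pow_conj[OF dG dG _ dc] carr by simp_all
  have "(a \<otimes> c) [^] (p ^ n) = a [^] (p ^ n) \<otimes> c [^] (p ^ n) \<otimes> (d [^] i) [^] (p ^ n choose 2)"
    using carr dG pw mult_commutator[of c a] by (intro pow_mult_class2) (simp_all add: comm m_assoc)
  also have "c [^] (p ^ n) = \<one>"
    by (rule pow_eq_one_dvd_nat[OF carr(3) ord(2) pn])
  also have "(d [^] i) [^] (p ^ n choose 2) = d [^] (i * int (p ^ n choose 2))"
    using dG by (simp only: int_pow_pow flip: int_pow_int)
  also have "\<dots> = \<one>"
    using dG dp adm prime_dvd_choose_2[of p n] p by (intro pow_eq_one_dvd) (auto simp: admissible_def)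
  finally have "(a \<otimes> c) [^] (p ^ n) = d" using carr by (simp add: d)
  moreover have "a \<otimes> b = b \<otimes> (a \<otimes> c)"
    using mult_commutator[of a b] carr by (simp add: comm m_assoc)
  then have "a [^] int (p ^ n) \<otimes> b = b \<otimes> (a \<otimes> c) [^] int (p ^ n)"
    using carr by (intro int_pow_conj) auto
  ultimately have db: "d \<otimes> b = b \<otimes> d"
    unfolding int_pow_int by (simp add: d)
  have "class3 G i j a b c d"
    by unfold_locales (use carr dG comm da db dc in auto)
  then show ?thesis using ord dp b dG by (simp add: rel_def d)
qed

text \<open>Here conjugation by a takes b to b c^-1, whose p^m-th power is again d. For p = 2 and m
  = 1 the correction disappears because j is even.\<close>

lemma rel_if_d_power_of_b:
  fixes G (structure)
  assumes G: "group G" and adm: "admissible p n m j"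
    and carr: "a \<in> carrier G" "b \<in> carrier G" "c \<in> carrier G"
    and d: "d = b [^] (p ^ m)" and ord: "b [^] (p ^ (m + 1)) = \<one>" "c [^] p = \<one>"
    and a: "a [^] (p ^ n) = \<one>"
    and comm: "commutator G a b = c" "commutator G c a = d [^] i" "commutator G c b = d [^] j"
  shows "rel G p n m i j 0 1 a b c d"
proof -
  note p = admissible_p[OF adm]
  interpret group G by fact
  have pm: "p dvd p ^ m" using p by (simp add: dvd_power)
  have dG: "d \<in> carrier G" using carr d by simp
  have dp: "d [^] p = \<one>" using ord carr by (simp add: d nat_pow_pow mult.commute)
  have db: "d \<otimes> b = b \<otimes> d"
    using carr nat_pow_comm[of b "p ^ m" 1] by (simp add: d)
  have dc: "d \<otimes> c = c \<otimes> d"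
    unfolding d using carr dp pm comm(3) by (intro pow_commute_if_commutator_pow) (auto simp: d)
  have pw: "d [^] k \<otimes> b = b \<otimes> d [^] k" "d [^] k \<otimes> c = c \<otimes> d [^] k" for k :: int
    using int_pow_conj[OF dG dG _ db] int_pow_conj[OF dG dG _ dc] carr by simp_all
  have pw': "d [^] k \<otimes> inv c = inv c \<otimes> d [^] k" for k :: int
    using int_pow_commute[OF dG carr(3) dc, of k "- 1"] carr by (simp add: int_pow_neg)
  have cb: "c \<otimes> b = b \<otimes> (c \<otimes> d [^] j)"
    using mult_commutator[of c b] carr dG by (simp add: comm m_assoc)
  have "c [^] (- 1 :: int) \<otimes> b = b \<otimes> (c \<otimes> d [^] j) [^] (- 1 :: int)"
    using carr dG cb by (intro int_pow_conj) auto
  then have cb': "inv c \<otimes> b = b \<otimes> (inv c \<otimes> d [^] (- j))"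
    using carr dG pw'[of "- j"] by (simp add: int_pow_neg inv_mult_group)
  have "(b \<otimes> inv c) [^] (p ^ m) =
      b [^] (p ^ m) \<otimes> inv c [^] (p ^ m) \<otimes> (d [^] (- j)) [^] (p ^ m choose 2)"
    using carr dG pw pw' cb' by (intro pow_mult_class2) simp_all
  also have "inv c [^] (p ^ m) = \<one>"
    using pow_eq_one_dvd_nat[of c p "p ^ m"] carr ord pm by (simp add: nat_pow_inv)
  also have "(d [^] (- j)) [^] (p ^ m choose 2) = d [^] (- j * int (p ^ m choose 2))"
    using dG by (simp only: int_pow_pow flip: int_pow_int)
  also have "\<dots> = \<one>"
  proof (rule pow_eq_one_dvd[OF dG dp])
    show "int p dvd - j * int (p ^ m choose 2)"
      using adm prime_dvd_choose_2[of p m] by (cases "p = 2 \<and> m = 1") (auto simp: admissible_def)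
  qed
  finally have "(b \<otimes> inv c) [^] (p ^ m) = d" using carr by (simp add: d)
  moreover have "a \<otimes> b \<otimes> inv c = b \<otimes> a"
    using mult_commutator[of a b] carr by (simp add: comm m_assoc)
  then have "b \<otimes> a = a \<otimes> (b \<otimes> inv c)" using carr by (simp add: m_assoc)
  then have "b [^] int (p ^ m) \<otimes> a = a \<otimes> (b \<otimes> inv c) [^] int (p ^ m)"
    using carr by (intro int_pow_conj) auto
  ultimately have da: "d \<otimes> a = a \<otimes> d"
    unfolding int_pow_int by (simp add: d)
  have "class3 G i j a b c d"
    by unfold_locales (use carr dG comm da db dc in auto)
  then show ?thesis using ord dp a dG by (simp add: rel_def d)
qed

lemma rel_if_d_generator:
  fixes G (structure)
  assumes G: "group G"
    and carr: "a \<in> carrier G" "b \<in> carrier G" "c \<in> carrier G" "d \<in> carrier G"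
    and ord: "a [^] (p ^ n) = \<one>" "b [^] (p ^ m) = \<one>" "c [^] p = \<one>" "d [^] (p::nat) = \<one>"
    and comm: "commutator G a b = c" "commutator G c a = d [^] (i::int)" "commutator G c b = d [^] (j::int)"
      "commutator G d a = \<one>" "commutator G d b = \<one>"
  shows "rel G p n m i j 0 0 a b c d"
proof -
  interpret group G by fact
  have da: "d \<otimes> a = a \<otimes> d" and db: "d \<otimes> b = b \<otimes> d"
    using comm carr by (simp_all add: commutator_eq_one_iff)
  have inv: "d \<otimes> inv x = inv x \<otimes> d" if "d \<otimes> x = x \<otimes> d" "x \<in> carrier G" for x
    using int_pow_commute[OF carr(4) that(2,1), of 1 "- 1"] carr that by (simp add: int_pow_neg)
  have mult: "d \<otimes> (x \<otimes> y) = x \<otimes> y \<otimes> d"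
    if "d \<otimes> x = x \<otimes> d" "d \<otimes> y = y \<otimes> d" "x \<in> carrier G" "y \<in> carrier G" for x y
    by (metis that carr(4) m_assoc)
  have dc: "d \<otimes> c = c \<otimes> d"
    unfolding comm(1)[symmetric] commutator_def using carr da db by (intro mult inv) auto
  have "class3 G i j a b c d"
    by unfold_locales (use carr comm da db dc in auto)
  then show ?thesis using ord by (simp add: rel_def)
qed

lemma relations_imp_rel:
  fixes G (structure)
  assumes G: "group G" and p: "prime p" and T: "listed p \<eta> T" "params T = (n, m, i, j, r, s)"
    and carr: "a \<in> carrier G" "b \<in> carrier G" "c \<in> carrier G" "Gen_d \<in> generators T \<Longrightarrow> d \<in> carrier G"
    and rels: "\<And>u v. (u, v) \<in> relations G p T a b c d \<Longrightarrow> u = v"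
  shows "rel G p n m i j r s a b c (central_gen G p T a b d)"
proof -
  interpret group G by fact
  note adm = listed_admissible[OF p T]
  have pp: "x [^] (\<nu> * int N) = (x [^] N) [^] \<nu>" if "x \<in> carrier G" for x \<nu> and N :: nat
    using int_pow_pow[OF that, of "int N" \<nu>] by (simp add: int_pow_int mult.commute)
  have rels': "\<forall>uv\<in>relations G p T a b c d. fst uv = snd uv"
    using rels by auto
  \<comment> \<open>The cases record where d comes from: a power of a (including \<open>H3\<close>,
    where s = 1 too), a power of b, or a generator.\<close>
  consider (a) "r = 1" | (b) "r = 0" "s = 1" | (d) "r = 0" "s = 0"
    using T by (cases T) auto
  then show ?thesis
  proof cases
    case a
    have "central_gen G p T a b d = a [^] (p ^ n) \<and> a [^] (p ^ (n + 1)) = \<one> \<and> c [^] p = \<one> \<and>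
      b [^] (p ^ m) = (a [^] (p ^ n)) [^] s \<and> commutator G a b = c \<and>
      commutator G c a = (a [^] (p ^ n)) [^] i \<and> commutator G c b = (a [^] (p ^ n)) [^] j"
      using a T rels' pp[OF carr(1), of _ "p ^ n"] int_pow_1[OF nat_pow_closed[OF carr(1)], of "p ^ n"] by (cases T) auto
    then show ?thesis unfolding a
      by (intro rel_if_d_power_of_a[OF G adm carr(1-3)]) auto
  next
    case b
    have "central_gen G p T a b d = b [^] (p ^ m) \<and> b [^] (p ^ (m + 1)) = \<one> \<and> c [^] p = \<one> \<and>
      a [^] (p ^ n) = \<one> \<and> commutator G a b = c \<and>
      commutator G c a = (b [^] (p ^ m)) [^] i \<and> commutator G c b = (b [^] (p ^ m)) [^] j"
      using b T rels' pp[OF carr(2), of _ "p ^ m"] int_pow_1[OF nat_pow_closed[OF carr(2)], of "p ^ m"] by (cases T) auto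
    then show ?thesis unfolding b
      by (intro rel_if_d_power_of_b[OF G adm carr(1-3)]) auto
  next
    case d
    have "Gen_d \<in> generators T" using d T by (cases T) auto
    then have dG: "d \<in> carrier G" by (rule carr)
    have "central_gen G p T a b d = d \<and> a [^] (p ^ n) = \<one> \<and> b [^] (p ^ m) = \<one> \<and> c [^] p = \<one> \<and>
      d [^] p = \<one> \<and> commutator G a b = c \<and> commutator G c a = d [^] i \<and> commutator G c b = d [^] j \<and>
      commutator G d a = \<one> \<and> commutator G d b = \<one>"
      using d T rels' carr(1-3) dG by (cases T) auto
    then show ?thesis unfolding d
      by (intro rel_if_d_generator[OF G]) (use carr dG in auto)
  qed
qed

lemma rel_imp_relations:
  fixes G (structure)
  assumes rel: "rel G p n m i j r s a b c d" and T: "listed p \<eta> T" "params T = (n, m, i, j, r, s)"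
  shows "central_gen G p T a b d = d" and "(u, v) \<in> relations G p T a b c d \<Longrightarrow> u = v"
proof -
  interpret class3 G i j a b c d using rel by (simp add: rel_def)
  have d: "commutator G d a = \<one>" "commutator G d b = \<one>"
    using da db by (simp_all add: commutator_eq_one_iff)
  have pp: "x [^] (\<nu> * int N) = (x [^] N) [^] \<nu>" if "x \<in> carrier G" for x \<nu> and N :: nat
    using int_pow_pow[OF that, of "int N" \<nu>] by (simp add: int_pow_int mult.commute)
  have ps: "x [^] (p * N) = (x [^] N) [^] p" if "x \<in> carrier G" for x and N :: nat
    using that by (simp add: mult.commute nat_pow_pow)
  have rels: "c [^] p = \<one>" "d [^] p = \<one>"
    "a [^] (p ^ n) = d [^] r" "b [^] (p ^ m) = d [^] s"
    using rel by (simp_all add: rel_def)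
  show "central_gen G p T a b d = d"
    using T rels by (cases T) auto
  show "u = v" if "(u, v) \<in> relations G p T a b c d"
    using that T rels ab ca cb d ps[of a "p ^ n"] ps[of b "p ^ m"] pp[of a _ "p ^ n"] pp[of b _ "p ^ m"]
    by (cases T) auto
qed

lemma relations_closed:
  assumes "group G" "a \<in> carrier G" "b \<in> carrier G" "c \<in> carrier G" "Gen_d \<in> generators T \<Longrightarrow> d \<in> carrier G"
  shows "relations G p T a b c d \<subseteq> carrier G \<times> carrier G"
proof -
  interpret group G by fact
  show ?thesis using assms by (cases T) auto
qed

lemma relations_hom:
  assumes "group G" "group H" "h \<in> hom G H" "a \<in> carrier G" "b \<in> carrier G" "c \<in> carrier G"
    "Gen_d \<in> generators T \<Longrightarrow> d \<in> carrier G"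
  shows "relations H p T (h a) (h b) (h c) (h d) = map_prod h h ` relations G p T a b c d"
proof -
  interpret group G by fact
  interpret H: group H by fact
  interpret h: group_hom G H h using assms(3) by unfold_locales
  note [simp] = hom_commutator[OF assms(2,3)] h.hom_nat_pow h.hom_int_pow
  show ?thesis using assms by (cases T) simp_all
qed

lemma central_gen_hom:
  assumes "group G" "group H" "h \<in> hom G H" "a \<in> carrier G" "b \<in> carrier G"
  shows "central_gen H p T (h a) (h b) (h d) = h (central_gen G p T a b d)"
proof -
  interpret group G by fact
  interpret H: group H by fact
  interpret h: group_hom G H h using assms(3) by unfold_locales
  show ?thesis using assms by (cases T) (simp_all add: h.hom_nat_pow)
qed

lemma M_relations_hom:
  assumes "group G" "group H" "h \<in> hom G H" "a \<in> carrier G" "b \<in> carrier G" "c \<in> carrier G"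
  shows "M_relations H p n m (h a) (h b) (h c) = map_prod h h ` M_relations G p n m a b c"
proof -
  interpret group G by fact
  interpret H: group H by fact
  interpret h: group_hom G H h using assms(3) by unfold_locales
  note [simp] = hom_commutator[OF assms(2,3)] h.hom_nat_pow h.hom_int_pow
  show ?thesis using assms by (simp add: M_relations_def)
qed

lemma Q_eq_collect:
  assumes "admissible p n m j"
  shows "nf p n m r s u = class3.collect (Q p n m i j r s) (nf p n m r s (1, 0, 0, 0))
    (nf p n m r s (0, 1, 0, 0)) (nf p n m r s (0, 0, 1, 0)) (nf p n m r s (0, 0, 0, 1)) u"
proof -
  interpret class3 "Q p n m i j r s" i j "nf p n m r s (1, 0, 0, 0)" "nf p n m r s (0, 1, 0, 0)"
    "nf p n m r s (0, 0, 1, 0)" "nf p n m r s (0, 0, 0, 1)"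
    using rel_Q[OF assms] by (simp add: rel_def del: nf.simps)
  obtain x y z w where u: "u = (x, y, z, w)" by (cases u)
  show ?thesis
    unfolding u collect_simp Q_int_pow[OF assms] U_int_pow Q_simps nf_hom_mult[OF assms] by simp
qed

lemma (in class3) hom_collect:
  assumes H: "group H" and h: "h \<in> hom G H" and H': "class3 H i j (h a) (h b) (h c) (h d)"
  shows "h (collect u) = class3.collect H (h a) (h b) (h c) (h d) u"
proof -
  interpret H': class3 H i j "h a" "h b" "h c" "h d" by fact
  interpret h: group_hom G H h using h by unfold_locales
  obtain x y z w where u: "u = (x, y, z, w)" by (cases u)
  show ?thesis
    by (simp add: u collect_simp H'.collect_simp h.hom_int_pow)
qed

lemma generators_subset: "{Gen_a, Gen_b, Gen_c} \<subseteq> generators T"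
  by (cases T) auto

lemma relations_ignore_d:
  assumes "Gen_d \<notin> generators T"
  shows "relations G p T a b c d = relations G p T a b c d'"
    and "central_gen G p T a b d = central_gen G p T a b d'"
  using assms by (cases T; simp)+

lemma central_gen_d: "Gen_d \<in> generators T \<Longrightarrow> central_gen G p T a b d = d"
  by (cases T) auto

text \<open>The upper bound for the order is collection in the presented group. The lower bound is
  the universal property: the generators of the model satisfy the presentation, so the presented
  group maps onto it.\<close>

lemma Q_iso_listed_group:
  assumes p: "prime p" and T: "listed p \<eta> T" "params T = (n, m, i, j, r, s)"
  shows "Q p n m i j r s \<cong> listed_group p T"
proof -
  note adm = listed_admissible[OF p T]
  note pp = admissible_p[OF adm]
  define A where "A = generators T"
  define F where "F = free_group A"
  define R where "R = relations F p T (free_gen A Gen_a) (free_gen A Gen_b) (free_gen A Gen_c) (free_gen A Gen_d)"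
  define L where "L = listed_group p T"
  let ?Q = "Q p n m i j r s"
  let ?f = "nf p n m r s"
  have L': "L = presented_group A R"
    by (simp add: L_def listed_group_def Let_def A_def R_def F_def)
  have gF: "group F" unfolding F_def by (rule group_free_group)
  have abc: "Gen_a \<in> A" "Gen_b \<in> A" "Gen_c \<in> A" using generators_subset by (auto simp: A_def)
  then have carr: "free_gen A Gen_a \<in> carrier F" "free_gen A Gen_b \<in> carrier F" "free_gen A Gen_c \<in> carrier F"
    "Gen_d \<in> generators T \<Longrightarrow> free_gen A Gen_d \<in> carrier F"
    by (auto simp: F_def free_gen_closed A_def)
  have R: "R \<subseteq> carrier F \<times> carrier F"
    unfolding R_def by (rule relations_closed[OF gF carr])
  obtain \<pi> where pi: "\<pi> \<in> hom F L" and gL: "group L" and piR: "\<And>u v. (u, v) \<in> R \<Longrightarrow> \<pi> u = \<pi> v"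
    and gen: "\<And>K. subgroup K L \<Longrightarrow> (\<And>x. x \<in> A \<Longrightarrow> \<pi> (free_gen A x) \<in> K) \<Longrightarrow> K = carrier L"
    and univ: "\<And>(H :: quad monoid) h. group H \<Longrightarrow> h \<in> hom F H \<Longrightarrow> (\<And>u v. (u, v) \<in> R \<Longrightarrow> h u = h v) \<Longrightarrow>
       \<exists>g\<in>hom L H. \<forall>u\<in>carrier F. g (\<pi> u) = h u"
    using presented_group_facts[of R A, folded F_def, OF R] unfolding L' by blast
  define a where "a = \<pi> (free_gen A Gen_a)"
  define b where "b = \<pi> (free_gen A Gen_b)"
  define c where "c = \<pi> (free_gen A Gen_c)"
  define d where "d = \<pi> (free_gen A Gen_d)"
  have carrL: "a \<in> carrier L" "b \<in> carrier L" "c \<in> carrier L" "Gen_d \<in> generators T \<Longrightarrow> d \<in> carrier L"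
    using carr pi by (auto simp: a_def b_def c_def d_def hom_def)
  have relsL: "relations L p T a b c d = map_prod \<pi> \<pi> ` R"
    unfolding a_def b_def c_def d_def R_def by (rule relations_hom[OF gF gL pi carr])
  have relL: "rel L p n m i j r s a b c (central_gen L p T a b d)"
  proof (rule relations_imp_rel[OF gL p T carrL])
    fix u v assume "(u, v) \<in> relations L p T a b c d"
    then show "u = v"
      unfolding relsL using piR by auto
  qed
  define D where "D = central_gen L p T a b d"
  note relL = relL[folded D_def]
  interpret L: class3 L i j a b c D using relL by (simp add: rel_def)
  have rng: "carrier L = range L.collect"
  proof (rule gen[symmetric, OF L.subgroup_range_collect])
    fix x assume x: "x \<in> A"
    have "a \<in> range L.collect" "b \<in> range L.collect" "c \<in> range L.collect" "D \<in> range L.collect"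
      by (metis L.collect_gens(1) rangeI, metis L.collect_gens(2) rangeI,
        metis L.collect_gens(3) rangeI, metis L.collect_gens(4) rangeI)
    moreover have "x = Gen_d \<Longrightarrow> D = d" using x by (simp add: D_def central_gen_d A_def)
    ultimately show "\<pi> (free_gen A x) \<in> range L.collect"
      by (cases x) (auto simp: a_def b_def c_def d_def)
  qed
  have gQ: "group ?Q" by (rule group_Q[OF adm])
  note relQ = rel_Q[OF adm, of i r s]
  define k where "k x = (case x of Gen_a \<Rightarrow> ?f (1, 0, 0, 0) | Gen_b \<Rightarrow> ?f (0, 1, 0, 0)
    | Gen_c \<Rightarrow> ?f (0, 0, 1, 0) | Gen_d \<Rightarrow> ?f (0, 0, 0, 1))" for x
  have k: "k x \<in> carrier ?Q" for x
    by (cases x) (simp_all add: k_def del: nf.simps)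
  obtain h where h: "h \<in> hom F ?Q" and hk: "\<And>x. x \<in> A \<Longrightarrow> h (free_gen A x) = k x"
    unfolding F_def using free_group_universal[of ?Q A k] gQ k by blast
  note hx = hk[unfolded k_def]
  have "h u = h v" if "(u, v) \<in> R" for u v
  proof -
    have "(h u, h v) \<in> map_prod h h ` R" using that by (metis map_prod_simp image_eqI)
    also have "map_prod h h ` R = relations ?Q p T (?f (1, 0, 0, 0)) (?f (0, 1, 0, 0)) (?f (0, 0, 1, 0)) (h (free_gen A Gen_d))"
    proof -
      have "map_prod h h ` R = relations ?Q p T (h (free_gen A Gen_a)) (h (free_gen A Gen_b)) (h (free_gen A Gen_c)) (h (free_gen A Gen_d))"
        unfolding R_def by (rule sym, rule relations_hom[OF gF gQ h carr])
      then show ?thesis using hx abc by (simp del: nf.simps)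
    qed
    \<comment> \<open>If \<open>Gen_d\<close> is not a generator, the value of h at its class is
      unspecified, but then the relations ignore that argument.\<close>
    also have "\<dots> = relations ?Q p T (?f (1, 0, 0, 0)) (?f (0, 1, 0, 0)) (?f (0, 0, 1, 0)) (?f (0, 0, 0, 1))"
    proof (cases "Gen_d \<in> generators T")
      case True
      then show ?thesis using hx by (simp add: A_def del: nf.simps)
    qed (rule relations_ignore_d(1))
    finally show "h u = h v" by (rule rel_imp_relations(2)[OF relQ T])
  qed
  then obtain g where g: "g \<in> hom L ?Q" and gpi: "\<And>u. u \<in> carrier F \<Longrightarrow> g (\<pi> u) = h u"
    using univ[OF gQ h] by blast
  have ga: "g a = ?f (1, 0, 0, 0)" and gb: "g b = ?f (0, 1, 0, 0)" and gc: "g c = ?f (0, 0, 1, 0)"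
    using abc carr by (simp_all add: a_def b_def c_def gpi hx del: nf.simps)
  have "g D = central_gen ?Q p T (g a) (g b) (g d)"
    using central_gen_hom[OF gL gQ g carrL(1,2), of p T d] by (simp add: D_def)
  also have "\<dots> = central_gen ?Q p T (g a) (g b) (?f (0, 0, 0, 1))"
  proof (cases "Gen_d \<in> generators T")
    case True
    then show ?thesis using hx gpi carr by (simp add: d_def A_def del: nf.simps)
  qed (rule relations_ignore_d(2))
  also have "\<dots> = ?f (0, 0, 0, 1)"
    unfolding ga gb by (rule rel_imp_relations(1)[OF relQ T])
  finally have gD: "g D = ?f (0, 0, 0, 1)" .
  have "class3 ?Q i j (g a) (g b) (g c) (g D)"
    unfolding ga gb gc gD using relQ unfolding rel_def by blast
  \<comment> \<open>Collecting and mapping back is reduction to normal form, so g is onto.\<close>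
  then have gf: "g (L.collect u) = ?f u" for u
    using L.hom_collect[OF gQ g, of u] unfolding Q_eq_collect[OF adm, of r s u i] ga gb gc gD by blast
  have "carrier ?Q \<subseteq> g ` carrier L"
    unfolding rng image_image gf by simp
  moreover have "finite (carrier L)"
    unfolding rng L.collect_image_Q[OF relL pp(2), symmetric] using finite_Q[OF pp(2)] by blast
  ultimately have "card (carrier ?Q) \<le> card (carrier L)"
    using surj_card_le by blast
  then show ?thesis
    unfolding card_Q[OF pp(2)] L_def[symmetric] using rng by (intro rel_imp_iso_Q[OF relL pp(2)]) auto
qed

text \<open>Only a lower bound for the order is required, to be used once finiteness is inherited
  from \<open>G\<close>. It comes from the model with all four residues zero, in which d is
  independent of a, b, c: elements with last coordinate 0 are counted.\<close>

lemma M_group_facts: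
  assumes p: "prime p" and nm: "1 \<le> m" "m \<le> n" "p = 2 \<longrightarrow> n > 1"
  obtains a b c where "group (M_group p n m)" "a \<in> carrier (M_group p n m)" "b \<in> carrier (M_group p n m)"
    "c \<in> carrier (M_group p n m)"
    "\<And>u v. (u, v) \<in> M_relations (M_group p n m) p n m a b c \<Longrightarrow> u = v"
    "\<And>K. subgroup K (M_group p n m) \<Longrightarrow> a \<in> K \<Longrightarrow> b \<in> K \<Longrightarrow> c \<in> K \<Longrightarrow> K = carrier (M_group p n m)"
    "finite (carrier (M_group p n m)) \<Longrightarrow> p ^ (n + m + 1) \<le> card (carrier (M_group p n m))"
proof -
  have adm: "admissible p n m 0" using p nm by (auto simp: admissible_def)
  note pp = admissible_p[OF adm]
  define A where "A = {Gen_a, Gen_b, Gen_c}"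
  define F where "F = free_group A"
  define R where "R = M_relations F p n m (free_gen A Gen_a) (free_gen A Gen_b) (free_gen A Gen_c)"
  define L where "L = M_group p n m"
  let ?Q = "Q p n m 0 0 0 0"
  let ?f = "nf p n m 0 0"
  have L': "L = presented_group A R"
    by (simp add: L_def M_group_def Let_def A_def R_def F_def)
  have gF: "group F" unfolding F_def by (rule group_free_group)
  interpret F: group F by fact
  have carr: "free_gen A Gen_a \<in> carrier F" "free_gen A Gen_b \<in> carrier F" "free_gen A Gen_c \<in> carrier F"
    by (auto simp: F_def free_gen_closed A_def)
  have R: "R \<subseteq> carrier F \<times> carrier F"
    unfolding R_def M_relations_def using carr by auto
  obtain \<pi> where pi: "\<pi> \<in> hom F L" and gL: "group L" and piR: "\<And>u v. (u, v) \<in> R \<Longrightarrow> \<pi> u = \<pi> v"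
    and gen: "\<And>K. subgroup K L \<Longrightarrow> (\<And>x. x \<in> A \<Longrightarrow> \<pi> (free_gen A x) \<in> K) \<Longrightarrow> K = carrier L"
    and univ: "\<And>(H :: quad monoid) h. group H \<Longrightarrow> h \<in> hom F H \<Longrightarrow> (\<And>u v. (u, v) \<in> R \<Longrightarrow> h u = h v) \<Longrightarrow>
       \<exists>g\<in>hom L H. \<forall>u\<in>carrier F. g (\<pi> u) = h u"
    using presented_group_facts[of R A, folded F_def, OF R] unfolding L' by blast
  define a where "a = \<pi> (free_gen A Gen_a)"
  define b where "b = \<pi> (free_gen A Gen_b)"
  define c where "c = \<pi> (free_gen A Gen_c)"
  have carrL: "a \<in> carrier L" "b \<in> carrier L" "c \<in> carrier L"
    using carr pi by (auto simp: a_def b_def c_def hom_def)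
  have gQ: "group ?Q" by (rule group_Q[OF adm])
  interpret Q: group ?Q by fact
  note relQ = rel_Q[OF adm, of 0 0 0]
  define k where "k x = (case x of Gen_a \<Rightarrow> ?f (1, 0, 0, 0) | Gen_b \<Rightarrow> ?f (0, 1, 0, 0)
    | Gen_c \<Rightarrow> ?f (0, 0, 1, 0) | Gen_d \<Rightarrow> ?f (0, 0, 0, 1))" for x
  have k: "k x \<in> carrier ?Q" for x
    by (cases x) (simp_all add: k_def del: nf.simps)
  obtain h where h: "h \<in> hom F ?Q" and hk: "\<And>x. x \<in> A \<Longrightarrow> h (free_gen A x) = k x"
    unfolding F_def using free_group_universal[of ?Q A k] gQ k by blast
  note hx = hk[unfolded k_def]
  have "h u = h v" if "(u, v) \<in> R" for u v
  proof -
    have "(h u, h v) \<in> map_prod h h ` R" using that by (metis map_prod_simp image_eqI)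
    also have "map_prod h h ` R = M_relations ?Q p n m (?f (1, 0, 0, 0)) (?f (0, 1, 0, 0)) (?f (0, 0, 1, 0))"
      unfolding R_def M_relations_hom[OF gF gQ h carr, symmetric] using hx by (simp add: A_def del: nf.simps)
    finally show "h u = h v"
      using relQ unfolding rel_def class3_def class3_axioms_def M_relations_def by (auto simp del: nf.simps Q_simps)
  qed
  then obtain g where g: "g \<in> hom L ?Q" and gpi: "\<And>u. u \<in> carrier F \<Longrightarrow> g (\<pi> u) = h u"
    using univ[OF gQ h] by blast
  have ga: "g a = ?f (1, 0, 0, 0)" and gb: "g b = ?f (0, 1, 0, 0)" and gc: "g c = ?f (0, 0, 1, 0)"
    using carr hx[of Gen_a] hx[of Gen_b] hx[of Gen_c]
    by (simp_all add: a_def b_def c_def gpi del: nf.simps) (simp_all add: A_def del: nf.simps)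
  interpret L: group L by fact
  interpret g: group_hom L ?Q g using g by unfold_locales
  show thesis
  proof
    show "group (M_group p n m)" using gL by (simp add: L_def)
    show "a \<in> carrier (M_group p n m)" "b \<in> carrier (M_group p n m)" "c \<in> carrier (M_group p n m)"
      using carrL by (simp_all add: L_def)
    show "u = v" if "(u, v) \<in> M_relations (M_group p n m) p n m a b c" for u v
      using that piR
      unfolding L_def[symmetric] a_def b_def c_def M_relations_hom[OF gF gL pi carr] R_def[symmetric] by auto
    show "K = carrier (M_group p n m)"
      if "subgroup K (M_group p n m)" "a \<in> K" "b \<in> K" "c \<in> K" for K
      using gen[of K] that unfolding L_def[symmetric] by (auto simp: A_def a_def b_def c_def)
    assume fin: "finite (carrier (M_group p n m))"
    define B where "B = {0..<int p ^ n} \<times> {0..<int p ^ m} \<times> {0..<int p} \<times> {0 :: int}"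
    have "B \<subseteq> g ` carrier L"
    proof
      fix u assume u: "u \<in> B"
      then obtain x y z where xyz: "u = (x, y, z, 0)" by (auto simp: B_def)
      have "g (a [^]\<^bsub>L\<^esub> x \<otimes>\<^bsub>L\<^esub> b [^]\<^bsub>L\<^esub> y \<otimes>\<^bsub>L\<^esub> c [^]\<^bsub>L\<^esub> z) = ?f (x, y, z, 0)"
        using carrL by (simp add: g.hom_int_pow ga gb gc Q_int_pow[OF adm] U_int_pow nf_hom_mult[OF adm] del: nf.simps)
      also have "\<dots> = u" using u xyz by (simp add: B_def)
      finally show "u \<in> g ` carrier L" using carrL by blast
    qed
    then have "card B \<le> card (carrier L)"
      using fin surj_card_le unfolding L_def by blast
    moreover have "card B = p ^ (n + m + 1)"
      by (simp add: B_def card_cartesian_product power_add nat_power_eq)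
    ultimately show "p ^ (n + m + 1) \<le> card (carrier (M_group p n m))" by (simp add: L_def)
  qed
qed

section \<open>Reduction to the model\<close>

lemma (in group) prime_order_subgroup:
  assumes Z: "subgroup Z G" and p: "prime (p::nat)" and card: "card Z = p"
  obtains d where "d \<in> Z" "d \<noteq> \<one>" "d [^] p = \<one>" "\<And>z. z \<in> Z \<Longrightarrow> \<exists>k::int. z = d [^] k"
proof -
  have fin: "finite Z" using card p by (metis card.infinite not_prime_0)
  have "\<not> Z \<subseteq> {\<one>}"
    using card p card_mono[of "{\<one>}" Z] prime_gt_1_nat[of p] by auto
  then obtain d where d: "d \<in> Z" "d \<noteq> \<one>" by blast
  have dG: "d \<in> carrier G" using d subgroup.subset[OF Z] by blast
  interpret H: group "G\<lparr>carrier := Z\<rparr>" by (rule subgroup.subgroup_is_group[OF Z is_group])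
  define S where "S = generate G {d}"
  have SG: "subgroup S G" unfolding S_def using dG by (intro generate_is_subgroup) auto
  have SZ: "S \<subseteq> Z" unfolding S_def using d Z by (intro generate_subgroup_incl) auto
  have "subgroup S (G\<lparr>carrier := Z\<rparr>)" by (rule subgroup_incl[OF SG Z SZ])
  from H.lagrange[OF this] have "card S dvd p" by (metis card dvd_triv_right order_def partial_object.simps(1) partial_object.surjective partial_object.update_convs(1))
  then have "card S = 1 \<or> card S = p" using p by (metis prime_nat_iff)
  moreover have "{\<one>, d} \<subseteq> S" using subgroup.one_closed[OF SG] by (auto simp: S_def generate.incl)
  then have "card {\<one>, d} \<le> card S" using SZ fin by (meson card_mono finite_subset)
  then have "card S \<noteq> 1" using d by simp
  ultimately have "S = Z" using SZ fin card by (intro card_subset_eq) auto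
  then have "\<exists>k::int. z = d [^] k" if "z \<in> Z" for z
    using that dG generate_pow[of d] by (auto simp: S_def)
  moreover have "d [^] p = \<one>"
    using H.pow_order_eq_1[of d] d card by (simp add: order_def nat_pow_consistent[symmetric])
  ultimately show thesis using that d by blast
qed

lemma fermat_power:
  assumes "prime (p::nat)" shows "[x ^ (p ^ k) = x] (mod p)"
proof (induction k)
  case (Suc k)
  have f: "[y ^ p = y] (mod p)" for y
  proof (cases "p dvd y")
    case True
    then show ?thesis using assms prime_gt_0_nat[of p]
      by (meson cong_0_iff cong_sym cong_trans dvd_power dvd_trans)
  next
    case False
    have "[y ^ (p - 1) * y = 1 * y] (mod p)" using fermat_theorem[OF assms False] by (intro cong_mult) auto
    moreover have "y ^ (p - 1) * y = y ^ p" using assms prime_gt_0_nat[of p] by (metis power_minus_mult)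
    ultimately show ?thesis by simp
  qed
  have "x ^ (p ^ Suc k) = (x ^ (p ^ k)) ^ p" by (simp add: mult.commute flip: power_mult)
  then show ?case using f[of "x ^ (p ^ k)"] Suc by (metis cong_trans)
qed simp

text \<open>
  If \<open>g\<close> maps a generator \<open>d\<close> of \<open>Z\<close> to \<open>d\<^sup>q\<close> and has order dividing \<open>p ^ N\<close>, then
  \<open>q ^ (p ^ N) \<equiv> 1\<close> modulo \<open>p\<close>, whereas \<open>q ^ (p ^ N) \<equiv> q\<close> by Fermat.
\<close>

lemma (in group) prime_order_normal_central:
  assumes G: "order G = p ^ N" and Z: "Z \<lhd> G" and p: "prime (p::nat)" and card: "card Z = p"
    and z: "z \<in> Z" and g: "g \<in> carrier G"
  shows "z \<otimes> g = g \<otimes> z"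
proof -
  interpret Z: normal Z G by fact
  obtain d where d: "d \<in> Z" "d \<noteq> \<one>" "d [^] p = \<one>" "\<And>z. z \<in> Z \<Longrightarrow> \<exists>k::int. z = d [^] k"
    using prime_order_subgroup[OF Z.subgroup_axioms p card] by blast
  have dG: "d \<in> carrier G" using d Z.subset by blast
  have dmod: "d [^] (k mod p) = d [^] k" for k :: nat
  proof -
    have "d [^] k = d [^] (p * (k div p) + k mod p)" by simp
    also have "\<dots> = (d [^] p) [^] (k div p) \<otimes> d [^] (k mod p)"
      using dG by (simp only: nat_pow_mult nat_pow_pow)
    finally show ?thesis using d dG by simp
  qed
  have pN: "x [^] (p ^ N) = \<one>" if "x \<in> carrier G" for x using that G pow_order_eq_1 by metis
  have "inv g \<otimes> d \<otimes> g \<in> Z" using Z.inv_op_closed1 g d by blast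
  then obtain k :: int where k: "inv g \<otimes> d \<otimes> g = d [^] k" using d by blast
  have dp: "d [^] int p = \<one>" using d by (simp add: int_pow_int)
  obtain q where q: "d [^] k = d [^] (q :: nat)"
  proof
    have "d [^] k = d [^] (int p * (k div int p) + k mod int p)" by simp
    also have "\<dots> = (d [^] int p) [^] (k div int p) \<otimes> d [^] (k mod int p)"
      using dG by (simp only: int_pow_mult int_pow_pow)
    also have "\<dots> = d [^] (k mod int p)" using dp dG by simp
    also have "\<dots> = d [^] int (nat (k mod int p))" using p by (simp add: prime_gt_0_nat)
    finally show "d [^] k = d [^] nat (k mod int p)" by (simp only: int_pow_int)
  qed
  have dg: "d \<otimes> g = g \<otimes> d [^] q"
  proof -
    have "g \<otimes> (inv g \<otimes> d \<otimes> g) = d \<otimes> g" using g dG by (simp add: m_assoc[symmetric])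
    then show ?thesis by (simp add: k q)
  qed
  have conj: "d [^] l \<otimes> g = g \<otimes> d [^] (q * l)" for l :: nat
    using int_pow_conj[OF dG _ g dg, of "int l"] dG by (simp add: int_pow_int nat_pow_pow)
  have "d \<otimes> g [^] l = g [^] l \<otimes> d [^] (q ^ l)" for l :: nat
  proof (induction l)
    case (Suc l)
    have "d \<otimes> g [^] Suc l = g [^] l \<otimes> (d [^] (q ^ l) \<otimes> g)"
      using g dG Suc by (simp add: m_assoc[symmetric])
    then show ?case using g dG by (simp add: conj m_assoc)
  qed (use dG in simp)
  from this[of "p ^ N"] have "d = d [^] (q ^ (p ^ N))" using g dG by (simp add: pN)
  also have "\<dots> = d [^] (q ^ (p ^ N) mod p)" by (rule dmod[symmetric])
  also have "q ^ (p ^ N) mod p = q mod p" using fermat_power[OF p] by (simp add: cong_def)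
  also have "d [^] (q mod p) = d [^] q" by (rule dmod)
  finally have "d \<otimes> g = g \<otimes> d" using dg by simp
  moreover obtain l :: int where "z = d [^] l" using d z by blast
  ultimately show ?thesis using int_pow_conj[of d d g l] g dG by simp
qed

text \<open>\<open>derived\<close> is built from x y x^-1 y^-1, which is the commutator of x^-1 and
  y^-1 in the convention used here.\<close>

lemma (in group) commutator_subgroup_derived:
  "commutator_subgroup G (carrier G) (carrier G) = derived G (carrier G)"
proof -
  have "{commutator G x y | x y. x \<in> carrier G \<and> y \<in> carrier G} = derived_set G (carrier G)"
  proof (intro equalityI subsetI)
    fix t assume "t \<in> {commutator G x y | x y. x \<in> carrier G \<and> y \<in> carrier G}"
    then obtain x y where "x \<in> carrier G" "y \<in> carrier G" "t = commutator G x y" by blast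
    then show "t \<in> derived_set G (carrier G)"
      by (intro UN_I[of "inv x"] UN_I[of "inv y"]) (auto simp: commutator_def)
  next
    fix t assume "t \<in> derived_set G (carrier G)"
    then obtain x y where "x \<in> carrier G" "y \<in> carrier G" "t = x \<otimes> y \<otimes> inv x \<otimes> inv y" by blast
    then have "t = commutator G (inv x) (inv y)" "inv x \<in> carrier G" "inv y \<in> carrier G"
      by (auto simp: commutator_def)
    then show "t \<in> {commutator G x y | x y. x \<in> carrier G \<and> y \<in> carrier G}" by blast
  qed
  then show ?thesis by (simp add: commutator_subgroup_def derived_def)
qed

lemma (in group) commutator_in_derived:
  "x \<in> carrier G \<Longrightarrow> y \<in> carrier G \<Longrightarrow> commutator G x y \<in> derived G (carrier G)"
  unfolding commutator_subgroup_derived[symmetric] commutator_subgroup_def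
  by (rule generate.incl) blast

lemma (in group) commutator_subgroup_normal:
  assumes "A \<lhd> G" shows "commutator_subgroup G A (carrier G) \<lhd> G"
  unfolding commutator_subgroup_def
proof (rule normal_generateI)
  interpret A: normal A G by fact
  show "{commutator G x y | x y. x \<in> A \<and> y \<in> carrier G} \<subseteq> carrier G" using A.subset by auto
  fix h g assume "h \<in> {commutator G x y | x y. x \<in> A \<and> y \<in> carrier G}" and g: "g \<in> carrier G"
  then obtain x y where xy: "x \<in> A" "y \<in> carrier G" and h: "h = commutator G x y" by blast
  have xG: "x \<in> carrier G" using xy A.subset by blast
  have "(\<lambda>x. g \<otimes> x \<otimes> inv g) \<in> hom G G"
    using g by (intro homI) (simp_all add: m_assoc, simp add: m_assoc[symmetric])
  from hom_commutator[OF is_group this xG xy(2)]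
  have "g \<otimes> h \<otimes> inv g = commutator G (g \<otimes> x \<otimes> inv g) (g \<otimes> y \<otimes> inv g)" by (simp add: h)
  moreover have "g \<otimes> x \<otimes> inv g \<in> A" using A.inv_op_closed2 g xy by blast
  ultimately show "g \<otimes> h \<otimes> inv g \<in> {commutator G x y | x y. x \<in> A \<and> y \<in> carrier G}"
    using g xy by auto
qed

lemma (in group) subgroup_center: "subgroup {x \<in> carrier G. \<forall>y\<in>carrier G. x \<otimes> y = y \<otimes> x} G"
proof (rule subgroupI)
  fix x assume x: "x \<in> {x \<in> carrier G. \<forall>y\<in>carrier G. x \<otimes> y = y \<otimes> x}"
  then have "inv x \<otimes> y = y \<otimes> inv x" if y: "y \<in> carrier G" for y
    using int_pow_commute[of x y "- 1" 1] y by (simp add: int_pow_neg)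
  then show "inv x \<in> {x \<in> carrier G. \<forall>y\<in>carrier G. x \<otimes> y = y \<otimes> x}" using x by auto
next
  fix x y assume xy: "x \<in> {x \<in> carrier G. \<forall>y\<in>carrier G. x \<otimes> y = y \<otimes> x}"
    "y \<in> {x \<in> carrier G. \<forall>y\<in>carrier G. x \<otimes> y = y \<otimes> x}"
  have "x \<otimes> y \<otimes> w = w \<otimes> (x \<otimes> y)" if w: "w \<in> carrier G" for w
  proof -
    have G: "x \<in> carrier G" "y \<in> carrier G" and xw: "x \<otimes> w = w \<otimes> x" and yw: "y \<otimes> w = w \<otimes> y"
      using xy w by blast+
    have "x \<otimes> y \<otimes> w = x \<otimes> (w \<otimes> y)" unfolding yw[symmetric] by (rule m_assoc[OF G w])
    also have "\<dots> = w \<otimes> x \<otimes> y" unfolding xw[symmetric] by (rule m_assoc[OF G(1) w G(2), symmetric])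
    finally show ?thesis using G w by (simp only: m_assoc)
  qed
  then show "x \<otimes> y \<in> {x \<in> carrier G. \<forall>y\<in>carrier G. x \<otimes> y = y \<otimes> x}" using xy by blast
qed (auto intro!: exI[of _ \<one>])

lemma (in group) commutator_subgroup_central:
  assumes "A \<subseteq> carrier G" "\<And>x y. x \<in> A \<Longrightarrow> y \<in> carrier G \<Longrightarrow> x \<otimes> y = y \<otimes> x"
  shows "commutator_subgroup G A (carrier G) = {\<one>}"
proof
  have "{commutator G x y | x y. x \<in> A \<and> y \<in> carrier G} \<subseteq> {\<one>}"
    using assms by (auto simp: commutator_eq_one_iff subset_iff)
  then show "commutator_subgroup G A (carrier G) \<subseteq> {\<one>}"
    unfolding commutator_subgroup_def by (intro generate_subgroup_incl triv_subgroup)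
  show "{\<one>} \<subseteq> commutator_subgroup G A (carrier G)"
    by (simp add: commutator_subgroup_def generate.one)
qed

text \<open>If a maximal M missed c^p, then M together with the central element c^p would generate
  H, and c = x c^(p k) with x in M. Then c^(1 - p k) lies in M, and 1 - p k is prime to the group
  order, so c and c^p lie in M after all.\<close>

lemma (in group) pow_in_frattini:
  assumes ord: "order G = p ^ N" and p: "prime (p::nat)"
    and H: "subgroup H G" and c: "c \<in> H" and central: "\<And>x. x \<in> H \<Longrightarrow> c [^] p \<otimes> x = x \<otimes> c [^] p"
  shows "c [^] p \<in> frattini (G\<lparr>carrier := H\<rparr>)"
proof -
  have cG: "c \<in> carrier G" using c subgroup.subset[OF H] by blast
  have cp: "c [^] p \<in> H" using c H by (metis int_pow_int subgroup_int_pow_closed)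
  interpret H: group "G\<lparr>carrier := H\<rparr>" by (rule subgroup.subgroup_is_group[OF H is_group])
  have "c [^] p \<in> M" if max: "maximal_subgroup M (G\<lparr>carrier := H\<rparr>)" for M
  proof -
    have MH: "subgroup M (G\<lparr>carrier := H\<rparr>)" using max by (simp add: maximal_subgroup_def)
    have M: "subgroup M G" by (rule incl_subgroup[OF H MH])
    have MsubH: "M \<subseteq> H" using subgroup.subset[OF MH] by simp
    have MG: "x \<in> carrier G" if "x \<in> M" for x using that subgroup.subset[OF M] by blast
    define e where "e = c [^] p"
    have eG: "e \<in> carrier G" using cG by (simp add: e_def)
    have ex: "e [^] k \<otimes> x = x \<otimes> e [^] k" if "x \<in> H" for x and k :: int
      using int_pow_conj[OF eG eG] central[OF that] that subgroup.subset[OF H] by (auto simp: e_def)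
    define K where "K = {x \<otimes> e [^] k | x (k::int). x \<in> M}"
    have KG: "subgroup K G"
    proof (rule subgroupI)
      show "K \<subseteq> carrier G" using MG eG by (auto simp: K_def)
      show "K \<noteq> {}" using subgroup.one_closed[OF M] by (auto simp: K_def)
      fix u assume "u \<in> K"
      then obtain x k where u: "u = x \<otimes> e [^] (k::int)" "x \<in> M" by (auto simp: K_def)
      have "inv u = inv (e [^] k \<otimes> x)" using u MsubH ex by auto
      also have "\<dots> = inv x \<otimes> e [^] (- k)" using u MG eG by (simp add: inv_mult_group int_pow_neg)
      finally show "inv u \<in> K" using subgroup.m_inv_closed[OF M u(2)] by (auto simp: K_def)
      fix v assume "v \<in> K"
      then obtain y l where v: "v = y \<otimes> e [^] (l::int)" "y \<in> M" by (auto simp: K_def)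
      have "u \<otimes> v = x \<otimes> (e [^] k \<otimes> y) \<otimes> e [^] l" using u v MG eG by (simp add: m_assoc)
      also have "e [^] k \<otimes> y = y \<otimes> e [^] k"
        using v MsubH by (intro ex) blast
      also have "x \<otimes> (y \<otimes> e [^] k) \<otimes> e [^] l = x \<otimes> y \<otimes> e [^] (k + l)"
        using u v MG eG by (simp add: m_assoc int_pow_mult)
      finally show "u \<otimes> v \<in> K" using subgroup.m_closed[OF M u(2) v(2)] by (auto simp: K_def)
    qed
    have "K \<subseteq> H"
      using MsubH subgroup.m_closed[OF H] subgroup_int_pow_closed[OF H cp] by (auto simp: K_def e_def)
    then have "subgroup K (G\<lparr>carrier := H\<rparr>)" by (rule subgroup_incl[OF KG H])
    moreover have "M \<subseteq> K"
    proof
      fix x assume x: "x \<in> M"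
      then have "x = x \<otimes> e [^] (0::int)" using MG by simp
      then show "x \<in> K" unfolding K_def using x by blast
    qed
    ultimately have "K = M \<or> K = H" using max by (auto simp: maximal_subgroup_def)
    then show ?thesis
    proof
      assume "K = M"
      moreover have "\<one> \<otimes> e [^] (1::int) \<in> K" unfolding K_def using subgroup.one_closed[OF M] by blast
      ultimately show ?thesis using eG by (simp add: e_def)
    next
      assume "K = H"
      then obtain x k where x: "c = x \<otimes> e [^] (k::int)" "x \<in> M" using c unfolding K_def by auto
      have "e [^] k = c [^] (int p * k)"
        using cG by (simp add: e_def int_pow_int flip: int_pow_pow)
      then have "c = x \<otimes> c [^] (int p * k)" using x by simp
      then have "c \<otimes> c [^] (- (int p * k)) = x \<otimes> (c [^] (int p * k) \<otimes> c [^] (- (int p * k)))"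
        using cG MG x by (metis m_assoc int_pow_closed)
      also have "\<dots> = x" using cG MG x by (simp flip: int_pow_mult)
      finally have "c [^] (1 - int p * k) \<in> M"
        using x cG int_pow_mult[of c 1 "- (int p * k)"] by simp
      moreover have "coprime (1 - int p * k) (int (order G))"
      proof -
        have "coprime (1 - int p * k) (int p)"
        proof -
          have "\<not> int p dvd 1 - int p * k"
            using p by (metis diff_add_cancel dvd_add dvd_triv_left not_prime_unit int_dvd_int_iff of_nat_1)
          then show ?thesis using p by (metis coprime_commute prime_imp_coprime prime_nat_int_transfer)
        qed
        then show ?thesis by (simp add: ord)
      qed
      ultimately have "c \<in> M" by (intro pow_mem_subgroup_imp[OF M cG])
      then show ?thesis using M by (metis int_pow_int subgroup_int_pow_closed)
    qed
  qed
  then show ?thesis using cp by (auto simp: frattini_def)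
qed

lemma (in class3) commutator_collect_derived:
  assumes "d [^] i = \<one>" "d [^] j = \<one>"
  shows "collect (0, 0, z, w) \<otimes> collect v = collect v \<otimes> collect (0, 0, z, w)"
proof -
  obtain x' y' z' w' where v: "v = (x', y', z', w')" by (cases v)
  have "commutator G (collect (0, 0, z, w)) (collect v) = collect (0, 0, 0, z * (i * x' + j * y'))"
    using group.hom_commutator[OF group_U is_group collect_hom, of "(0, 0, z, w)" v]
    unfolding v commutator_U_derived by simp
  also have "\<dots> = (d [^] i) [^] (z * x') \<otimes> (d [^] j) [^] (z * y')"
    by (simp add: int_pow_pow int_pow_mult[symmetric] algebra_simps)
  also have "\<dots> = \<one>" using assms by simp
  finally show ?thesis by (simp add: commutator_eq_one_iff)
qed

text \<open>When i and j vanish modulo p, c is central along with d, and the class is at most 2.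
  This rules out both vanishing when \<open>G_3\<close> is nontrivial.\<close>

lemma (in class3) derived_central:
  assumes gen: "carrier G \<subseteq> range collect" and "d [^] i = \<one>" "d [^] j = \<one>"
    and x: "x \<in> derived G (carrier G)" and y: "y \<in> carrier G"
  shows "x \<otimes> y = y \<otimes> x"
proof -
  have "{commutator G x y | x y. x \<in> carrier G \<and> y \<in> carrier G} \<subseteq> {x \<in> carrier G. \<forall>y\<in>carrier G. x \<otimes> y = y \<otimes> x}"
  proof clarify
    fix x y assume xy: "x \<in> carrier G" "y \<in> carrier G"
    obtain u v where uv: "x = collect u" "y = collect v" using xy gen by blast
    obtain D e where De: "commutator (U i j) u v = (0, 0, D, e)"
      using commutator_U by (metis prod_cases4)
    have c: "commutator G x y = collect (0, 0, D, e)"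
      using group.hom_commutator[OF group_U is_group collect_hom, of u v] unfolding De uv by simp
    have "\<forall>t\<in>carrier G. collect (0, 0, D, e) \<otimes> t = t \<otimes> collect (0, 0, D, e)"
    proof
      fix t assume "t \<in> carrier G"
      then obtain w where "t = collect w" using gen by blast
      then show "collect (0, 0, D, e) \<otimes> t = t \<otimes> collect (0, 0, D, e)"
        using commutator_collect_derived[OF assms(2,3)] by simp
    qed
    then show "commutator G x y \<in> carrier G \<and> (\<forall>t\<in>carrier G. commutator G x y \<otimes> t = t \<otimes> commutator G x y)"
      unfolding c by simp
  qed
  then have "derived G (carrier G) \<subseteq> {x \<in> carrier G. \<forall>y\<in>carrier G. x \<otimes> y = y \<otimes> x}"
    unfolding commutator_subgroup_derived[symmetric] commutator_subgroup_def
    by (rule generate_subgroup_incl[OF _ subgroup_center])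
  then show ?thesis using x y by blast
qed

text \<open>Lifts of the generators of the quotient satisfy its relations up to elements of
  \<open>Z\<close>, that is, up to powers of d, whose exponents are the four residues.\<close>

lemma reduction:
  fixes G (structure)
  defines "Z \<equiv> commutator_subgroup G (derived G (carrier G)) (carrier G)"
  assumes p: "prime p" and fpg: "finite_p_group p G"
    and isoZ: "G\<lparr>carrier := Z\<rparr> \<cong> integer_mod_group p"
    and fr: "frattini (G\<lparr>carrier := derived G (carrier G)\<rparr>) = {\<one>}"
    and nm: "1 \<le> m" "m \<le> n" "p = 2 \<longrightarrow> n > 1"
    and isoM: "G Mod Z \<cong> M_group p n m"
  shows "\<exists>i j r s. admissible p n m j \<and> \<not> (int p dvd i \<and> int p dvd j) \<and> Q p n m i j r s \<cong> G"
    and "has_nilpotency_class G 3"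
proof -
  interpret group G using fpg by (simp add: finite_p_group_def)
  have fin: "finite (carrier G)" using fpg by (simp add: finite_p_group_def)
  obtain N where ord: "order G = p ^ N" using fpg by (auto simp: finite_p_group_def)
  have p0: "p > 0" using p by (rule prime_gt_0_nat)
  interpret D: normal "derived G (carrier G)" G by (rule derived_self_is_normal)
  interpret Z: normal Z G unfolding Z_def by (rule commutator_subgroup_normal[OF D.normal_axioms])
  have cardZ: "card Z = p"
    using iso_same_card[OF isoZ] p0 by (simp add: carrier_integer_mod_group)
  obtain d where d: "d \<in> Z" "d \<noteq> \<one>" "d [^] p = \<one>" "\<And>z. z \<in> Z \<Longrightarrow> \<exists>k::int. z = d [^] k"
    using prime_order_subgroup[OF Z.subgroup_axioms p cardZ] by blast
  have dG: "d \<in> carrier G" using d Z.subset by blast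
  have central: "z \<otimes> g = g \<otimes> z" if "z \<in> Z" "g \<in> carrier G" for z g
    by (rule prime_order_normal_central[OF ord Z.normal_axioms p cardZ that])
  have dvd: "int p dvd k" if "d [^] (k::int) = \<one>" for k
  proof (rule ccontr)
    assume "\<not> int p dvd k"
    then have "coprime k (int p)" using p by (metis coprime_commute prime_imp_coprime prime_nat_int_transfer)
    then obtain x :: int where "d = (d [^] k) [^] x"
      using int_pow_root[of d p k] dG d(3) by (metis int_pow_int)
    then show False using that d(2) by simp
  qed

  obtain a' b' c' where M: "group (M_group p n m)" "a' \<in> carrier (M_group p n m)" "b' \<in> carrier (M_group p n m)"
    "c' \<in> carrier (M_group p n m)"
    "\<And>u v. (u, v) \<in> M_relations (M_group p n m) p n m a' b' c' \<Longrightarrow> u = v"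
    "\<And>K. subgroup K (M_group p n m) \<Longrightarrow> a' \<in> K \<Longrightarrow> b' \<in> K \<Longrightarrow> c' \<in> K \<Longrightarrow> K = carrier (M_group p n m)"
    "finite (carrier (M_group p n m)) \<Longrightarrow> p ^ (n + m + 1) \<le> card (carrier (M_group p n m))"
    using M_group_facts[OF p nm] by blast
  have gF: "group (G Mod Z)" by (rule Z.factorgroup_is_group)
  obtain f where f: "f \<in> iso (M_group p n m) (G Mod Z)"
    using group.iso_sym[OF gF isoM] by (auto simp: is_iso_def)
  have fh: "f \<in> hom (M_group p n m) (G Mod Z)" using f by (simp add: iso_def)
  interpret M: group "M_group p n m" by fact
  interpret F: group "G Mod Z" by fact
  interpret f: group_hom "M_group p n m" "G Mod Z" f using fh by unfold_locales
  let ?\<pi> = "\<lambda>x. Z #> x"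
  have pih: "?\<pi> \<in> hom G (G Mod Z)" by (rule Z.r_coset_hom_Mod)
  interpret pi: group_hom G "G Mod Z" ?\<pi> using pih by unfold_locales
  have rep: "\<exists>x\<in>carrier G. f t = ?\<pi> x" if "t \<in> carrier (M_group p n m)" for t
    using f.hom_closed[OF that] by (auto simp: carrier_FactGroup)
  obtain a where a: "a \<in> carrier G" "f a' = ?\<pi> a" using rep[OF M(2)] by blast
  obtain b where b: "b \<in> carrier G" "f b' = ?\<pi> b" using rep[OF M(3)] by blast
  define c where "c = commutator G a b"
  have cG: "c \<in> carrier G" using a b by (simp add: c_def)
  have Zone: "x \<in> Z" if "?\<pi> x = \<one>\<^bsub>G Mod Z\<^esub>" "x \<in> carrier G" for x
    using that coset_join1[OF _ that(2) Z.subgroup_axioms] by simp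
  have Mrel: "u = v" if "(u, v) \<in> M_relations (G Mod Z) p n m (f a') (f b') (f c')" for u v
    using that M(5) unfolding M_relations_hom[OF M(1) gF fh M(2-4)] by auto
  have c: "f c' = ?\<pi> c"
  proof -
    have "commutator (G Mod Z) (f a') (f b') = f c'" by (rule Mrel) (simp add: M_relations_def)
    then show ?thesis using hom_commutator[OF gF pih a(1) b(1)] by (simp add: a b c_def)
  qed
  have "?\<pi> (a [^] (p ^ n)) = \<one>\<^bsub>G Mod Z\<^esub>" "?\<pi> (b [^] (p ^ m)) = \<one>\<^bsub>G Mod Z\<^esub>" "?\<pi> (c [^] p) = \<one>\<^bsub>G Mod Z\<^esub>"
    unfolding pi.hom_nat_pow[OF a(1)] pi.hom_nat_pow[OF b(1)] pi.hom_nat_pow[OF cG] a(2)[symmetric] b(2)[symmetric] c[symmetric]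
    by (rule Mrel; simp add: M_relations_def)+
  then have abcZ: "a [^] (p ^ n) \<in> Z" "b [^] (p ^ m) \<in> Z" "c [^] p \<in> Z"
    using Zone a b cG by blast+
  obtain r :: int where r: "a [^] (p ^ n) = d [^] r" using d abcZ by blast
  obtain s :: int where s: "b [^] (p ^ m) = d [^] s" using d abcZ by blast
  have cD: "c \<in> derived G (carrier G)" unfolding c_def using a b by (intro commutator_in_derived)
  have inZ: "commutator G x y \<in> Z" if "x \<in> derived G (carrier G)" "y \<in> carrier G" for x y
    unfolding Z_def commutator_subgroup_def using that by (intro generate.incl) blast
  obtain i :: int where i: "commutator G c a = d [^] i" using d inZ[OF cD a(1)] by blast
  obtain j :: int where j: "commutator G c b = d [^] j" using d inZ[OF cD b(1)] by blast
  \<comment> \<open>c^p lies in \<open>Z\<close> and is therefore central, as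
    \<open>pow_in_frattini\<close> requires.\<close>
  have "c [^] p \<in> frattini (G\<lparr>carrier := derived G (carrier G)\<rparr>)"
    using central[OF abcZ(3)] D.subset
    by (intro pow_in_frattini[OF ord p D.subgroup_axioms cD]) blast
  then have cp: "c [^] p = \<one>" using fr by simp
  interpret class3 G i j a b c d
    by unfold_locales (use a b cG dG i j central[OF d(1)] in \<open>auto simp: c_def\<close>)
  have rel: "rel G p n m i j r s a b c d"
    using cp d r s by (simp add: rel_def class3_axioms)
  have dS: "z \<in> range collect" if "z \<in> Z" for z
    using d(4)[OF that] collect_gens(6) by (metis rangeI)
  have gen: "carrier G \<subseteq> range collect"
  proof
    fix x assume x: "x \<in> carrier G"
    \<comment> \<open>The lifts generate modulo \<open>Z\<close> because a', b', c' generate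
      \<open>M_group\<close>; \<open>Z\<close> itself is covered by powers of d.\<close>
    define K where "K = {t \<in> carrier (M_group p n m). f t \<in> ?\<pi> ` range collect}"
    have "subgroup K (M_group p n m)"
      unfolding K_def by (intro f.subgroup_preimage pi.subgroup_img_is_subgroup subgroup_range_collect)
    moreover have "a \<in> range collect" "b \<in> range collect" "c \<in> range collect"
      by (metis collect_gens(1) rangeI, metis collect_gens(2) rangeI, metis collect_gens(3) rangeI)
    then have "a' \<in> K" "b' \<in> K" "c' \<in> K" using M(2-4) a b c unfolding K_def by auto
    ultimately have K: "K = carrier (M_group p n m)" by (rule M(6))
    have "?\<pi> x \<in> carrier (G Mod Z)" using x by simp
    then obtain t where "t \<in> carrier (M_group p n m)" "f t = ?\<pi> x"
      using f unfolding iso_def bij_betw_def by auto (metis imageE)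
    then have "t \<in> K" "f t = ?\<pi> x" using K by simp_all
    then have "?\<pi> x \<in> ?\<pi> ` range collect" unfolding K_def by (metis (mono_tags, lifting) mem_Collect_eq)
    then obtain u where u: "?\<pi> x = ?\<pi> (collect u)" by blast
    have "x \<in> ?\<pi> x" by (rule rcos_self[OF x Z.subgroup_axioms])
    then have "x \<in> Z #> collect u" by (simp only: u)
    then obtain z where "z \<in> Z" "x = z \<otimes> collect u" by (auto simp: r_coset_def)
    then show "x \<in> range collect"
      using subgroup.m_closed[OF subgroup_range_collect dS[of z]] by blast
  qed
  have "card (carrier (G Mod Z)) * card Z = card (carrier G)"
    using lagrange_finite[OF fin Z.subgroup_axioms] by (simp add: FactGroup_def order_def)
  moreover have "card (carrier (G Mod Z)) = card (carrier (M_group p n m))"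
    using iso_same_card[OF isoM] .
  moreover have "finite (carrier (G Mod Z))" using fin by (simp add: carrier_FactGroup)
  then have "finite (carrier (M_group p n m))" using iso_finite[OF isoM] by blast
  then have "p ^ (n + m + 1) * p \<le> card (carrier (M_group p n m)) * p" using M(7) by simp
  ultimately have card: "p ^ (n + m + 2) \<le> card (carrier G)" using cardZ by (simp add: mult.commute)
  have Zne: "Z \<noteq> {\<one>}" using d by blast
  have nz: "\<not> (int p dvd i \<and> int p dvd j)"
  proof
    assume "int p dvd i \<and> int p dvd j"
    then have "d [^] i = \<one>" "d [^] j = \<one>" using pow_eq_one_dvd[OF dG d(3)] by blast+
    then have "Z = {\<one>}"
      unfolding Z_def using derived_central[OF gen] D.subset by (intro commutator_subgroup_central) auto
    then show False using Zne by simp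
  qed
  \<comment> \<open>b^2 = d^s commutes with a, while moving it past a produces c^-2 d^-j with c^2 =
    1.\<close>
  have "int p dvd j" if "p = 2" "m = 1"
  proof -
    have b2: "b [^] (2::int) = d [^] s" using s that int_pow_int[of G b 2] by simp
    have "b [^] (2::int) \<otimes> a = a \<otimes> (b [^] (2::int) \<otimes> c [^] (- 2 :: int) \<otimes> d [^] (- j))"
      using b_pow_a[of 2] by (simp add: tri_def)
    moreover have "c [^] (- 2 :: int) = \<one>"
      using cp cG that int_pow_int[of G c 2] by (simp add: int_pow_neg)
    ultimately have "a \<otimes> d [^] s = a \<otimes> (d [^] s \<otimes> d [^] (- j))"
      unfolding b2 using d_commute1(1)[of s] a dG by simp
    then have "a \<otimes> d [^] s \<otimes> d [^] (- j) = a \<otimes> d [^] s" using a dG by (simp add: m_assoc)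
    then have "d [^] (- j) = \<one>" using a dG by (simp add: l_cancel_one)
    then show ?thesis using dvd[of "- j"] by simp
  qed
  then have "admissible p n m j" using p nm by (simp add: admissible_def)
  then show "\<exists>i j r s. admissible p n m j \<and> \<not> (int p dvd i \<and> int p dvd j) \<and> Q p n m i j r s \<cong> G"
    using nz rel_imp_iso_Q[OF rel p0 gen card] by blast
  have lc: "lower_central G 1 = derived G (carrier G)" "lower_central G 2 = Z"
    by (simp_all add: commutator_subgroup_derived Z_def numeral_2_eq_2)
  have "lower_central G 3 = {\<one>}"
    using commutator_subgroup_central[OF Z.subset central] lc(2) by (simp add: numeral_3_eq_3 numeral_2_eq_2)
  \<comment> \<open>A trivial term stays trivial, so nontriviality of \<open>Z\<close>, which has
    index 2 in the shifted numbering, suffices for all earlier terms.\<close>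
  moreover have suc: "lower_central G (Suc k) = {\<one>}" if "lower_central G k = {\<one>}" for k
    using commutator_subgroup_central[of "{\<one>}"] that by simp
  have "lower_central G k \<noteq> {\<one>}" if "k < 3" for k
  proof
    assume k: "lower_central G k = {\<one>}"
    have "k = 0 \<or> k = 1 \<or> k = 2" using that by auto
    then have "lower_central G 2 = {\<one>}"
      using k suc[of 0] suc[of 1] unfolding numeral_2_eq_2 One_nat_def by blast
    then show False using Zne lc(2) by simp
  qed
  ultimately show "has_nilpotency_class G 3" by (simp add: has_nilpotency_class_def)
qed

section \<open>Classification\<close>

lemma not_QuadRes_mult:
  assumes p: "prime p" "2 < p" and a: "\<not> QuadRes (int p) a" and b: "\<not> QuadRes (int p) b"
  shows "QuadRes (int p) (a * b)"
proof (rule ccontr)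
  assume ab: "\<not> QuadRes (int p) (a * b)"
  have L: "[-1 = x ^ ((p - 1) div 2)] (mod int p)" if "\<not> QuadRes (int p) x" for x
  proof -
    have "\<not> [x = 0] (mod int p)"
      using that unfolding QuadRes_def by (metis cong_sym zero_power2)
    then show ?thesis using euler_criterion[OF p, of x] that by (simp add: Legendre_def)
  qed
  have "[(-1) * (-1) = a ^ ((p - 1) div 2) * b ^ ((p - 1) div 2)] (mod int p)"
    by (intro cong_mult L a b)
  then have "[1 = (a * b) ^ ((p - 1) div 2)] (mod int p)" by (simp add: power_mult_distrib)
  then have "[1 = -1] (mod int p)" using L[OF ab] by (meson cong_sym cong_trans)
  then have "int p dvd 2" by (simp add: cong_iff_dvd_diff)
  then show False using p by (auto dest: zdvd_imp_le)
qed

lemma prime_inverse: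
  assumes "prime p" "\<not> int p dvd x"
  obtains y where "int p dvd x * y - 1"
proof -
  have "coprime x (int p)" using assms by (metis coprime_commute prime_imp_coprime prime_nat_int_transfer)
  then show thesis using cong_solve_coprime_int that by (metis cong_iff_dvd_diff)
qed

text \<open>For odd p the units modulo p fall into two classes modulo squares, represented by 1 and
  \<eta>; for p = 2 every unit is 1.\<close>

lemma square_class:
  assumes p: "prime p" and \<eta>: "p \<noteq> 2 \<Longrightarrow> \<not> QuadRes (int p) \<eta>" and E: "\<not> int p dvd E"
  obtains t \<nu> where "\<nu> \<in> nu_values p \<eta>" "int p dvd t\<^sup>2 * E - \<nu>"
proof (cases "p = 2")
  case True
  then show thesis using that[of 1 1] E by (auto simp: nu_values_def)
next
  case False
  then have p2: "2 < p" using p by (metis le_neq_implies_less prime_ge_2_nat)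
  obtain F where F: "int p dvd E * F - 1" using prime_inverse[OF p E] .
  then obtain k where k: "E * F = 1 + int p * k" by (metis diff_add_cancel add.commute dvdE)
  \<comment> \<open>F inverts E, so y^2 = E \<nu> makes t = y / E satisfy t^2 E = \<nu>.\<close>
  have *: "int p dvd (y * F)\<^sup>2 * E - \<nu>" if "[y\<^sup>2 = E * \<nu>] (mod int p)" for y \<nu>
  proof -
    have "(y * F)\<^sup>2 * E - \<nu> = F\<^sup>2 * E * (y\<^sup>2 - E * \<nu>) + (E * F - 1) * \<nu> * (E * F + 1)"
      by (simp add: power2_eq_square algebra_simps)
    then show ?thesis using that F by (simp add: cong_iff_dvd_diff)
  qed
  show thesis
  proof (cases "QuadRes (int p) E")
    case True
    then obtain y where "[y\<^sup>2 = E * 1] (mod int p)" by (auto simp: QuadRes_def)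
    from *[OF this] show thesis by (rule that[rotated]) (simp add: nu_values_def)
  next
    case nE: False
    obtain y where "[y\<^sup>2 = E * \<eta>] (mod int p)"
      using not_QuadRes_mult[OF p p2 nE \<eta>[OF False]] by (auto simp: QuadRes_def)
    from *[OF this] show thesis by (rule that[rotated]) (simp add: nu_values_def False)
  qed
qed

lemma nu_values_unit:
  assumes p: "prime p" and \<eta>: "p \<noteq> 2 \<Longrightarrow> \<not> QuadRes (int p) \<eta>" and \<nu>: "\<nu> \<in> nu_values p \<eta>"
  shows "\<not> int p dvd \<nu>"
proof (cases "\<nu> = 1")
  case True
  then show ?thesis using p prime_gt_1_nat[of p] by auto
next
  case False
  then have "p \<noteq> 2" "\<nu> = \<eta>" using \<nu> by (auto simp: nu_values_def split: if_splits)
  then show ?thesis using \<eta> unfolding QuadRes_def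
    by (metis cong_0_iff cong_sym zero_power2)
qed

lemma nu_values_square_class:
  assumes p: "prime p" and \<eta>: "p \<noteq> 2 \<Longrightarrow> \<not> QuadRes (int p) \<eta>"
    and \<nu>: "\<nu> \<in> nu_values p \<eta>" "\<nu>' \<in> nu_values p \<eta>"
    and xy: "\<not> int p dvd x" "\<not> int p dvd y" "int p dvd x\<^sup>2 * \<nu> - y\<^sup>2 * \<nu>'"
  shows "\<nu> = \<nu>'"
proof (rule ccontr)
  assume "\<nu> \<noteq> \<nu>'"
  then have p2: "p \<noteq> 2" and "\<nu> = 1 \<and> \<nu>' = \<eta> \<or> \<nu> = \<eta> \<and> \<nu>' = 1"
    using \<nu> by (auto simp: nu_values_def split: if_splits)
  \<comment> \<open>By symmetry the value 1 goes with x, exchanging x and y if necessary.\<close>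
  then obtain x y where xy: "\<not> int p dvd y" "int p dvd x\<^sup>2 - y\<^sup>2 * \<eta>"
    using xy by (metis dvd_diff_commute mult.right_neutral)
  obtain Y where Y: "int p dvd y * Y - 1" using prime_inverse[OF p xy(1)] .
  have "(x * Y)\<^sup>2 - \<eta> = Y\<^sup>2 * (x\<^sup>2 - y\<^sup>2 * \<eta>) + (y * Y - 1) * \<eta> * (y * Y + 1)"
    by (simp add: power2_eq_square algebra_simps)
  then have "[(x * Y)\<^sup>2 = \<eta>] (mod int p)" using xy Y by (simp add: cong_iff_dvd_diff)
  then show False using \<eta>[OF p2] by (auto simp: QuadRes_def)
qed

text \<open>A certificate: the difference is an explicit multiple of something known to vanish
  modulo P. The cofactors given in \<open>classification\<close> are found by expanding the
  congruence.\<close>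

lemma cong_by:
  assumes "P dvd (h::int)" "X - Y = c * h" shows "[X = Y] (mod P)"
  using assms by (simp add: cong_iff_dvd_diff)

lemma cong_by2:
  assumes "P dvd (h::int)" "P dvd h'" "X - Y = c * h + c' * h'" shows "[X = Y] (mod P)"
  using assms by (simp add: cong_iff_dvd_diff)

text \<open>(i, j) and (r, s) act as linear forms on exponent vectors modulo p. New generators are
  chosen in the kernels of these forms as far as possible; the remaining scale factors and l
  normalise the surviving coefficients to 1 or \<nu>.\<close>

lemma classification:
  assumes adm: "admissible p n m j" and nz: "\<not> (int p dvd i \<and> int p dvd j)" and 3: "\<not> (p = 3 \<and> n = 1)"
    and \<eta>: "p \<noteq> 2 \<Longrightarrow> \<not> QuadRes (int p) \<eta>"
  shows "\<exists>T i' j' r' s'. listed p \<eta> T \<and> params T = (n, m, i', j', r', s') \<and>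
    (\<exists>\<alpha> \<beta> \<gamma> \<delta> l. basis_change p n m i j r s i' j' r' s' \<alpha> \<beta> \<gamma> \<delta> l)"
proof -
  note p = admissible_p[OF adm]
  let ?P = "int p"
  have I: ?thesis if "listed p \<eta> T" "params T = (n, m, i', j', r', s')"
    "basis_change p n m i j r s i' j' r' s' \<alpha> \<beta> \<gamma> \<delta> l" for T i' j' r' s' \<alpha> \<beta> \<gamma> \<delta> l
    using that by blast
  have unit: "\<not> ?P dvd x * y \<longleftrightarrow> \<not> ?P dvd x \<and> \<not> ?P dvd y" for x y
    using p(4) by (simp add: prime_dvd_mult_iff)
  have inv_unit: "\<not> ?P dvd y" if "?P dvd x * y - 1" for x y
  proof
    assume "?P dvd y"
    then have "?P dvd x * y" by simp
    from dvd_diff[OF this that] have "?P dvd 1" by simp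
    then show False using p(3) by simp
  qed
  define q where "q = ?P ^ (n - m)"
  have bcI: "basis_change p n m i j r s i' j' r' s' \<alpha> \<beta> \<gamma> \<delta> l"
    if "\<not> ?P dvd l" "[(\<alpha> * \<delta> - \<beta> * (q * \<gamma>)) * (i * \<alpha> + j * \<beta>) = l * i'] (mod ?P)"
      "[(\<alpha> * \<delta> - \<beta> * (q * \<gamma>)) * (i * (q * \<gamma>) + j * \<delta>) = l * j'] (mod ?P)"
      "[r * \<alpha> + s * q * \<beta> = l * r'] (mod ?P)"
      "[r * \<gamma> + s * \<delta> + twist p n m (i * \<gamma> * \<delta>) = l * s'] (mod ?P)"
    for \<alpha> \<beta> \<gamma> \<delta> l i' j' r' s'
    using that by (simp add: basis_change_def Let_def q_def)
  show ?thesis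
  proof (cases "n = m")
    case True
    then have q1: "q = 1" by (simp add: q_def)
    have tw: "twist p n m x = 0" for x using True by (simp add: twist_def)
    have m3: "p \<le> 3 \<longrightarrow> m > 1"
    proof
      assume "p \<le> 3"
      then have "p = 2 \<or> p = 3" using p(3) by auto
      then show "m > 1" using 3 True adm p(5) by (auto simp: admissible_def)
    qed
    show ?thesis
    proof (cases "?P dvd r \<and> ?P dvd s")
      case rs: True
      obtain \<alpha> \<beta> where "\<not> ?P dvd i * \<alpha> + j * \<beta>"
        using nz by (metis mult.right_neutral mult_zero_right add.right_neutral add.left_neutral)
      then have l: "\<not> ?P dvd (i * \<alpha> + j * \<beta>) * (i * \<alpha> + j * \<beta>)" by (simp add: unit)
      \<comment> \<open>The second generator (-j, i) spans the kernel of (i, j); the determinant is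
        then i \<alpha> + j \<beta>, whence the square as l.\<close>
      show ?thesis
      proof (rule I[of "G2 m" 1 0 0 0 \<alpha> \<beta> "- j" i "(i * \<alpha> + j * \<beta>) * (i * \<alpha> + j * \<beta>)"], goal_cases)
        case 3
        show ?case
        proof (rule bcI[OF l], goal_cases)
          case 3 show ?case
            by (rule cong_by2[OF conjunct1[OF rs] conjunct2[OF rs], where c = \<alpha> and c' = \<beta>]) (simp add: q1)
        next
          case 4 show ?case
            by (rule cong_by2[OF conjunct1[OF rs] conjunct2[OF rs], where c = "- j" and c' = i]) (simp add: tw)
        qed (simp_all add: q1 algebra_simps)
      qed (use m3 True p in simp_all)
    next
      case rs: False
      show ?thesis
      proof (cases "?P dvd r * j - s * i")
        case dep: True
        show ?thesis
        proof (cases "?P dvd i")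
          case False
          then obtain y where y: "?P dvd i * y - 1" using prime_inverse[OF p(1)] by blast
          have "\<not> ?P dvd r"
          proof
            assume r: "?P dvd r"
            then have "?P dvd r * j" by simp
            from dvd_diff[OF this dep] have "?P dvd s * i" by simp
            then have "?P dvd s" using False p(4) by (simp add: prime_dvd_mult_iff)
            then show False using rs r by simp
          qed
          then have l: "\<not> ?P dvd r * y" using inv_unit[OF y] by (simp add: unit)
          \<comment> \<open>The forms are proportional, so (-s, r) lies in both kernels; y scales
            the first generator to value 1 under (i, j), and l = r y makes r' = 1.\<close>
          show ?thesis
          proof (rule I[of "G3 m" 1 0 1 0 y 0 "- s" r "r * y"], goal_cases)
            case 3
            show ?case
            proof (rule bcI[of "r * y" y r 0 "- s", OF l], goal_cases)
              case 1 show ?case by (rule cong_by[OF y, where c = "r * y"]) (simp add: q1 algebra_simps)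
            next
              case 2 show ?case by (rule cong_by[OF dep, where c = "r * y"]) (simp add: q1 algebra_simps)
            qed (simp_all add: q1 tw)
          qed (use m3 True p in simp_all)
        next
          case i: True
          then have j: "\<not> ?P dvd j" using nz by simp
          then obtain y where y: "?P dvd j * y - 1" using prime_inverse[OF p(1)] by blast
          have "\<not> ?P dvd s"
          proof
            assume s: "?P dvd s"
            then have "?P dvd s * i" by simp
            from dvd_add[OF dep this] have "?P dvd r * j" by simp
            then have "?P dvd r" using j p(4) by (simp add: prime_dvd_mult_iff)
            then show False using rs s by simp
          qed
          then have l: "\<not> ?P dvd s * y" using inv_unit[OF y] by (simp add: unit)
          show ?thesis
          proof (rule I[of "G3 m" 1 0 1 0 0 y "- s" r "s * y"], goal_cases)
            case 3
            show ?case
            proof (rule bcI[of "s * y" 0 r y "- s", OF l], goal_cases)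
              case 1 show ?case by (rule cong_by[OF y, where c = "s * y"]) (simp add: q1 algebra_simps)
            next
              case 2 show ?case by (rule cong_by[OF dep, where c = "s * y"]) (simp add: q1 algebra_simps)
            qed (simp_all add: q1 tw)
          qed (use m3 True p in simp_all)
        qed
      next
        case ind: False
        obtain t \<nu> where t: "\<nu> \<in> nu_values p \<eta>" "?P dvd t\<^sup>2 * (r * j - s * i) - \<nu>"
          using square_class[OF p(1) \<eta> ind] by blast
        \<comment> \<open>The forms are independent: (j, -i) is in the kernel of the first, t (-s,
          r) in that of the second. The determinant of the change is t (r j - s i), so j' becomes
          t^2 (r j - s i).\<close>
        show ?thesis
        proof (rule I[of "G1 m \<nu>" 0 \<nu> 1 0 j "- i" "- t * s" "t * r" "r * j - s * i"], goal_cases)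
          case 3
          show ?case
          proof (rule bcI[of "r * j - s * i" j "t * r" "- i" "- t * s", OF ind], goal_cases)
            case 2 show ?case by (rule cong_by[OF t(2), where c = "r * j - s * i"])
                (simp add: q1 algebra_simps power2_eq_square)
          qed (simp_all add: q1 tw algebra_simps)
        qed (use m3 True p t in simp_all)
      qed
    qed
  next
    case False
    then have mn: "m < n" using p by simp
    have q: "?P dvd q" using mn by (simp add: q_def dvd_power)
    show ?thesis
    proof (cases "p = 2 \<and> m = 1")
      case p2: True
      then have j: "?P dvd j" using adm by (simp add: admissible_def)
      then have "?P dvd i - 1" using nz p2 by auto
      \<comment> \<open>Modulo 2 only \<gamma> is worth varying. It changes s by r \<gamma>, and by
        (r + i) \<gamma> when n = 2; as i is odd, s can be removed exactly for even r when n = 2 and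
        exactly for odd r when n > 2.\<close>
      have twoI: ?thesis if "listed p \<eta> T" "params T = (n, m, 1, 0, r', s')"
        "[r = r'] (mod ?P)" "[r * \<gamma> + s + twist p n m (i * \<gamma>) = s'] (mod ?P)" for T r' s' \<gamma>
      proof (rule I[OF that(1,2)], rule bcI[of 1 1 1 0 \<gamma>], goal_cases)
        case 2 show ?case by (rule cong_by[OF \<open>?P dvd i - 1\<close>, where c = 1]) simp
      next
        case 3 show ?case by (rule cong_by2[OF q j, where c = "i * \<gamma>" and c' = 1]) simp
      qed (use that p in simp_all)
      show ?thesis
      proof (cases "n = 2")
        case n2: True
        have tw: "twist p n m x = x" for x using n2 p2 by (simp add: twist_def)
        have i: "odd i" using \<open>?P dvd i - 1\<close> p2 by simp
        consider "even r" | "odd r" "even s" | "odd r" "odd s" by blast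
        then show ?thesis
        proof cases
          case 1
          show ?thesis by (rule twoI[of H1 0 0 s]) (use p2 n2 1 i in \<open>auto simp: twist_def cong_iff_dvd_diff\<close>)
        next
          case 2
          show ?thesis by (rule twoI[of H2 1 0 0]) (use p2 n2 2 in \<open>auto simp: twist_def cong_iff_dvd_diff\<close>)
        next
          case 3
          show ?thesis by (rule twoI[of H3 1 1 0]) (use p2 n2 3 in \<open>auto simp: twist_def cong_iff_dvd_diff\<close>)
        qed
      next
        case n2: False
        have tw: "twist p n m x = 0" for x using n2 p2 by (simp add: twist_def)
        have n3: "n \<ge> 3" using mn n2 p2 by simp
        consider "even r" "even s" | "even r" "odd s" | "odd r" by blast
        then show ?thesis
        proof cases
          case 1
          show ?thesis by (rule twoI[of "I1 n" 0 0 0]) (use p2 n3 1 in \<open>auto simp: twist_def cong_iff_dvd_diff\<close>)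
        next
          case 2
          show ?thesis by (rule twoI[of "I3 n" 0 1 0]) (use p2 n3 2 in \<open>auto simp: twist_def cong_iff_dvd_diff\<close>)
        next
          case 3
          show ?thesis by (rule twoI[of "I2 n" 1 0 s]) (use p2 n3 3 in \<open>auto simp: twist_def cong_iff_dvd_diff\<close>)
        qed
      qed
    next
      case np2: False
      have tw: "twist p n m x = 0" for x using np2 by (auto simp: twist_def)
      have m2: "p = 2 \<longrightarrow> m > 1" using np2 p by auto
      have L: "m \<ge> 1 \<and> n > m \<and> (p = 2 \<longrightarrow> m > 1)" using p mn m2 by simp
      show ?thesis
      proof (cases "?P dvd j")
        case j: False
        obtain y where y: "?P dvd j * y - 1" using prime_inverse[OF p(1) j] .
        consider "\<not> ?P dvd r" | "?P dvd r" "\<not> ?P dvd s" | "?P dvd r" "?P dvd s" by blast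
        then show ?thesis
        proof cases
          case 1
          then have rj: "\<not> ?P dvd r * j" using j by (simp add: unit)
          obtain t \<nu> where t: "\<nu> \<in> nu_values p \<eta>" "?P dvd t\<^sup>2 * (r * j) - \<nu>"
            using square_class[OF p(1) \<eta> rj] by blast
          \<comment> \<open>As for independent forms with n = m; since q is 0 modulo p, only r j
            survives of the determinant r j - s i.\<close>
          show ?thesis
          proof (rule I[of "J1 n m \<nu>" 0 \<nu> 1 0 j "- i" "- s * t" "r * t" "r * j"], goal_cases)
            case 3
            show ?case
            proof (rule bcI[of "r * j" j "r * t" "- i" "- s * t", OF rj], goal_cases)
              case 2 show ?case
                by (rule cong_by2[OF t(2) q, where c = "r * j" and c' = "t\<^sup>2 * (i\<^sup>2 * q * s\<^sup>2 - 2 * j * r * i * s)"])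
                  (simp add: algebra_simps power2_eq_square)
            next
              case 3 show ?case by (rule cong_by[OF q, where c = "- s * i"]) (simp add: algebra_simps)
            qed (simp_all add: tw algebra_simps)
          qed (use L t in simp_all)
        next
          case 2
          then have l: "\<not> ?P dvd s * s * y * y" using inv_unit[OF y] by (simp add: unit)
          \<comment> \<open>With \<alpha> = j, both j' = 1 and s' = 1 require l = (j \<delta>)^2 = s
            \<delta>, hence \<delta> = s / j^2.\<close>
          show ?thesis
          proof (rule I[of "J3 n m" 0 1 0 1 j "- i" 0 "s * y * y" "s * s * y * y"], goal_cases)
            case 3
            show ?case
            proof (rule bcI[of "s * s * y * y" j "s * y * y" "- i" 0, OF l], goal_cases)
              case 2 show ?case
                by (rule cong_by[OF y, where c = "s * s * y * y * (j * y + 1)"]) (simp add: algebra_simps)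
            next
              case 3 show ?case
                by (rule cong_by2[OF 2(1) q, where c = j and c' = "- s * i"]) (simp add: algebra_simps)
            qed (simp_all add: tw algebra_simps)
          qed (use L in simp_all)
        next
          case 3
          have l: "\<not> ?P dvd j * j" using j by (simp add: unit)
          show ?thesis
          proof (rule I[of "J5 n m" 0 1 0 0 j "- i" 0 1 "j * j"], goal_cases)
            case 3
            show ?case
            proof (rule bcI[of "j * j" j 1 "- i" 0, OF l], goal_cases)
              case 3 show ?case
                by (rule cong_by2[OF \<open>?P dvd r\<close> q, where c = j and c' = "- s * i"]) (simp add: algebra_simps)
            next
              case 4 show ?case by (rule cong_by[OF \<open>?P dvd s\<close>, where c = 1]) (simp add: tw)
            qed (simp_all add: algebra_simps)
          qed (use L in simp_all)
        qed
      next
        case j: True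
        then have i: "\<not> ?P dvd i" using nz by simp
        obtain y where y: "?P dvd i * y - 1" using prime_inverse[OF p(1) i] .
        consider "\<not> ?P dvd r" | "?P dvd r" "\<not> ?P dvd s" | "?P dvd r" "?P dvd s" by blast
        then show ?thesis
        proof cases
          case 1
          then have l: "\<not> ?P dvd r * y" using inv_unit[OF y] by (simp add: unit)
          show ?thesis
          proof (rule I[of "J2 n m" 1 0 1 0 y 0 "- s" r "r * y"], goal_cases)
            case 3
            show ?case
            proof (rule bcI[of "r * y" y r 0 "- s", OF l], goal_cases)
              case 1 show ?case by (rule cong_by[OF y, where c = "r * y"]) (simp add: algebra_simps)
            next
              case 2 show ?case
                by (rule cong_by2[OF q j, where c = "- y * r * i * s" and c' = "y * r * r"]) (simp add: algebra_simps)
            qed (simp_all add: tw algebra_simps)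
          qed (use L in simp_all)
        next
          case 2
          then have si: "\<not> ?P dvd s * i" using i by (simp add: unit)
          obtain t \<nu> where t: "\<nu> \<in> nu_values p \<eta>" "?P dvd t\<^sup>2 * (s * i) - \<nu>"
            using square_class[OF p(1) \<eta> si] by blast
          \<comment> \<open>With \<delta> = 1, s' = 1 requires l = s; \<alpha> = s t then gives i' =
            t^2 s i.\<close>
          show ?thesis
          proof (rule I[of "J4 n m \<nu>" \<nu> 0 0 1 "s * t" 0 0 1 s], goal_cases)
            case 3
            show ?case
            proof (rule bcI[of s "s * t" 1 0 0, OF 2(2)], goal_cases)
              case 1 show ?case
                by (rule cong_by[OF t(2), where c = s]) (simp add: algebra_simps power2_eq_square)
            next
              case 2 show ?case by (rule cong_by[OF j, where c = "s * t"]) simp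
            next
              case 3 show ?case by (rule cong_by[OF 2(1), where c = "s * t"]) simp
            qed (simp_all add: tw)
          qed (use L t in simp_all)
        next
          case 3
          show ?thesis
          proof (rule I[of "J6 n m" 1 0 0 0 1 0 0 1 i], goal_cases)
            case 3
            show ?case
              by (rule bcI[of i 1 1 0 0, OF i]) (use j \<open>?P dvd r\<close> \<open>?P dvd s\<close> in \<open>simp_all add: tw cong_0_iff\<close>)
          qed (use L in simp_all)
        qed
      qed
    qed
  qed
qed

section \<open>Invariants under change of generators\<close>

lemma cong_unit_mult_dvd_iff:
  assumes "prime (P::int)" "[x * u = l * x'] (mod P)" "\<not> P dvd u" "\<not> P dvd l"
  shows "P dvd x' \<longleftrightarrow> P dvd x"
  using assms by (metis cong_dvd_iff prime_dvd_mult_iff)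

lemma basis_change_unit:
  assumes p: "prime p" and bc: "basis_change p n m i j r s i' j' r' s' \<alpha> \<beta> \<gamma> \<delta> l"
    and nz: "\<not> (int p dvd i' \<and> int p dvd j')"
  shows "\<not> int p dvd \<alpha> * \<delta> - \<beta> * (int p ^ (n - m) * \<gamma>)"
proof
  assume "int p dvd \<alpha> * \<delta> - \<beta> * (int p ^ (n - m) * \<gamma>)"
  then have "int p dvd l * i'" "int p dvd l * j'" "\<not> int p dvd l"
    using bc unfolding basis_change_def Let_def by (metis cong_dvd_iff dvd_mult2)+
  then show False using p nz by (simp add: prime_dvd_mult_iff)
qed

text \<open>
  For \<open>n = m\<close> the coefficients form two linear forms \<open>(i, j)\<close> and \<open>(r, s)\<close> on \<open>G/\<Phi>(G)\<close>; their
  determinant is invariant up to squares.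
\<close>

lemma basis_change_invariants_eq:
  assumes p: "prime p" and bc: "basis_change p n n i j r s i' j' r' s' \<alpha> \<beta> \<gamma> \<delta> l"
    and nz: "\<not> (int p dvd i' \<and> int p dvd j')" and n: "p = 2 \<longrightarrow> n > 1"
  obtains x y where "\<not> int p dvd x" "\<not> int p dvd y"
    "[x\<^sup>2 * (r * j - s * i) = y\<^sup>2 * (r' * j' - s' * i')] (mod int p)"
    "int p dvd r' \<and> int p dvd s' \<longleftrightarrow> int p dvd r \<and> int p dvd s"
proof -
  define D where "D = \<alpha> * \<delta> - \<beta> * \<gamma>"
  have D: "\<not> int p dvd D" using basis_change_unit[OF p bc nz] by (simp add: D_def)
  have l: "\<not> int p dvd l"
    and 1: "[D * (i * \<alpha> + j * \<beta>) = l * i'] (mod int p)" and 2: "[D * (i * \<gamma> + j * \<delta>) = l * j'] (mod int p)"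
    and 3: "[r * \<alpha> + s * \<beta> = l * r'] (mod int p)" and 4: "[r * \<gamma> + s * \<delta> = l * s'] (mod int p)"
    using bc n by (auto simp: basis_change_def Let_def D_def twist_def split: if_splits)
  have "[(r * \<alpha> + s * \<beta>) * (D * (i * \<gamma> + j * \<delta>)) - (r * \<gamma> + s * \<delta>) * (D * (i * \<alpha> + j * \<beta>))
      = (l * r') * (l * j') - (l * s') * (l * i')] (mod int p)"
    by (intro cong_diff cong_mult 1 2 3 4)
  also have "(r * \<alpha> + s * \<beta>) * (D * (i * \<gamma> + j * \<delta>)) - (r * \<gamma> + s * \<delta>) * (D * (i * \<alpha> + j * \<beta>))
    = D\<^sup>2 * (r * j - s * i)" by (simp add: D_def algebra_simps power2_eq_square)
  also have "(l * r') * (l * j') - (l * s') * (l * i') = l\<^sup>2 * (r' * j' - s' * i')"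
    by (simp add: algebra_simps power2_eq_square)
  finally have det: "[D\<^sup>2 * (r * j - s * i) = l\<^sup>2 * (r' * j' - s' * i')] (mod int p)" .
  have "int p dvd r' \<and> int p dvd s'" if "int p dvd r \<and> int p dvd s"
  proof -
    have "int p dvd r * \<alpha> + s * \<beta>" "int p dvd r * \<gamma> + s * \<delta>" using that by auto
    then have "int p dvd l * r'" "int p dvd l * s'" using 3 4 by (metis cong_dvd_iff)+
    then show ?thesis using l p by (simp add: prime_dvd_mult_iff)
  qed
  moreover have "int p dvd r \<and> int p dvd s" if "int p dvd r' \<and> int p dvd s'"
  proof -
    have z: "int p dvd r * \<alpha> + s * \<beta>" "int p dvd r * \<gamma> + s * \<delta>" using 3 4 that by (metis cong_dvd_iff dvd_mult)+
    have "int p dvd (r * \<alpha> + s * \<beta>) * \<delta> - (r * \<gamma> + s * \<delta>) * \<beta>" using z by (intro dvd_diff dvd_mult2)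
    also have "(r * \<alpha> + s * \<beta>) * \<delta> - (r * \<gamma> + s * \<delta>) * \<beta> = r * D" by (simp add: D_def algebra_simps)
    finally have r: "int p dvd r" using D p by (simp add: prime_dvd_mult_iff)
    have "int p dvd (r * \<gamma> + s * \<delta>) * \<alpha> - (r * \<alpha> + s * \<beta>) * \<gamma>" using z by (intro dvd_diff dvd_mult2)
    also have "(r * \<gamma> + s * \<delta>) * \<alpha> - (r * \<alpha> + s * \<beta>) * \<gamma> = s * D" by (simp add: D_def algebra_simps)
    finally show ?thesis using r D p by (simp add: prime_dvd_mult_iff)
  qed
  ultimately show thesis using that[OF D l det] by blast
qed

text \<open>Since p divides p^(n-m), the matrix is triangular modulo p and \<alpha>, \<delta> are
  units. Hence j and r only scale, and s does so once r vanishes. For p = 2, m = 1, n = 2 the roles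
  turn around: \<gamma> enters s' with coefficient r + i, which is even when r and i are
  odd.\<close>

lemma basis_change_invariants_less:
  assumes p: "prime p" and bc: "basis_change p n m i j r s i' j' r' s' \<alpha> \<beta> \<gamma> \<delta> l"
    and nz: "\<not> (int p dvd i' \<and> int p dvd j')" and mn: "m < n"
  obtains x y where "\<not> int p dvd x" "\<not> int p dvd y"
    "[x\<^sup>2 * (r * j) = y\<^sup>2 * (r' * j')] (mod int p)"
    "int p dvd j' \<longleftrightarrow> int p dvd j" "int p dvd r' \<longleftrightarrow> int p dvd r"
    "\<not> (p = 2 \<and> m = 1 \<and> n = 2) \<Longrightarrow> int p dvd r \<Longrightarrow> int p dvd s' \<longleftrightarrow> int p dvd s"
    "\<not> (p = 2 \<and> m = 1 \<and> n = 2) \<Longrightarrow> int p dvd r \<Longrightarrow> int p dvd j \<Longrightarrow> [x\<^sup>2 * (i * s) = y\<^sup>2 * (i' * s')] (mod int p)"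
    "p = 2 \<and> m = 1 \<and> n = 2 \<Longrightarrow> odd (r * i) \<Longrightarrow> even s' \<longleftrightarrow> even s"
proof -
  have pp: "prime (int p)" using p by simp
  define q where "q = int p ^ (n - m)"
  have q: "int p dvd q" using mn by (simp add: q_def dvd_power)
  define D where "D = \<alpha> * \<delta>"
  have bc': "\<not> int p dvd l" "[(D - \<beta> * (q * \<gamma>)) * (i * \<alpha> + j * \<beta>) = l * i'] (mod int p)"
      "[(D - \<beta> * (q * \<gamma>)) * (i * (q * \<gamma>) + j * \<delta>) = l * j'] (mod int p)"
      "[r * \<alpha> + s * q * \<beta> = l * r'] (mod int p)"
      "[r * \<gamma> + s * \<delta> + twist p n m (i * \<gamma> * \<delta>) = l * s'] (mod int p)"
    using bc unfolding basis_change_def Let_def q_def D_def by blast+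
  have "\<not> int p dvd D - \<beta> * (q * \<gamma>)"
    using basis_change_unit[OF p bc nz] by (simp add: D_def q_def)
  then have D: "\<not> int p dvd D" using q by (metis dvd_diff dvd_mult dvd_mult2)
  then have u: "\<not> int p dvd \<alpha>" "\<not> int p dvd \<delta>" by (auto simp: D_def)
  have eqD: "[D - \<beta> * (q * \<gamma>) = D] (mod int p)"
    using q by (intro cong_by[where c = "- \<beta> * \<gamma>", OF q]) simp
  have 1: "[D * (i * \<alpha> + j * \<beta>) = l * i'] (mod int p)"
    by (rule cong_trans[OF cong_sym bc'(2)], rule cong_mult[OF eqD cong_refl])
  have "[i * (q * \<gamma>) + j * \<delta> = j * \<delta>] (mod int p)" by (rule cong_by[where c = "i * \<gamma>", OF q]) simp
  then have 2: "[D * (j * \<delta>) = l * j'] (mod int p)"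
    by (intro cong_trans[OF cong_sym bc'(3)] cong_mult[OF eqD])
  have "[r * \<alpha> + s * q * \<beta> = r * \<alpha>] (mod int p)" by (rule cong_by[where c = "s * \<beta>", OF q]) simp
  then have 3: "[r * \<alpha> = l * r'] (mod int p)" by (rule cong_trans[OF cong_sym bc'(4)])
  have J: "[D\<^sup>2 * (r * j) = l\<^sup>2 * (r' * j')] (mod int p)"
    using cong_mult[OF 3 2] by (simp add: D_def power2_eq_square ac_simps)
  have S: "[s * \<delta> = l * s'] (mod int p)" if "\<not> (p = 2 \<and> m = 1 \<and> n = 2)" "int p dvd r"
  proof -
    have "[r * \<gamma> + s * \<delta> + twist p n m (i * \<gamma> * \<delta>) = s * \<delta>] (mod int p)"
      using that by (intro cong_by[where c = \<gamma>, OF that(2)]) (auto simp: twist_def)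
    then show ?thesis by (rule cong_trans[OF cong_sym bc'(5)])
  qed
  show thesis
  proof (rule that[OF D bc'(1) J])
    show "int p dvd r' \<longleftrightarrow> int p dvd r"
      by (rule cong_unit_mult_dvd_iff[OF pp 3 u(1) bc'(1)])
    have "[j * (D * \<delta>) = l * j'] (mod int p)" using 2 by (simp add: ac_simps)
    then show "int p dvd j' \<longleftrightarrow> int p dvd j"
      by (rule cong_unit_mult_dvd_iff[OF pp]) (use D u bc' pp in \<open>auto simp: prime_dvd_mult_iff\<close>)
    assume *: "\<not> (p = 2 \<and> m = 1 \<and> n = 2)" "int p dvd r"
    show "int p dvd s' \<longleftrightarrow> int p dvd s"
      by (rule cong_unit_mult_dvd_iff[OF pp S[OF *] u(2) bc'(1)])
    assume j: "int p dvd j"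
    have "[D * (i * \<alpha> + j * \<beta>) = D * (i * \<alpha>)] (mod int p)" by (rule cong_by[where c = "D * \<beta>", OF j]) (simp add: algebra_simps)
    then have "[D * (i * \<alpha>) = l * i'] (mod int p)" by (rule cong_trans[OF cong_sym 1])
    from cong_mult[OF this S[OF *]] show "[D\<^sup>2 * (i * s) = l\<^sup>2 * (i' * s')] (mod int p)"
      by (simp add: D_def power2_eq_square ac_simps)
  next
    assume *: "p = 2 \<and> m = 1 \<and> n = 2" "odd (r * i)"
    have "even (r * \<gamma> + s * \<delta> + twist p n m (i * \<gamma> * \<delta>)) \<longleftrightarrow> even (l * s')"
      using bc'(5) * by (metis cong_dvd_iff of_nat_numeral)
    moreover have "odd l" "odd \<delta>" "odd r" "odd i" using bc'(1) u * by auto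
    ultimately show "even s' \<longleftrightarrow> even s" using * by (auto simp: twist_def)
  qed
qed

section \<open>Separation of the listed types and the theorem\<close>

lemma listed_facts:
  assumes p: "prime p" and \<eta>: "p \<noteq> 2 \<Longrightarrow> \<not> QuadRes (int p) \<eta>"
    and T: "listed p \<eta> T" "params T = (n, m, i, j, r, s)"
  shows "\<not> (int p dvd i \<and> int p dvd j)" "\<not> (p = 3 \<and> n = 1)"
proof -
  have "\<not> int p dvd 1" using p by auto
  then show "\<not> (int p dvd i \<and> int p dvd j)" "\<not> (p = 3 \<and> n = 1)"
    using T nu_values_unit[OF p \<eta>] by (cases T; auto)+
qed

text \<open>Vanishing of the residues and of r j - s i separates the types. The square class of r j
  - s i recovers \<nu> in \<open>G1\<close>, that of r j in \<open>J1\<close> and that of i s in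
  \<open>J4\<close>.\<close>

lemma listed_group_iso_imp_eq:
  assumes p: "prime p" and \<eta>: "p \<noteq> 2 \<Longrightarrow> \<not> QuadRes (int p) \<eta>"
    and T: "listed p \<eta> T" and T': "listed p \<eta> T'" and iso: "listed_group p T' \<cong> listed_group p T"
  shows "T = T'"
proof -
  obtain n m i j r s where P: "params T = (n, m, i, j, r, s)" by (cases "params T")
  obtain n' m' i' j' r' s' where P': "params T' = (n', m', i', j', r', s')" by (cases "params T'")
  note adm = listed_admissible[OF p T P] and adm' = listed_admissible[OF p T' P']
  note f = listed_facts[OF p \<eta> T P] and f' = listed_facts[OF p \<eta> T' P']
  have "Q p n' m' i' j' r' s' \<cong> Q p n m i j r s"
    using Q_iso_listed_group[OF p T' P'] iso group.iso_sym[OF group_Q[OF adm] Q_iso_listed_group[OF p T P]]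
    by (blast intro: iso_trans)
  from iso_Q_imp_basis_change[OF adm adm' f(1) f'(1) f(2) this]
  obtain \<alpha> \<beta> \<gamma> \<delta> l where nm: "n = n'" "m = m'" and bc: "basis_change p n m i j r s i' j' r' s' \<alpha> \<beta> \<gamma> \<delta> l"
    by blast
  have one: "\<not> int p dvd 1" using p by auto
  note unit = nu_values_unit[OF p \<eta>]
  have sq: "\<nu> = \<nu>'" if "\<nu> \<in> nu_values p \<eta>" "\<nu>' \<in> nu_values p \<eta>" "\<not> int p dvd x" "\<not> int p dvd y"
    "[x\<^sup>2 * \<nu> = y\<^sup>2 * \<nu>'] (mod int p)" for \<nu> \<nu>' x y
    using nu_values_square_class[OF p \<eta> that(1-4)] that(5) by (simp add: cong_iff_dvd_diff)
  show ?thesis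
  proof (cases "n = m")
    case True
    obtain x y where xy: "\<not> int p dvd x" "\<not> int p dvd y"
      "[x\<^sup>2 * (r * j - s * i) = y\<^sup>2 * (r' * j' - s' * i')] (mod int p)"
      "int p dvd r' \<and> int p dvd s' \<longleftrightarrow> int p dvd r \<and> int p dvd s"
      using basis_change_invariants_eq[OF p bc[folded True] f'(1)] adm True by (auto simp: admissible_def)
    have d: "int p dvd r' * j' - s' * i' \<longleftrightarrow> int p dvd r * j - s * i"
      using cong_unit_mult_dvd_iff[of "int p" "r * j - s * i" "x\<^sup>2" "y\<^sup>2" "r' * j' - s' * i'"] xy p
      by (simp add: mult.commute prime_dvd_power_iff)
    have "(\<exists>\<nu>\<in>nu_values p \<eta>. T = G1 m \<nu> \<and> i = 0 \<and> j = \<nu> \<and> r = 1 \<and> s = 0) \<or>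
        T = G2 m \<and> i = 1 \<and> j = 0 \<and> r = 0 \<and> s = 0 \<or> T = G3 m \<and> i = 1 \<and> j = 0 \<and> r = 1 \<and> s = 0"
      using T P True by (cases T) auto
    moreover have "(\<exists>\<nu>\<in>nu_values p \<eta>. T' = G1 m \<nu> \<and> i' = 0 \<and> j' = \<nu> \<and> r' = 1 \<and> s' = 0) \<or>
        T' = G2 m \<and> i' = 1 \<and> j' = 0 \<and> r' = 0 \<and> s' = 0 \<or> T' = G3 m \<and> i' = 1 \<and> j' = 0 \<and> r' = 1 \<and> s' = 0"
      using T' P' True nm by (cases T') auto
    ultimately show ?thesis
      by (elim disjE bexE conjE) (use xy d one unit sq[OF _ _ xy(1,2)] in auto)
  next
    case False
    then have mn: "m < n" using admissible_p[OF adm] by simp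
    obtain x y where xy: "\<not> int p dvd x" "\<not> int p dvd y"
      "[x\<^sup>2 * (r * j) = y\<^sup>2 * (r' * j')] (mod int p)"
      "int p dvd j' \<longleftrightarrow> int p dvd j" "int p dvd r' \<longleftrightarrow> int p dvd r"
      "\<not> (p = 2 \<and> m = 1 \<and> n = 2) \<Longrightarrow> int p dvd r \<Longrightarrow> int p dvd s' \<longleftrightarrow> int p dvd s"
      "\<not> (p = 2 \<and> m = 1 \<and> n = 2) \<Longrightarrow> int p dvd r \<Longrightarrow> int p dvd j \<Longrightarrow> [x\<^sup>2 * (i * s) = y\<^sup>2 * (i' * s')] (mod int p)"
      "p = 2 \<and> m = 1 \<and> n = 2 \<Longrightarrow> odd (r * i) \<Longrightarrow> even s' \<longleftrightarrow> even s"
      using basis_change_invariants_less[OF p bc f'(1) mn] by metis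
    show ?thesis
    proof (cases "p = 2 \<and> m = 1")
      case p2: True
      show ?thesis
      proof (cases "n = 2")
        case True
        have "T = H1 \<and> r = 0 \<or> T = H2 \<and> i = 1 \<and> r = 1 \<and> s = 0 \<or> T = H3 \<and> i = 1 \<and> r = 1 \<and> s = 1"
          using T P True p2 by (cases T) auto
        moreover have "T' = H1 \<and> r' = 0 \<or> T' = H2 \<and> i' = 1 \<and> r' = 1 \<and> s' = 0 \<or> T' = H3 \<and> i' = 1 \<and> r' = 1 \<and> s' = 1"
          using T' P' True p2 nm by (cases T') auto
        ultimately show ?thesis
          by (elim disjE conjE) (use xy(5,8) p2 True in auto)
      next
        case n2: False
        have "T = I1 n \<and> r = 0 \<and> s = 0 \<or> T = I2 n \<and> r = 1 \<or> T = I3 n \<and> r = 0 \<and> s = 1"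
          using T P n2 p2 mn by (cases T) auto
        moreover have "T' = I1 n \<and> r' = 0 \<and> s' = 0 \<or> T' = I2 n \<and> r' = 1 \<or> T' = I3 n \<and> r' = 0 \<and> s' = 1"
          using T' P' n2 p2 mn nm by (cases T') auto
        ultimately show ?thesis
          by (elim disjE conjE) (use xy(5,6) p2 n2 in auto)
      qed
    next
      case np2: False
      have "(\<exists>\<nu>\<in>nu_values p \<eta>. T = J1 n m \<nu> \<and> i = 0 \<and> j = \<nu> \<and> r = 1 \<and> s = 0) \<or> T = J2 n m \<and> j = 0 \<and> r = 1 \<or>
          T = J3 n m \<and> j = 1 \<and> r = 0 \<and> s = 1 \<or>
          (\<exists>\<nu>\<in>nu_values p \<eta>. T = J4 n m \<nu> \<and> i = \<nu> \<and> j = 0 \<and> r = 0 \<and> s = 1) \<or>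
          T = J5 n m \<and> j = 1 \<and> r = 0 \<and> s = 0 \<or> T = J6 n m \<and> j = 0 \<and> r = 0 \<and> s = 0"
        using T P np2 mn by (cases T) auto
      moreover have "(\<exists>\<nu>\<in>nu_values p \<eta>. T' = J1 n m \<nu> \<and> i' = 0 \<and> j' = \<nu> \<and> r' = 1 \<and> s' = 0) \<or> T' = J2 n m \<and> j' = 0 \<and> r' = 1 \<or>
          T' = J3 n m \<and> j' = 1 \<and> r' = 0 \<and> s' = 1 \<or>
          (\<exists>\<nu>\<in>nu_values p \<eta>. T' = J4 n m \<nu> \<and> i' = \<nu> \<and> j' = 0 \<and> r' = 0 \<and> s' = 1) \<or>
          T' = J5 n m \<and> j' = 1 \<and> r' = 0 \<and> s' = 0 \<or> T' = J6 n m \<and> j' = 0 \<and> r' = 0 \<and> s' = 0"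
        using T' P' np2 mn nm by (cases T') auto
      ultimately show ?thesis
        by (elim disjE bexE conjE) (use xy(3-7) np2 one unit sq[OF _ _ xy(1,2)] in auto)
    qed
  qed
qed

text \<open>Type (F) stands for all groups of order 81 and class 3 together, so its separation from
  the list is a statement about every such K.\<close>

theorem theorem4p6:
  fixes p :: nat and \<eta> :: int
  assumes "prime p"
    and "p \<noteq> 2 \<Longrightarrow> \<not> QuadRes (int p) \<eta>"
  shows
    "(\<forall>(G :: ('a, 'b) monoid_scheme) n m.
        finite_p_group p G \<and>
        G\<lparr>carrier := commutator_subgroup G (derived G (carrier G)) (carrier G)\<rparr>
          \<cong> integer_mod_group p \<and>
        frattini (G\<lparr>carrier := derived G (carrier G)\<rparr>) = {\<one>\<^bsub>G\<^esub>} \<and>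
        1 \<le> m \<and> m \<le> n \<and> (p = 2 \<longrightarrow> n > 1) \<and>
        G Mod commutator_subgroup G (derived G (carrier G)) (carrier G) \<cong> M_group p n m
        \<longrightarrow> (p = 3 \<and> maximal_class_81 G) \<or> (\<exists>T. listed p \<eta> T \<and> G \<cong> listed_group p T))
     \<and> (\<forall>T T'. listed p \<eta> T \<and> listed p \<eta> T' \<and> T \<noteq> T'
          \<longrightarrow> \<not> listed_group p T \<cong> listed_group p T')
     \<and> (\<forall>(K :: ('c, 'd) monoid_scheme) T. maximal_class_81 K \<and> listed p \<eta> T
          \<longrightarrow> \<not> K \<cong> listed_group p T)"
proof (intro conjI allI impI)
  fix G :: "('a, 'b) monoid_scheme" and n m
  assume "finite_p_group p G \<and>
        G\<lparr>carrier := commutator_subgroup G (derived G (carrier G)) (carrier G)\<rparr>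
          \<cong> integer_mod_group p \<and>
        frattini (G\<lparr>carrier := derived G (carrier G)\<rparr>) = {\<one>\<^bsub>G\<^esub>} \<and>
        1 \<le> m \<and> m \<le> n \<and> (p = 2 \<longrightarrow> n > 1) \<and>
        G Mod commutator_subgroup G (derived G (carrier G)) (carrier G) \<cong> M_group p n m"
  then have H: "finite_p_group p G" "G\<lparr>carrier := commutator_subgroup G (derived G (carrier G)) (carrier G)\<rparr>
          \<cong> integer_mod_group p" "frattini (G\<lparr>carrier := derived G (carrier G)\<rparr>) = {\<one>\<^bsub>G\<^esub>}"
    "1 \<le> m" "m \<le> n" "p = 2 \<longrightarrow> n > 1"
    "G Mod commutator_subgroup G (derived G (carrier G)) (carrier G) \<cong> M_group p n m"
    by blast+
  obtain i j r s where adm: "admissible p n m j" and nz: "\<not> (int p dvd i \<and> int p dvd j)"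
    and Q: "Q p n m i j r s \<cong> G"
    using reduction(1)[OF assms(1) H] by blast
  have gG: "group G" using H(1) by (simp add: finite_p_group_def)
  have ord: "order G = p ^ (n + m + 2)"
    using iso_same_card[OF Q] card_Q[OF admissible_p(2)[OF adm]] by (simp only: order_def)
  show "(p = 3 \<and> maximal_class_81 G) \<or> (\<exists>T. listed p \<eta> T \<and> G \<cong> listed_group p T)"
  proof (cases "p = 3 \<and> n = 1")
    case True
    then have "m = 1" using H by simp
    then show ?thesis
      using True ord gG reduction(2)[OF assms(1) H] by (simp add: maximal_class_81_def)
  next
    case False
    obtain T i' j' r' s' \<alpha> \<beta> \<gamma> \<delta> l where T: "listed p \<eta> T" "params T = (n, m, i', j', r', s')"
      and bc: "basis_change p n m i j r s i' j' r' s' \<alpha> \<beta> \<gamma> \<delta> l"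
      using classification[OF adm nz False, of \<eta> r s] assms(2) by blast
    have "Q p n m i' j' r' s' \<cong> Q p n m i j r s"
      by (rule basis_change_imp_iso_Q[OF adm False listed_facts(1)[OF assms T] bc])
    then have "Q p n m i' j' r' s' \<cong> G" using Q by (rule iso_trans)
    then have "G \<cong> Q p n m i' j' r' s'"
      using group.iso_sym group_Q[OF listed_admissible[OF assms(1) T]] by blast
    then have "G \<cong> listed_group p T"
      using Q_iso_listed_group[OF assms(1) T] by (rule iso_trans)
    then show ?thesis using T by blast
  qed
next
  fix T T' assume "listed p \<eta> T \<and> listed p \<eta> T' \<and> T \<noteq> T'"
  then show "\<not> listed_group p T \<cong> listed_group p T'"
    using listed_group_iso_imp_eq[OF assms, of T' T] by blast
next
  fix K :: "('c, 'd) monoid_scheme" and T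
  assume KT: "maximal_class_81 K \<and> listed p \<eta> T"
  show "\<not> K \<cong> listed_group p T"
  proof
    assume K: "K \<cong> listed_group p T"
    obtain n m i j r s where P: "params T = (n, m, i, j, r, s)" by (cases "params T")
    have T: "listed p \<eta> T" using KT by simp
    note adm = admissible_p[OF listed_admissible[OF assms(1) T P]]
    \<comment> \<open>Order 81 forces p = 3 and n = m = 1, which the conditions on the listed
      parameters exclude.\<close>
    have "p ^ (n + m + 2) = 3 ^ 4"
      using iso_same_card[OF K] iso_same_card[OF Q_iso_listed_group[OF assms(1) T P]] KT card_Q[OF adm(2)]
      by (simp only: maximal_class_81_def order_def)
    moreover from this have "p dvd 3 ^ 4" by (metis dvd_power add_gr_0 zero_less_numeral)
    then have p3: "p dvd 3" by (rule prime_dvd_power[OF adm(1)])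
    then have "p = 2 \<or> p = 3" using dvd_imp_le[OF p3] adm(3) by auto
    then have "p = 3" using p3 by auto
    ultimately have "(3::nat) ^ (n + m + 2) = 3 ^ 4" by simp
    then have "n + m + 2 = 4" by (simp only: power_inject_exp)
    then have "n = 1" using adm(5,6) by linarith
    then show False using listed_facts(2)[OF assms T P] \<open>p = 3\<close> by simp
  qed
qed

end
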